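(* Let $\{Y_t\}_{t\ge0}$ be the stationary Lévy-driven Ornstein-Uhlenbeck process described in the context, with true mean-reversion parameter $\lambda_o>0$, and let $d\ge0$ be fixed. Let $K$ be a compact subset of $\mathbb{R}_+=[0,\infty)$ such that $\lambda_o\in K$, and let $$\hat\lambda_n=\operatorname*{argmin}_{\lambda\in K}\ \sum_{h=1}^d\bigl(\hat\rho_n(h)-e^{-\lambda h}\bigr)^2 .$$ Then $\hat\lambda_n$ exists, is locally unique, and $$\hat\lambda_n\longrightarrow\lambda_o\quad\text{almost surely as } n\to\infty .$$
   Context: Setting: $\{L_t\}_{t\ge0}$ is a one-dimensional càdlàg Lévy process whose Lévy measure $F_L$ satisfies, for some constant $M>0$, $\int_{|x|>1}e^{vx}F_L(dx)<\infty$ for every real $|v|\le M$. The process $Y$ is $$Y_t=e^{-\lambda_o t}Y_0+e^{-\lambda_o t}\int_0^{\lambda_o t}e^{s}\,dL_s,\qquad t\ge0,$$ where $Y_0$ is independent of $\{L_t\}_{t\ge0}$ and has the same distribution as $\int_0^\infty e^{-s}dL_s$ (so $Y$ is strictly stationary). Empirical autocorrelations, from the observations $Y_1,\dots,Y_n$ at integer times, for $h\in\{0,\dots,d\}$: $\bar Y_\cdot=\frac1n\sum_{i=1}^nY_i$, $\hat\gamma_n(h)=\frac1n\sum_{i=1}^{n-h}(Y_{i+h}-\bar Y_\cdot)(Y_i-\bar Y_\cdot)$, $\hat\rho_n(h)=\hat\gamma_n(h)/\hat\gamma_n(0)$.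
   Formalization: Local uniqueness and convergence are stated only for d≥1, since for d=0 the objective is an empty sum and every point of K is a minimiser; L_1 is assumed not almost surely constant, since otherwise Y is constant and the empirical autocorrelations are 0/0. *)

theory Defs
  imports "HOL-Probability.Probability"
begin

definition cadlag :: "(real \<Rightarrow> real) \<Rightarrow> bool" where
  "cadlag f \<longleftrightarrow>
     (\<forall>t\<ge>0. (f \<longlongrightarrow> f t) (at_right t)) \<and>
     (\<forall>t>0. \<exists>l. (f \<longlongrightarrow> l) (at_left t))"

text \<open>The time set is the half-line of nonnegative reals; values \<open>L t\<close> with \<open>t < 0\<close> play no role.\<close>

definition levy_process :: "'a measure \<Rightarrow> (real \<Rightarrow> 'a \<Rightarrow> real) \<Rightarrow> bool" where
  "levy_process P L \<longleftrightarrow>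
     prob_space P \<and>
     (\<forall>t\<ge>0. L t \<in> borel_measurable P) \<and>
     (AE \<omega> in P. L 0 \<omega> = 0) \<and>
     (\<forall>(t :: nat \<Rightarrow> real) n. 0 \<le> t 0 \<and> mono t \<longrightarrow>
        prob_space.indep_vars P (\<lambda>_. borel) (\<lambda>i \<omega>. L (t (Suc i)) \<omega> - L (t i) \<omega>) {..<n}) \<and>
     (\<forall>s\<ge>0. \<forall>t\<ge>0. distr P borel (\<lambda>\<omega>. L (s + t) \<omega> - L s \<omega>) = distr P borel (L t)) \<and>
     (AE \<omega> in P. cadlag (\<lambda>t. L t \<omega>))"

text \<open>The Levy-Khintchine exponent with drift \<open>b\<close>, Gaussian variance \<open>c\<close>, Levy measure \<open>F\<close>
  and truncation function \<open>x \<mapsto> x 1\<^bsub>|x| \<le> 1\<^esub>\<close>.\<close>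

definition levy_exponent :: "real \<Rightarrow> real \<Rightarrow> real measure \<Rightarrow> real \<Rightarrow> complex" where
  "levy_exponent b c F u =
     \<i> * of_real (b * u) - of_real (c * u\<^sup>2 / 2) +
     (CLINT x|F. iexp (u * x) - 1 - \<i> * of_real (u * x * indicator {-1..1} x))"

definition is_levy_measure :: "'a measure \<Rightarrow> (real \<Rightarrow> 'a \<Rightarrow> real) \<Rightarrow> real measure \<Rightarrow> bool" where
  "is_levy_measure P L F \<longleftrightarrow>
     sets F = sets borel \<and> emeasure F {0} = 0 \<and> integrable F (\<lambda>x. min 1 (x\<^sup>2)) \<and>
     (\<exists>b c. 0 \<le> c \<and>
        (\<forall>t\<ge>0. \<forall>u. char (distr P borel (L t)) u = exp (of_real t * levy_exponent b c F u)))"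

text \<open>The classical Riemann-Stieltjes integral of \<open>f\<close> with respect to \<open>g\<close> over \<open>[a, b]\<close>: tagged
  Riemann sums converge as the mesh tends to zero.  For a continuously differentiable \<open>f\<close> it exists
  along every cadlag \<open>g\<close> (integration by parts).  As left-point sums converge in probability
  to the stochastic integral, for such deterministic integrands the pathwise integral is a version
  of the stochastic integral with respect to a cadlag semimartingale.\<close>

definition has_RS_integral ::
    "(real \<Rightarrow> real) \<Rightarrow> (real \<Rightarrow> real) \<Rightarrow> real \<Rightarrow> real \<Rightarrow> real \<Rightarrow> bool" where
  "has_RS_integral f g a b I \<longleftrightarrow>
     (\<forall>\<epsilon>>0. \<exists>\<delta>>0. \<forall>p. p tagged_division_of {a..b} \<and> (\<forall>(x, J)\<in>p. Sup J - Inf J < \<delta>) \<longrightarrow>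
        \<bar>(\<Sum>(x, J)\<in>p. f x * (g (Sup J) - g (Inf J))) - I\<bar> < \<epsilon>)"

definition RS_integral :: "(real \<Rightarrow> real) \<Rightarrow> (real \<Rightarrow> real) \<Rightarrow> real \<Rightarrow> real \<Rightarrow> real" where
  "RS_integral f g a b = (THE I. has_RS_integral f g a b I)"

text \<open>In the following, \<open>y i\<close> is the observation at time \<open>i\<close>, used for \<open>1 \<le> i \<le> n\<close>.\<close>

definition emp_mean :: "nat \<Rightarrow> (nat \<Rightarrow> real) \<Rightarrow> real" where
  "emp_mean n y = (\<Sum>i=1..n. y i) / real n"

definition emp_acov :: "nat \<Rightarrow> (nat \<Rightarrow> real) \<Rightarrow> nat \<Rightarrow> real" where
  "emp_acov n y h = (\<Sum>i=1..n - h. (y (i + h) - emp_mean n y) * (y i - emp_mean n y)) / real n"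

definition emp_acorr :: "nat \<Rightarrow> (nat \<Rightarrow> real) \<Rightarrow> nat \<Rightarrow> real" where
  "emp_acorr n y h = emp_acov n y h / emp_acov n y 0"

definition acf_loss :: "nat \<Rightarrow> nat \<Rightarrow> (nat \<Rightarrow> real) \<Rightarrow> real \<Rightarrow> real" where
  "acf_loss d n y l = (\<Sum>h=1..d. (emp_acorr n y h - exp (- l * real h))\<^sup>2)"

text \<open>\<open>l\<close> is a value of the estimator computed from \<open>y 1, \<dots>, y n\<close>; the minimiser over \<open>K\<close> need not
  be unique, so this is a relation.\<close>

definition is_acf_estimate :: "real set \<Rightarrow> nat \<Rightarrow> nat \<Rightarrow> (nat \<Rightarrow> real) \<Rightarrow> real \<Rightarrow> bool" where
  "is_acf_estimate K d n y l \<longleftrightarrow> is_arg_min (acf_loss d n y) (\<lambda>l. l \<in> K) l"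

end

theory Submission
  imports Defs "HOL-Library.Discrete_Functions" "HOL-Real_Asymp.Real_Asymp"
begin

text \<open>
  At integer times \<open>Y\<close> satisfies the AR(1) recursion \<open>Y (i + 1) = a * Y i + X i\<close> with \<open>a = exp (- lambda\<^sub>o)\<close>,
  where the innovations \<open>X i\<close> are a.s. limits of Riemann--Stieltjes sums over disjoint blocks of increments
  of \<open>L\<close>, hence i.i.d.  Their characteristic function is a limit of exponentials of Riemann sums of the
  Levy exponent, which yields finite second moments and nondegeneracy.  Writing \<open>z\<close> and \<open>e\<close> for the
  centred observations and innovations, multiplying the recursion by \<open>z\<close> gives
  \<open>acov (h + 1) = a * acov h + o(1)\<close>, because \<open>e (i + h) * z i\<close> are orthogonal up to the negligible
  contribution of the initial value, and \<open>acov 0\<close> stays bounded away from \<open>0\<close>.  Hence the empirical autocorrelations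
  converge to \<open>a ^ h\<close> a.s.  Finally the loss at the minimiser is at most the loss at \<open>lambda\<^sub>o\<close>, which
  tends to \<open>0\<close>, and already the summand \<open>h = 1\<close> forces convergence.
\<close>

section \<open>Existence of Riemann--Stieltjes integrals against cadlag functions\<close>

text \<open>The only law of large numbers available here is the one for orthogonal sequences with
  bounded second moments, and this shapes the argument. A limit theorem for the squared observations
  would ask for fourth moments, so \<open>emp_acov n y 0\<close> is never shown to converge. It is
  only bounded below, by way of the truncated squares \<open>min ((e i)\<^sup>2) 1\<close>, and the
  ratio is treated through the numerator minus \<open>a ^ h\<close> times the denominator. The cross
  terms, in contrast, have bounded second moments: once the initial value is split off, their two
  factors are independent. The law of the innovations is never computed. Inequalities for the
  characteristic functions of the approximating sums, uniform in the mesh, survive the limit: a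
  quadratic bound on \<open>1 - Re char\<close> near 0 gives the second moment, and a modulus below
  1 at a single point excludes constants. The second bound needs grids with a fixed fraction of
  cells near the right end of a block, which is why grid sizes are multiples
  \<open>m * Suc N\<close> of a free \<open>m\<close>.\<close>

definition rs_sum :: "(real \<Rightarrow> real) \<Rightarrow> (real \<Rightarrow> real) \<Rightarrow> (real \<times> real set) set \<Rightarrow> real" where
  "rs_sum f g p = (\<Sum>(x, J)\<in>p. f x * (g (Sup J) - g (Inf J)))"

definition rs_fine :: "real \<Rightarrow> (real \<times> real set) set \<Rightarrow> bool" where
  "rs_fine \<delta> p \<longleftrightarrow> (\<forall>(x, J)\<in>p. Sup J - Inf J < \<delta>)"

lemma has_RS_integral_alt:
  "has_RS_integral f g a b I \<longleftrightarrow>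
     (\<forall>\<epsilon>>0. \<exists>\<delta>>0. \<forall>p. p tagged_division_of {a..b} \<and> rs_fine \<delta> p \<longrightarrow> \<bar>rs_sum f g p - I\<bar> < \<epsilon>)"
  by (simp add: has_RS_integral_def rs_sum_def rs_fine_def)

lemma rs_fine_mono: "rs_fine \<delta> p \<Longrightarrow> \<delta> \<le> \<delta>' \<Longrightarrow> rs_fine \<delta>' p"
  by (fastforce simp: rs_fine_def)

lemma tagged_division_cell:
  fixes a b :: real
  assumes "p tagged_division_of {a..b}" "(x, J) \<in> p"
  obtains u v where "J = {u..v}" "Sup J = v" "Inf J = u" "u \<le> x" "x \<le> v" "a \<le> u" "v \<le> b"
proof -
  obtain u v where J: "J = cbox u v"
    using tagged_division_ofD(4)[OF assms] by blast
  have "x \<in> J" "J \<subseteq> {a..b}"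
    using tagged_division_ofD(2,3)[OF assms] by auto
  with J have "u \<le> x" "x \<le> v" "a \<le> u" "v \<le> b" by auto
  with J show thesis by (intro that[of u v]) auto
qed

lemma rs_sum_const:
  fixes a b :: real
  assumes "a \<le> b" "p tagged_division_of {a..b}"
  shows "(\<Sum>(x, J)\<in>p. c * (g (Sup J) - g (Inf J))) = c * (g b - g a :: real)"
  unfolding additive_tagged_division_1[OF assms, of g, symmetric] sum_distrib_left
  by (intro sum.cong) auto

text \<open>Summation by parts bounds the sums by the sup norm of the integrator.\<close>

lemma rs_sum_bound:
  assumes ab: "a \<le> b" and p: "p tagged_division_of {a..b}" and f: "mono_on {a..b} f"
    and g: "\<And>s. s \<in> {a..b} \<Longrightarrow> \<bar>g s\<bar> \<le> e"
  shows "\<bar>rs_sum f g p\<bar> \<le> e * (\<bar>f a\<bar> + \<bar>f b\<bar> + (f b - f a))"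
proof -
  \<comment> \<open>Summation by parts: \<open>f x * (g v - g u)\<close> is the telescoping
    increment of \<open>f * g\<close> minus \<open>r\<close>. The tag splits the increment of
    \<open>f\<close> over a cell into two nonnegative pieces, so the remainders add up to at most
    \<open>e\<close> times the variation of \<open>f\<close>.\<close>
  define r where "r x J = (f (Sup J) - f x) * g (Sup J) + (f x - f (Inf J)) * g (Inf J)" for x :: real and J
  have "rs_sum f g p = (\<Sum>(x, J)\<in>p. (f (Sup J) * g (Sup J) - f (Inf J) * g (Inf J)) - r x J)"
    unfolding rs_sum_def r_def by (intro sum.cong) (auto simp: algebra_simps)
  also have "\<dots> = (f b * g b - f a * g a) - (\<Sum>(x, J)\<in>p. r x J)"
    using rs_sum_const[OF ab p, of 1 "\<lambda>s. f s * g s"]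
    by (simp add: sum_subtractf case_prod_unfold)
  finally have 1: "rs_sum f g p = (f b * g b - f a * g a) - (\<Sum>(x, J)\<in>p. r x J)" .
  have "\<bar>\<Sum>(x, J)\<in>p. r x J\<bar> \<le> (\<Sum>(x, J)\<in>p. \<bar>r x J\<bar>)"
    using sum_abs[of "\<lambda>(x, J). r x J" p] by (simp add: case_prod_unfold)
  also have "\<dots> \<le> (\<Sum>(x, J)\<in>p. e * (f (Sup J) - f (Inf J)))"
  proof (intro sum_mono, safe)
    fix x J assume "(x, J) \<in> p"
    from p this obtain u v where J: "Sup J = v" "Inf J = u" "u \<le> x" "x \<le> v" "a \<le> u" "v \<le> b"
      by (rule tagged_division_cell) 
    have f1: "f x \<le> f v" "f u \<le> f x"
      using J by (auto intro!: mono_onD[OF f])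
    have "\<bar>r x J\<bar> \<le> (f v - f x) * \<bar>g v\<bar> + (f x - f u) * \<bar>g u\<bar>"
      unfolding r_def J using f1 by (intro order.trans[OF abs_triangle_ineq]) (simp add: abs_mult)
    also have "\<dots> \<le> (f v - f x) * e + (f x - f u) * e"
      using J f1 by (intro add_mono mult_left_mono g) auto
    finally show "\<bar>r x J\<bar> \<le> e * (f (Sup J) - f (Inf J))"
      by (simp add: J algebra_simps)
  qed
  also have "\<dots> = e * (f b - f a)"
    by (rule rs_sum_const[OF ab p])
  finally have 2: "\<bar>\<Sum>(x, J)\<in>p. r x J\<bar> \<le> e * (f b - f a)" .
  have "\<bar>f b * g b\<bar> \<le> \<bar>f b\<bar> * e" "\<bar>f a * g a\<bar> \<le> \<bar>f a\<bar> * e"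
    using ab by (auto simp: abs_mult intro!: mult_left_mono g)
  with 1 2 show ?thesis by (simp add: algebra_simps)
qed

lemma has_RS_integral_add:
  assumes "has_RS_integral f g a b I" "has_RS_integral f h a b J"
  shows "has_RS_integral f (\<lambda>s. g s + h s) a b (I + J)"
  unfolding has_RS_integral_alt
proof (intro allI impI)
  fix e :: real assume "e > 0"
  then have "e / 2 > 0" by simp
  obtain d1 where d1: "d1 > 0"
    "\<And>p. p tagged_division_of {a..b} \<Longrightarrow> rs_fine d1 p \<Longrightarrow> \<bar>rs_sum f g p - I\<bar> < e / 2"
    using assms(1)[unfolded has_RS_integral_alt, rule_format, OF \<open>e / 2 > 0\<close>] by auto
  obtain d2 where d2: "d2 > 0"
    "\<And>p. p tagged_division_of {a..b} \<Longrightarrow> rs_fine d2 p \<Longrightarrow> \<bar>rs_sum f h p - J\<bar> < e / 2"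
    using assms(2)[unfolded has_RS_integral_alt, rule_format, OF \<open>e / 2 > 0\<close>] by auto
  note d = d1(1) d2(1) d1(2) d2(2)
  have "\<bar>rs_sum f (\<lambda>s. g s + h s) p - (I + J)\<bar> < e"
    if p: "p tagged_division_of {a..b}" "rs_fine (min d1 d2) p" for p
  proof -
    have "rs_sum f (\<lambda>s. g s + h s) p = rs_sum f g p + rs_sum f h p"
      unfolding rs_sum_def sum.distrib[symmetric] by (intro sum.cong) (auto simp: algebra_simps)
    moreover have "\<bar>rs_sum f g p - I\<bar> < e / 2" "\<bar>rs_sum f h p - J\<bar> < e / 2"
      by (rule d; use p in \<open>auto intro: rs_fine_mono\<close>)+
    ultimately show ?thesis by linarith
  qed
  then show "\<exists>\<delta>>0. \<forall>p. p tagged_division_of {a..b} \<and> rs_fine \<delta> p \<longrightarrow>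
      \<bar>rs_sum f (\<lambda>s. g s + h s) p - (I + J)\<bar> < e"
    using d by (intro exI[of _ "min d1 d2"]) auto
qed

lemma has_RS_integral_cmult:
  assumes "has_RS_integral f g a b I"
  shows "has_RS_integral f (\<lambda>s. c * g s) a b (c * I)"
  unfolding has_RS_integral_alt
proof (intro allI impI)
  fix e :: real assume "e > 0"
  then have "e / (\<bar>c\<bar> + 1) > 0" by simp
  with assms obtain d where d: "d > 0"
    "\<And>p. p tagged_division_of {a..b} \<Longrightarrow> rs_fine d p \<Longrightarrow> \<bar>rs_sum f g p - I\<bar> < e / (\<bar>c\<bar> + 1)"
    unfolding has_RS_integral_alt by meson
  have "\<bar>rs_sum f (\<lambda>s. c * g s) p - c * I\<bar> < e"
    if p: "p tagged_division_of {a..b}" "rs_fine d p" for p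
  proof -
    have "rs_sum f (\<lambda>s. c * g s) p = c * rs_sum f g p"
      unfolding rs_sum_def sum_distrib_left by (intro sum.cong) (auto simp: algebra_simps)
    then have "\<bar>rs_sum f (\<lambda>s. c * g s) p - c * I\<bar> = \<bar>c\<bar> * \<bar>rs_sum f g p - I\<bar>"
      by (simp add: abs_mult[symmetric] algebra_simps)
    also have "\<dots> \<le> (\<bar>c\<bar> + 1) * \<bar>rs_sum f g p - I\<bar>"
      by (intro mult_right_mono) auto
    also have "\<dots> < (\<bar>c\<bar> + 1) * (e / (\<bar>c\<bar> + 1))"
      by (intro mult_strict_left_mono d p) auto
    finally show ?thesis by simp
  qed
  then show "\<exists>\<delta>>0. \<forall>p. p tagged_division_of {a..b} \<and> rs_fine \<delta> p \<longrightarrow>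
      \<bar>rs_sum f (\<lambda>s. c * g s) p - c * I\<bar> < e"
    using d by auto
qed

text \<open>Only a cell with \<open>Inf J < t \<le> Sup J\<close> sees the jump, and its tag lies
  within the mesh of \<open>t\<close>. The increments of the indicator are nonnegative and telescope
  to at most 1, so the error is at most the oscillation of \<open>f\<close> at the scale of the
  mesh.\<close>

lemma has_RS_integral_jump:
  assumes ab: "a \<le> b" and f: "continuous_on {a..b} f"
  shows "has_RS_integral f (indicator {t..}) a b (f t * (indicator {t..} b - indicator {t..} a))"
  unfolding has_RS_integral_alt
proof (intro allI impI)
  fix e :: real assume e: "e > 0"
  let ?h = "indicator {t..} :: real \<Rightarrow> real"
  have "uniformly_continuous_on {a..b} f"
    using f by (rule compact_uniformly_continuous) simp
  then obtain d where d: "d > 0"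
    "\<And>x y. x \<in> {a..b} \<Longrightarrow> y \<in> {a..b} \<Longrightarrow> \<bar>x - y\<bar> < d \<Longrightarrow> \<bar>f x - f y\<bar> < e / 2"
    using e by (auto elim!: uniformly_continuous_onE[of _ _ "e / 2"] simp: dist_real_def)
  have "\<bar>rs_sum f ?h p - f t * (?h b - ?h a)\<bar> < e"
    if p: "p tagged_division_of {a..b}" "rs_fine d p" for p
  proof -
    have "f t * (?h b - ?h a) = (\<Sum>(x, J)\<in>p. f t * (?h (Sup J) - ?h (Inf J)))"
      by (rule rs_sum_const[OF ab p(1), symmetric])
    then have "rs_sum f ?h p - f t * (?h b - ?h a) =
        (\<Sum>(x, J)\<in>p. (f x - f t) * (?h (Sup J) - ?h (Inf J)))"
      unfolding rs_sum_def
      by (simp add: sum_subtractf[symmetric] case_prod_unfold left_diff_distrib)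
    also have "\<bar>\<dots>\<bar> \<le> (\<Sum>(x, J)\<in>p. \<bar>(f x - f t) * (?h (Sup J) - ?h (Inf J))\<bar>)"
      by (rule order.trans[OF sum_abs]) (simp add: case_prod_unfold)
    also have "\<dots> \<le> (\<Sum>(x, J)\<in>p. e / 2 * (?h (Sup J) - ?h (Inf J)))"
    proof (intro sum_mono, safe)
      fix x J assume xJ: "(x, J) \<in> p"
      from p(1) xJ obtain u v where J: "Sup J = v" "Inf J = u" "u \<le> x" "x \<le> v" "a \<le> u" "v \<le> b"
        by (rule tagged_division_cell) 
      have uv: "v - u < d"
        using p(2) xJ J unfolding rs_fine_def by fastforce
      show "\<bar>(f x - f t) * (?h (Sup J) - ?h (Inf J))\<bar> \<le> e / 2 * (?h (Sup J) - ?h (Inf J))"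
      proof (cases "u < t \<and> t \<le> v")
        case True
        then have "\<bar>f x - f t\<bar> < e / 2" using J uv by (intro d) auto
        with True show ?thesis by (simp add: J)
      next
        case False
        with J show ?thesis by (auto simp: indicator_def)
      qed
    qed
    also have "\<dots> = e / 2 * (?h b - ?h a)"
      by (rule rs_sum_const[OF ab p(1)])
    also have "\<dots> \<le> e / 2" using e by (simp add: indicator_def)
    finally show ?thesis using e by linarith
  qed
  then show "\<exists>\<delta>>0. \<forall>p. p tagged_division_of {a..b} \<and> rs_fine \<delta> p \<longrightarrow>
      \<bar>rs_sum f ?h p - f t * (?h b - ?h a)\<bar> < e"
    using d by auto
qed

text \<open>\<open>G\<close> is a step function, found by a compactness argument from the one-sided
  limits of \<open>g\<close>. Only the existence of the integral of \<open>f\<close> against it is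
  recorded, since this and the uniform error are all that the Cauchy estimate uses.\<close>

lemma cadlag_uniform_approx:
  assumes g: "cadlag g" and T: "0 \<le> T" and e: "0 < e"
    and f: "continuous_on {0..T} f"
  obtains G I where "has_RS_integral f G 0 T I" "\<And>s. s \<in> {0..T} \<Longrightarrow> \<bar>g s - G s\<bar> \<le> e"
proof -
  define H where "H G \<longleftrightarrow> (\<exists>I. has_RS_integral f G 0 T I)" for G
  have H_add: "H (\<lambda>s. G1 s + G2 s)" if "H G1" "H G2" for G1 G2
    using that has_RS_integral_add unfolding H_def by blast
  have H_jump: "H (\<lambda>s. c * indicator {t..} s)" for c t
    using has_RS_integral_cmult[OF has_RS_integral_jump[OF T f]] unfolding H_def by blast
  have H_int: "H (\<lambda>s. c * indicator {u..<v} s)" if "u \<le> v" for c u v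
  proof -
    have "(\<lambda>s. c * indicator {u..<v} s) = (\<lambda>s. c * indicator {u..} s + (- c) * indicator {v..} s)"
        using that by (auto simp: indicator_def fun_eq_iff)
    then show ?thesis using H_add[OF H_jump[of c u] H_jump[of "- c" v]] by simp
  qed
  \<comment> \<open>The cells are half-open and \<open>G\<close> vanishes outside, so that
    approximants on adjacent cells can simply be added. The guard \<open>0 \<le> u\<close> is there
    because \<open>cadlag\<close> does not constrain negative times.\<close>
  define Q where "Q u v \<longleftrightarrow> 0 \<le> u \<longrightarrow>
    (\<exists>G. H G \<and> (\<forall>s\<in>{u..<v}. \<bar>g s - G s\<bar> \<le> e) \<and> (\<forall>s. s \<notin> {u..<v} \<longrightarrow> G s = 0))" for u v
  from T have "Q 0 T"
  proof (induct rule: Bolzano)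
    case (trans u v w)
    show ?case unfolding Q_def
    proof
      assume "0 \<le> u"
      then have "0 \<le> v" using trans(3) by simp
      obtain G1 where G1: "H G1" "\<forall>s\<in>{u..<v}. \<bar>g s - G1 s\<bar> \<le> e" "\<forall>s. s \<notin> {u..<v} \<longrightarrow> G1 s = 0"
        using trans(1) \<open>0 \<le> u\<close> unfolding Q_def by blast
      obtain G2 where G2: "H G2" "\<forall>s\<in>{v..<w}. \<bar>g s - G2 s\<bar> \<le> e" "\<forall>s. s \<notin> {v..<w} \<longrightarrow> G2 s = 0"
        using trans(2) \<open>0 \<le> v\<close> unfolding Q_def by blast
      note G = G1(1) G2(1) G1(2,3) G2(2,3)
      have "\<bar>g s - (G1 s + G2 s)\<bar> \<le> e" if "s \<in> {u..<w}" for s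
      proof (cases "s < v")
        case True
        with that G(3) have "\<bar>g s - G1 s\<bar> \<le> e" by simp
        moreover have "G2 s = 0" using G(6) True by simp
        ultimately show ?thesis by simp
      next
        case False
        with that G(5) have "\<bar>g s - G2 s\<bar> \<le> e" by simp
        moreover have "G1 s = 0" using G(4) False by simp
        ultimately show ?thesis by simp
      qed
      moreover have "G1 s + G2 s = 0" if "s \<notin> {u..<w}" for s
        using that trans(3,4) G(4,6)[rule_format, of s] by auto
      ultimately show "\<exists>G. H G \<and> (\<forall>s\<in>{u..<w}. \<bar>g s - G s\<bar> \<le> e) \<and> (\<forall>s. s \<notin> {u..<w} \<longrightarrow> G s = 0)"
        using H_add[OF G(1,2)] by (intro exI[of _ "\<lambda>s. G1 s + G2 s"]) auto
    qed
  next
    case (local x)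
    have "(g \<longlongrightarrow> g x) (at_right x)"
      using g local by (auto simp: cadlag_def)
    then have "\<forall>\<^sub>F s in at_right x. dist (g s) (g x) < e"
      using e by (rule tendstoD)
    then obtain d1 where d1: "d1 > x" "\<And>s. x < s \<Longrightarrow> s < d1 \<Longrightarrow> \<bar>g s - g x\<bar> < e"
      unfolding eventually_at_right[OF gt_ex[of x, THEN someI_ex]] dist_real_def
      by auto
    have "\<exists>l d2. d2 < x \<and> (\<forall>s. 0 \<le> s \<longrightarrow> d2 < s \<longrightarrow> s < x \<longrightarrow> \<bar>g s - l\<bar> < e)"
    \<comment> \<open>At 0 there is no left limit, but also no \<open>s\<close> with
      \<open>0 \<le> s < 0\<close>, so any bound will do.\<close>
    proof (cases "x = 0")
      case True
      then show ?thesis by (intro exI[of _ 0] exI[of _ "-1"]) auto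
    next
      case False
      then have "0 < x" using local by simp
      then obtain l where "(g \<longlongrightarrow> l) (at_left x)"
        using g unfolding cadlag_def by blast
      then have "\<forall>\<^sub>F s in at_left x. dist (g s) l < e"
        using e by (rule tendstoD)
      then show ?thesis
        unfolding eventually_at_left[OF lt_ex[of x, THEN someI_ex]] dist_real_def
        by blast
    qed
    then obtain l d2 where d2: "d2 < x" "\<And>s. 0 \<le> s \<Longrightarrow> d2 < s \<Longrightarrow> s < x \<Longrightarrow> \<bar>g s - l\<bar> < e"
      by blast
    have "Q u v" if uv: "u \<le> x" "x \<le> v" "v - u < min (d1 - x) (x - d2)" for u v
      unfolding Q_def
    proof
      assume "0 \<le> u"
      let ?G = "\<lambda>s. l * indicator {u..<x} s + g x * indicator {x..<v} s"
      have "H ?G" using uv by (intro H_add H_int)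
      moreover have "\<bar>g s - ?G s\<bar> \<le> e" if "s \<in> {u..<v}" for s
        using that uv \<open>0 \<le> u\<close> d1(2)[of s] d2(2)[of s] e
        by (cases "s < x"; cases "s = x") (auto simp: indicator_def intro: less_imp_le)
      moreover have "?G s = 0" if "s \<notin> {u..<v}" for s
        using that uv by (auto simp: indicator_def)
      ultimately show "\<exists>G. H G \<and> (\<forall>s\<in>{u..<v}. \<bar>g s - G s\<bar> \<le> e) \<and> (\<forall>s. s \<notin> {u..<v} \<longrightarrow> G s = 0)"
        by (intro exI[of _ ?G]) auto
    qed
    then show ?case
      using d1 d2 by (intro exI[of _ "min (d1 - x) (x - d2)"]) auto
  qed
  then obtain G where G: "H G" "\<forall>s\<in>{0..<T}. \<bar>g s - G s\<bar> \<le> e" "\<forall>s. s \<notin> {0..<T} \<longrightarrow> G s = 0"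
    unfolding Q_def by auto
  \<comment> \<open>\<open>G\<close> is 0 at the point \<open>T\<close>, which
    \<open>{0..<T}\<close> omits; a jump of height \<open>g T\<close> repairs this.\<close>
  let ?G = "\<lambda>s. G s + g T * indicator {T..} s"
  have "H ?G" by (intro H_add H_jump G(1))
  then obtain I where "has_RS_integral f ?G 0 T I" unfolding H_def by blast
  moreover have "\<bar>g s - ?G s\<bar> \<le> e" if "s \<in> {0..T}" for s
    using that G e by (cases "s = T") auto
  ultimately show thesis by (rule that)
qed

text \<open>Parametrised by mesh and number of cells rather than by an interval: grids of equal mesh
  on intervals of different length are initial segments of one another, so the difference of two
  such sums is a sum over one block of cells.\<close>

definition rs_grid :: "real \<Rightarrow> nat \<Rightarrow> (real \<times> real set) set" where
  "rs_grid c n = (\<lambda>k. (c * real k, {c * real k..c * real (Suc k)})) ` {..<n}"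

lemma rs_grid:
  assumes c: "0 < c" and n: "0 < n"
  shows rs_grid_tagged: "rs_grid c n tagged_division_of {0..c * real n}"
    and rs_grid_fine: "c < \<delta> \<Longrightarrow> rs_fine \<delta> (rs_grid c n)"
    and rs_grid_sum: "rs_sum f g (rs_grid c n) =
      (\<Sum>k<n. f (c * real k) * (g (c * real (Suc k)) - g (c * real k)))"
proof -
  have le: "c * real k \<le> c * real (Suc k)" for k using c by simp
  show "rs_fine \<delta> (rs_grid c n)" if "c < \<delta>"
    using that c le by (auto simp: rs_fine_def rs_grid_def) (simp add: algebra_simps)
  have inj: "inj_on (\<lambda>k. (c * real k, {c * real k..c * real (Suc k)})) {..<n}"
    using c by (auto simp: inj_on_def)
  show "rs_sum f g (rs_grid c n) =
      (\<Sum>k<n. f (c * real k) * (g (c * real (Suc k)) - g (c * real k)))"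
    unfolding rs_sum_def rs_grid_def sum.reindex[OF inj] o_def using le by simp
  show "rs_grid c n tagged_division_of {0..c * real n}"
  proof (rule tagged_division_ofI)
    show "finite (rs_grid c n)" by (simp add: rs_grid_def)
  next
    fix x J assume "(x, J) \<in> rs_grid c n"
    then obtain k where k: "k < n" "x = c * real k" "J = {c * real k..c * real (Suc k)}"
      by (auto simp: rs_grid_def)
    show "x \<in> J" using k le by auto
    have "c * real (Suc k) \<le> c * real n"
      using k c by (intro mult_left_mono) auto
    then show "J \<subseteq> {0..c * real n}" using k c by auto
    show "\<exists>a b. J = cbox a b" using k by auto
  next
    fix x1 J1 x2 J2
    assume "(x1, J1) \<in> rs_grid c n" "(x2, J2) \<in> rs_grid c n" and ne: "(x1, J1) \<noteq> (x2, J2)"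
    then obtain k l where k: "J1 = {c * real k..c * real (Suc k)}" "J2 = {c * real l..c * real (Suc l)}"
      "k \<noteq> l"
      unfolding rs_grid_def by auto
    have "Suc k \<le> l \<or> Suc l \<le> k" using k by auto
    then have "c * real (Suc k) \<le> c * real l \<or> c * real (Suc l) \<le> c * real k"
      using c by (auto intro!: mult_left_mono simp del: of_nat_Suc)
    then show "interior J1 \<inter> interior J2 = {}"
      unfolding k(1,2) by auto
  next
    show "\<Union> {J. \<exists>x. (x, J) \<in> rs_grid c n} = {0..c * real n}"
    proof (intro equalityI subsetI)
      fix s assume "s \<in> \<Union> {J. \<exists>x. (x, J) \<in> rs_grid c n}"
      then obtain k where k: "k < n" "s \<in> {c * real k..c * real (Suc k)}"
        by (auto simp: rs_grid_def)
      have "c * real (Suc k) \<le> c * real n" "0 \<le> c * real k"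
        using k c by (auto intro!: mult_left_mono simp del: of_nat_Suc)
      with k show "s \<in> {0..c * real n}" by auto
    next
      fix s assume "s \<in> {0..c * real n}"
      then have "\<exists>k<n. s \<in> {c * real k..c * real (Suc k)}"
        using n
      proof (induction n)
        case (Suc n)
        show ?case
        proof (cases "s \<le> c * real n \<and> 0 < n")
          case True
          with Suc have "\<exists>k<n. s \<in> {c * real k..c * real (Suc k)}" by auto
          then show ?thesis using less_Suc_eq by blast
        next
          case False
          with Suc.prems show ?thesis by (intro exI[of _ n]) auto
        qed
      qed simp
      then show "s \<in> \<Union> {J. \<exists>x. (x, J) \<in> rs_grid c n}"
        unfolding rs_grid_def by blast
    qed
  qed
qed


text \<open>Replacing \<open>g\<close> by a uniformly close \<open>G\<close> moves every sum by at
  most \<open>e / 4\<close>, whatever the division, by \<open>rs_sum_bound\<close>; the fine sums of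
  \<open>G\<close> are themselves within \<open>e / 4\<close> of its integral.\<close>

lemma cadlag_RS_cauchy:
  assumes g: "cadlag g" and T: "0 \<le> T" and e: "0 < e"
    and f: "continuous_on {0..T} f" "mono_on {0..T} f"
  obtains \<delta> where "\<delta> > 0"
    "\<And>p q. p tagged_division_of {0..T} \<Longrightarrow> q tagged_division_of {0..T} \<Longrightarrow> rs_fine \<delta> p \<Longrightarrow> rs_fine \<delta> q \<Longrightarrow>
       \<bar>rs_sum f g p - rs_sum f g q\<bar> < e"
proof -
  define C where "C = \<bar>f 0\<bar> + \<bar>f T\<bar> + (f T - f 0)"
  have "f 0 \<le> f T" using T by (intro mono_onD[OF f(2)]) auto
  then have C: "C \<ge> 0" by (simp add: C_def)
  define e' where "e' = e / (4 * (C + 1))"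
  have e': "e' > 0" using e C by (simp add: e'_def)
  obtain G I where G: "has_RS_integral f G 0 T I" "\<And>s. s \<in> {0..T} \<Longrightarrow> \<bar>g s - G s\<bar> \<le> e'"
    using cadlag_uniform_approx[OF g T e' f(1)] by blast
  obtain \<delta> where d: "\<delta> > 0"
    "\<And>p. p tagged_division_of {0..T} \<Longrightarrow> rs_fine \<delta> p \<Longrightarrow> \<bar>rs_sum f G p - I\<bar> < e / 4"
    using G(1)[unfolded has_RS_integral_alt, rule_format, of "e / 4"] e by auto
  have close: "\<bar>rs_sum f g p - rs_sum f G p\<bar> \<le> e / 4" if p: "p tagged_division_of {0..T}" for p
  proof -
    have "rs_sum f g p - rs_sum f G p = rs_sum f (\<lambda>s. g s - G s) p"
      unfolding rs_sum_def sum_subtractf[symmetric]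
      by (intro sum.cong) (auto simp: algebra_simps)
    also have "\<bar>\<dots>\<bar> \<le> e' * C"
      unfolding C_def by (rule rs_sum_bound[OF T p f(2) G(2)])
    also have "\<dots> \<le> e' * (C + 1)" using e' by simp
    also have "\<dots> = e / 4" using C unfolding e'_def by (simp add: divide_simps)
    finally show ?thesis .
  qed
  show thesis
  proof (rule that[OF d(1)])
    fix p q assume "p tagged_division_of {0..T}" "q tagged_division_of {0..T}" "rs_fine \<delta> p" "rs_fine \<delta> q"
    with close[of p] close[of q] d(2)[of p] d(2)[of q]
    show "\<bar>rs_sum f g p - rs_sum f g q\<bar> < e" by linarith
  qed
qed

text \<open>The factor \<open>m\<close> lets intervals of length proportional to \<open>i\<close> be
  refined with one common mesh, by taking \<open>m\<close> proportional to \<open>i\<close>.\<close>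

lemma rs_grid_tendsto:
  assumes I: "has_RS_integral f g 0 T I" and T: "0 < T" and m: "0 < m"
  shows "(\<lambda>N. rs_sum f g (rs_grid (T / real (m * Suc N)) (m * Suc N))) \<longlonglongrightarrow> I"
proof (rule LIMSEQ_I)
  fix e :: real assume "e > 0"
  then obtain \<delta> where d: "\<delta> > 0"
    "\<And>p. p tagged_division_of {0..T} \<Longrightarrow> rs_fine \<delta> p \<Longrightarrow> \<bar>rs_sum f g p - I\<bar> < e"
    using I[unfolded has_RS_integral_alt, rule_format, of e] by auto
  obtain N0 :: nat where N0: "T / \<delta> < real N0" using reals_Archimedean2 by blast
  have "norm (rs_sum f g (rs_grid (T / real (m * Suc N)) (m * Suc N)) - I) < e" if "N \<ge> N0" for N
  proof -
    define n where "n = m * Suc N"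
    have "N < n" using m unfolding n_def by (cases m) auto
    then have n: "n > 0" "real N0 < real n" using that by auto
    then have "T / \<delta> < real n" using N0 by linarith
    then have "T / real n < \<delta>" using d(1) n by (simp add: field_simps)
    moreover have "0 < T / real n" "T / real n * real n = T" using n T by auto
    ultimately show ?thesis
      using d(2)[of "rs_grid (T / real n) n"] rs_grid_tagged[of "T / real n" n]
        rs_grid_fine[of "T / real n" n \<delta>] n unfolding n_def by simp
  qed
  then show "\<exists>N0. \<forall>N\<ge>N0. norm (rs_sum f g (rs_grid (T / real (m * Suc N)) (m * Suc N)) - I) < e"
    by blast
qed

lemma cadlag_has_RS_integral:
  assumes g: "cadlag g" and T: "0 < T"
    and f: "continuous_on {0..T} f" "mono_on {0..T} f"
  shows "has_RS_integral f g 0 T (RS_integral f g 0 T)"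
proof -
  define S where "S N = rs_sum f g (rs_grid (T / real (Suc N)) (Suc N))" for N
  have tag: "rs_grid (T / real (Suc N)) (Suc N) tagged_division_of {0..T}" for N
    using rs_grid_tagged[of "T / real (Suc N)" "Suc N"] T by simp
  have fine: "\<exists>N0. \<forall>N\<ge>N0. rs_fine \<delta> (rs_grid (T / real (Suc N)) (Suc N))" if "\<delta> > 0" for \<delta>
  proof -
    obtain N0 :: nat where N0: "T / \<delta> < real N0" using reals_Archimedean2 by blast
    have "T / real (Suc N) < \<delta>" if "N \<ge> N0" for N
    proof -
      have "T / \<delta> < real (Suc N)" using N0 that by simp
      with \<open>\<delta> > 0\<close> show ?thesis by (simp add: field_simps)
    qed
    then show ?thesis using T by (intro exI[of _ N0]) (auto intro!: rs_grid_fine)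
  qed
  have "Cauchy S"
  proof (rule CauchyI)
    fix e :: real assume "e > 0"
    obtain \<delta> where d: "\<delta> > 0"
      "\<And>p q. p tagged_division_of {0..T} \<Longrightarrow> q tagged_division_of {0..T} \<Longrightarrow> rs_fine \<delta> p \<Longrightarrow> rs_fine \<delta> q \<Longrightarrow>
         \<bar>rs_sum f g p - rs_sum f g q\<bar> < e"
      using cadlag_RS_cauchy[OF g less_imp_le[OF T] \<open>e > 0\<close> f] by blast
    obtain N0 where "\<forall>N\<ge>N0. rs_fine \<delta> (rs_grid (T / real (Suc N)) (Suc N))"
      using fine[OF d(1)] by blast
    then show "\<exists>M. \<forall>m\<ge>M. \<forall>n\<ge>M. norm (S m - S n) < e"
      unfolding S_def real_norm_def using d(2)[OF tag tag] by (intro exI[of _ N0]) blast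
  qed
  then obtain I where I: "S \<longlonglongrightarrow> I" using Cauchy_convergent convergent_def by blast
  have "has_RS_integral f g 0 T I"
    unfolding has_RS_integral_alt
  proof (intro allI impI)
    fix e :: real assume "e > 0"
    then have e: "e / 2 > 0" by simp
    obtain \<delta> where d: "\<delta> > 0"
      "\<And>p q. p tagged_division_of {0..T} \<Longrightarrow> q tagged_division_of {0..T} \<Longrightarrow> rs_fine \<delta> p \<Longrightarrow> rs_fine \<delta> q \<Longrightarrow>
         \<bar>rs_sum f g p - rs_sum f g q\<bar> < e / 2"
      using cadlag_RS_cauchy[OF g less_imp_le[OF T] e f] by blast
    obtain N0 where N0: "\<forall>N\<ge>N0. rs_fine \<delta> (rs_grid (T / real (Suc N)) (Suc N))"
      using fine[OF d(1)] by blast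
    have "\<bar>rs_sum f g p - I\<bar> < e" if p: "p tagged_division_of {0..T}" "rs_fine \<delta> p" for p
    proof -
      have "(\<lambda>N. \<bar>rs_sum f g p - S N\<bar>) \<longlonglongrightarrow> \<bar>rs_sum f g p - I\<bar>"
        by (intro tendsto_intros I)
      moreover have "\<exists>M. \<forall>N\<ge>M. \<bar>rs_sum f g p - S N\<bar> \<le> e / 2"
        unfolding S_def using N0 d(2)[OF p(1) tag p(2)] by (meson less_imp_le)
      ultimately have "\<bar>rs_sum f g p - I\<bar> \<le> e / 2"
        by (rule LIMSEQ_le_const2)
      with \<open>e > 0\<close> show ?thesis by linarith
    qed
    with d(1) show "\<exists>\<delta>>0. \<forall>p. p tagged_division_of {0..T} \<and> rs_fine \<delta> p \<longrightarrow> \<bar>rs_sum f g p - I\<bar> < e"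
      by blast
  qed
  \<comment> \<open>Any value of the integral is the limit along the grids, which makes the
    \<open>THE\<close> in \<open>RS_integral\<close> well defined.\<close>
  moreover have "J = I" if "has_RS_integral f g 0 T J" for J
    using rs_grid_tendsto[OF that T, of 1] I LIMSEQ_unique unfolding S_def by auto
  ultimately show ?thesis
    unfolding RS_integral_def by (metis theI)
qed

section \<open>Autocorrelations of a deterministic AR(1) recursion and the estimator\<close>

lemma contraction_null:
  fixes x b :: "nat \<Rightarrow> real"
  assumes a: "0 \<le> a" "a < 1" and step: "\<And>n. x (Suc n) \<le> a * x n + b n"
    and nonneg: "\<And>n. 0 \<le> x n" and b: "b \<longlonglongrightarrow> 0"
  shows "x \<longlonglongrightarrow> 0"
proof (rule LIMSEQ_I)
  fix e :: real assume e: "e > 0"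
  \<comment> \<open>\<open>e / 2\<close> is the fixed point of
    \<open>t \<mapsto> a * t + e / 2 * (1 - a)\<close>, so perturbations below this threshold keep
    the iterates under \<open>e / 2\<close> plus a geometric term.\<close>
  then have "e / 2 * (1 - a) > 0" using a by simp
  then obtain N where N: "\<And>n. n \<ge> N \<Longrightarrow> \<bar>b n\<bar> < e / 2 * (1 - a)"
    using LIMSEQ_D[OF b] by fastforce
  have bound: "x (N + k) \<le> e / 2 + a ^ k * x N" for k
  proof (induction k)
    case (Suc k)
    have "x (N + Suc k) \<le> a * x (N + k) + b (N + k)" using step by simp
    also have "\<dots> \<le> a * (e / 2 + a ^ k * x N) + e / 2 * (1 - a)"
      using N[of "N + k"] a by (intro add_mono mult_left_mono Suc) auto
    finally show ?case by (simp add: field_simps)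
  qed (use e in auto)
  have "(\<lambda>k. a ^ k * x N) \<longlonglongrightarrow> 0 * x N"
    by (intro tendsto_mult_right LIMSEQ_realpow_zero a)
  then obtain K where K: "\<And>k. k \<ge> K \<Longrightarrow> \<bar>a ^ k * x N\<bar> < e / 2"
    using LIMSEQ_D[of _ "0::real" "e / 2"] e by fastforce
  have "norm (x n - 0) < e" if "n \<ge> N + K" for n
  proof -
    have "x n \<le> e / 2 + a ^ (n - N) * x N" "\<bar>a ^ (n - N) * x N\<bar> < e / 2"
      using bound[of "n - N"] K[of "n - N"] that by auto
    then show ?thesis using nonneg[of n] by simp
  qed
  then show "\<exists>no. \<forall>n\<ge>no. norm (x n - 0) < e" by blast
qed

lemma mean_truncate:
  fixes x :: "nat \<Rightarrow> real"
  assumes "(\<lambda>n. (\<Sum>i<n. x i) / real n) \<longlonglongrightarrow> l"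
  shows "(\<lambda>n. (\<Sum>i<n - h. x i) / real n) \<longlonglongrightarrow> l"
proof -
  have "(\<lambda>n. real n / (real n + real h)) \<longlonglongrightarrow> 1" by real_asymp
  with assms have "(\<lambda>n. (\<Sum>i<n. x i) / real n * (real n / (real n + real h))) \<longlonglongrightarrow> l * 1"
    by (rule tendsto_mult)
  moreover have "(\<Sum>i<n. x i) / real n * (real n / (real n + real h)) = (\<Sum>i<n + h - h. x i) / real (n + h)" for n
    by (cases "n = 0") auto
  ultimately have "(\<lambda>n. (\<Sum>i<n + h - h. x i) / real (n + h)) \<longlonglongrightarrow> l"
    by (simp only: mult_1_right)
  then show ?thesis by (rule LIMSEQ_offset)
qed

lemma mean_shift:
  fixes x :: "nat \<Rightarrow> real"
  assumes "(\<lambda>n. (\<Sum>i<n. x i) / real n) \<longlonglongrightarrow> l"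
  shows "(\<lambda>n. (\<Sum>i<n. x (i + h)) / real n) \<longlonglongrightarrow> l"
proof (induction h)
  case (Suc h)
  have "(\<lambda>n. (\<Sum>i<Suc n. x (i + h)) / real (Suc n) * (real (Suc n) / real n) - x h / real n) \<longlonglongrightarrow> l * 1 - 0"
  proof (intro tendsto_diff tendsto_mult)
    show "(\<lambda>n. (\<Sum>i<Suc n. x (i + h)) / real (Suc n)) \<longlonglongrightarrow> l"
      using LIMSEQ_Suc[OF Suc] .
    show "(\<lambda>n. real (Suc n) / real n) \<longlonglongrightarrow> 1" "(\<lambda>n. x h / real n) \<longlonglongrightarrow> 0"
      by real_asymp+
  qed
  moreover have "(\<Sum>i<Suc n. x (i + h)) / real (Suc n) * (real (Suc n) / real n) - x h / real n
      = (\<Sum>i<n. x (i + Suc h)) / real n" for n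
  proof -
    have "(\<Sum>i<Suc n. x (i + h)) / real (Suc n) * (real (Suc n) / real n) = (\<Sum>i<Suc n. x (i + h)) / real n"
      by (simp del: of_nat_Suc sum.lessThan_Suc)
    then show ?thesis
      unfolding sum.lessThan_Suc_shift by (simp add: add_divide_distrib del: of_nat_Suc)
  qed
  ultimately show ?case by (simp only: mult_1_right diff_zero)
qed (use assms in simp)

lemma sum_Suc_atLeastAtMost: "(\<Sum>i=1..m. f i) = (\<Sum>i<m. f (Suc i))"
  by (simp add: sum.atLeast1_atMost_eq)

text \<open>The randomness is frozen: these are the almost sure properties of one sample path.
  \<open>e_growth\<close> serves to discard single boundary summands, \<open>e_spread\<close> to
  keep the denominator of the autocorrelations away from 0.\<close>

locale stable_ar1 =
  fixes a \<mu> p :: real and y z e :: "nat \<Rightarrow> real"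
  assumes a: "0 < a" "a < 1"
    and z: "\<And>i. z i = y i - \<mu>"
    and step: "\<And>i. z (Suc i) = a * z i + e i"
    and e_mean: "(\<lambda>n. (\<Sum>i<n. e i) / real n) \<longlonglongrightarrow> 0"
    and e_cross: "\<And>h. (\<lambda>n. (\<Sum>i<n. e (i + h) * z i) / real n) \<longlonglongrightarrow> 0"
    and e_growth: "(\<lambda>n. e n / sqrt (real (Suc n))) \<longlonglongrightarrow> 0"
    and e_spread: "(\<lambda>n. (\<Sum>i<n. min ((e i)\<^sup>2) 1) / real n) \<longlonglongrightarrow> p" "p > 0"
begin

text \<open>The empirical autocovariance with the fixed centre \<open>\<mu>\<close> in place of the
  sample mean; the shift by \<open>Suc\<close> matches observations numbered from 1.\<close>

definition A :: "nat \<Rightarrow> nat \<Rightarrow> real" where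
  "A h n = (\<Sum>i<n - h. z (Suc i + h) * z (Suc i)) / real n"

text \<open>Dividing the recursion by a growing denominator preserves the contraction factor
  \<open>a\<close>, so the growth rate of the innovations is inherited.\<close>

lemma z_growth: "(\<lambda>n. z n / sqrt (real (Suc n))) \<longlonglongrightarrow> 0"
proof -
  have "(\<lambda>n. \<bar>z n\<bar> / sqrt (real (Suc n))) \<longlonglongrightarrow> 0"
  proof (rule contraction_null[where a = a and b = "\<lambda>n. \<bar>e n\<bar> / sqrt (real (Suc n))"])
    fix n
    have "\<bar>z (Suc n)\<bar> / sqrt (real (Suc (Suc n))) \<le> (a * \<bar>z n\<bar> + \<bar>e n\<bar>) / sqrt (real (Suc n))"
      unfolding step using a
      by (intro frac_le order.trans[OF abs_triangle_ineq]) (auto simp: abs_mult)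
    then show "\<bar>z (Suc n)\<bar> / sqrt (real (Suc (Suc n))) \<le>
        a * (\<bar>z n\<bar> / sqrt (real (Suc n))) + \<bar>e n\<bar> / sqrt (real (Suc n))"
      by (simp add: add_divide_distrib)
  next
    show "(\<lambda>n. \<bar>e n\<bar> / sqrt (real (Suc n))) \<longlonglongrightarrow> 0"
      using tendsto_rabs_zero[OF e_growth] by simp
  qed (use a in auto)
  then show ?thesis
    by (subst tendsto_rabs_zero_iff[symmetric]) simp
qed

text \<open>Two factors that are o(sqrt n) have a product that is o(n). This disposes of the last
  summand by which \<open>A h\<close> exceeds \<open>A (Suc h)\<close>.\<close>

lemma z_prod_growth: "(\<lambda>n. z (n + h) * z n / real (n + h)) \<longlonglongrightarrow> 0"
proof -
  define s where "s n = sqrt (real (Suc n))" for n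
  have s: "s n \<noteq> 0" for n by (simp add: s_def del: of_nat_Suc)
  have "(\<lambda>n. z (n + h) / s (n + h) * (z n / s n) * (s (n + h) * s n / real (n + h))) \<longlonglongrightarrow> 0 * 0 * 1"
  proof (intro tendsto_mult)
    show "(\<lambda>n. s (n + h) * s n / real (n + h)) \<longlonglongrightarrow> 1" unfolding s_def by real_asymp
    show "(\<lambda>n. z n / s n) \<longlonglongrightarrow> 0" unfolding s_def by (rule z_growth)
    then show "(\<lambda>n. z (n + h) / s (n + h)) \<longlonglongrightarrow> 0" by (rule LIMSEQ_ignore_initial_segment)
  qed
  moreover have "z (n + h) / s (n + h) * (z n / s n) * (s (n + h) * s n / real (n + h)) =
      z (n + h) * z n / real (n + h)" for n
    using s[of n] s[of "n + h"] by simp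
  ultimately show ?thesis by (simp only: mult_zero_left)
qed

lemma z_over_n: "(\<lambda>n. z n / real n) \<longlonglongrightarrow> 0"
proof -
  define s where "s n = sqrt (real (Suc n))" for n
  have s: "s n \<noteq> 0" for n by (simp add: s_def del: of_nat_Suc)
  have "(\<lambda>n. z n / s n * (s n / real n)) \<longlonglongrightarrow> 0 * 0"
  proof (intro tendsto_mult)
    show "(\<lambda>n. z n / s n) \<longlonglongrightarrow> 0" unfolding s_def by (rule z_growth)
    show "(\<lambda>n. s n / real n) \<longlonglongrightarrow> 0" unfolding s_def by real_asymp
  qed
  moreover have "z n / s n * (s n / real n) = z n / real n" for n
    using s[of n] by simp
  ultimately show ?thesis by (simp only: mult_zero_left)
qed

text \<open>Summing the recursion gives a linear equation for the sum of the \<open>z i\<close>,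
  whose solution involves the innovations and the two boundary values only.\<close>

lemma z_mean: "(\<lambda>n. (\<Sum>i<n. z i) / real n) \<longlonglongrightarrow> 0"
proof -
  have eq: "(\<Sum>i<n. z i) = ((\<Sum>i<n. e i) - z n + z 0) / (1 - a)" for n
  proof -
    have "(\<Sum>i<n. z (Suc i)) = a * (\<Sum>i<n. z i) + (\<Sum>i<n. e i)"
      by (simp add: step sum.distrib sum_distrib_left)
    moreover have "(\<Sum>i<n. z (Suc i)) = (\<Sum>i<n. z i) + z n - z 0"
      using sum.lessThan_Suc_shift[of z n] by simp
    ultimately have "(1 - a) * (\<Sum>i<n. z i) = (\<Sum>i<n. e i) - z n + z 0"
      unfolding left_diff_distrib by linarith
    then show ?thesis using a by (simp add: eq_divide_eq mult.commute)
  qed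
  have "(\<lambda>n. ((\<Sum>i<n. e i) / real n - z n / real n + z 0 / real n) / (1 - a)) \<longlonglongrightarrow> (0 - 0 + 0) / (1 - a)"
    using a by (intro tendsto_intros e_mean z_over_n lim_const_over_n) auto
  moreover have "((\<Sum>i<n. e i) / real n - z n / real n + z 0 / real n) / (1 - a) = (\<Sum>i<n. z i) / real n" for n
    unfolding eq add_divide_distrib[symmetric] diff_divide_distrib[symmetric] by simp
  ultimately show ?thesis by simp
qed

text \<open>Multiplying the recursion at index \<open>i + h\<close> by \<open>z i\<close> yields the
  two autocovariances and a cross term; the lengths of the sums differ by one, which leaves a
  boundary product.\<close>

lemma A_Suc: "(\<lambda>n. A (Suc h) n - a * A h n) \<longlonglongrightarrow> 0"
\<comment> \<open>The shift removes the truncated subtractions \<open>n - Suc h\<close> and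
  \<open>n - h\<close>.\<close>
proof (rule LIMSEQ_offset[where k = "Suc h"])
  have eq: "A (Suc h) (n + Suc h) - a * A h (n + Suc h) =
     (\<Sum>i<n + Suc h - Suc h. e (i + Suc h) * z (i + 1)) / real (n + Suc h)
     - a * (z (Suc n + h) * z (Suc n) / real (Suc n + h))" for n
  proof -
    have 1: "(\<Sum>i<n. z (Suc i + Suc h) * z (Suc i)) =
        a * (\<Sum>i<n. z (Suc i + h) * z (Suc i)) + (\<Sum>i<n. e (i + Suc h) * z (i + 1))"
      unfolding sum_distrib_left sum.distrib[symmetric]
      by (intro sum.cong) (auto simp: step algebra_simps)
    have "A (Suc h) (n + Suc h) = (\<Sum>i<n. z (Suc i + Suc h) * z (Suc i)) / real (n + Suc h)"
      by (simp add: A_def)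
    moreover have "A h (n + Suc h) =
        ((\<Sum>i<n. z (Suc i + h) * z (Suc i)) + z (Suc n + h) * z (Suc n)) / real (n + Suc h)"
      by (simp add: A_def)
    ultimately show ?thesis unfolding 1
      by (simp add: add_divide_distrib algebra_simps)
  qed
  have cross: "(\<lambda>n. (\<Sum>i<n. e (i + Suc h) * z (i + 1)) / real n) \<longlonglongrightarrow> 0"
    using mean_shift[OF e_cross[of h], of 1] by simp
  have "(\<lambda>n. (\<Sum>i<n + Suc h - Suc h. e (i + Suc h) * z (i + 1)) / real (n + Suc h)
     - a * (z (Suc n + h) * z (Suc n) / real (Suc n + h))) \<longlonglongrightarrow> 0 - a * 0"
    by (intro tendsto_intros LIMSEQ_ignore_initial_segment[OF mean_truncate[OF cross]]
      LIMSEQ_Suc[OF z_prod_growth])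
  then show "(\<lambda>n. A (Suc h) (n + Suc h) - a * A h (n + Suc h)) \<longlonglongrightarrow> 0"
    unfolding eq by simp
qed

lemma A_power: "(\<lambda>n. A h n - a ^ h * A 0 n) \<longlonglongrightarrow> 0"
proof (induction h)
  case (Suc h)
  have "(\<lambda>n. (A (Suc h) n - a * A h n) + a * (A h n - a ^ h * A 0 n)) \<longlonglongrightarrow> 0 + a * 0"
    by (intro tendsto_intros A_Suc Suc)
  then show ?case by (simp add: algebra_simps)
qed simp

text \<open>Recentring at the sample mean shifts each factor by \<open>b n\<close>, the average of
  the \<open>z\<close>, and every correction term contains \<open>b n\<close> as a null
  factor.\<close>

lemma acov_A: "(\<lambda>n. emp_acov n y h - A h n) \<longlonglongrightarrow> 0"
proof -
  define b where "b n = (\<Sum>i<n. z (Suc i)) / real n" for n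
  have zS: "(\<lambda>n. (\<Sum>i<n. z (Suc i)) / real n) \<longlonglongrightarrow> 0"
    using mean_shift[OF z_mean, of 1] by simp
  then have b: "b \<longlonglongrightarrow> 0" by (simp add: b_def[abs_def])
  have zSh: "(\<lambda>n. (\<Sum>i<n. z (Suc i + h)) / real n) \<longlonglongrightarrow> 0"
    using mean_shift[OF z_mean, of "Suc h"] by (simp add: add.commute)
  have eq: "emp_acov n y h - A h n =
      b n * b n * (real (n - h) / real n)
      - b n * ((\<Sum>i<n - h. z (Suc i + h)) / real n) - b n * ((\<Sum>i<n - h. z (Suc i)) / real n)"
    if "n > 0" for n
  proof -
    \<comment> \<open>This is where \<open>n > 0\<close> matters: for \<open>n = 0\<close> both
      averages are 0 by the convention for division.\<close>
    have "b n = emp_mean n y - \<mu>"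
      using that unfolding b_def emp_mean_def sum_Suc_atLeastAtMost
      by (simp add: z sum_subtractf field_simps)
    then have m: "emp_mean n y = b n + \<mu>" by simp
    have "(\<Sum>i=1..n - h. (y (i + h) - emp_mean n y) * (y i - emp_mean n y)) =
        (\<Sum>i<n - h. (z (Suc i + h) - b n) * (z (Suc i) - b n))"
      unfolding sum_Suc_atLeastAtMost m z by (simp add: algebra_simps)
    also have "\<dots> = (\<Sum>i<n - h. z (Suc i + h) * z (Suc i)) - b n * (\<Sum>i<n - h. z (Suc i + h))
       - b n * (\<Sum>i<n - h. z (Suc i)) + real (n - h) * (b n * b n)"
    proof -
      have "(\<Sum>i<m. (f i - b n) * (g i - b n)) =
          (\<Sum>i<m. f i * g i) - b n * (\<Sum>i<m. f i) - b n * (\<Sum>i<m. g i) + real m * (b n * b n)"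
        for m and f g :: "nat \<Rightarrow> real"
        by (induction m) (auto simp: algebra_simps)
      then show ?thesis .
    qed
    finally show ?thesis
      unfolding emp_acov_def A_def by (simp add: add_divide_distrib diff_divide_distrib)
  qed
  have "(\<lambda>n. b n * b n * (real (n - h) / real n)
      - b n * ((\<Sum>i<n - h. z (Suc i + h)) / real n) - b n * ((\<Sum>i<n - h. z (Suc i)) / real n))
      \<longlonglongrightarrow> 0 * 0 * 1 - 0 * 0 - 0 * 0"
  proof (intro tendsto_diff tendsto_mult b mean_truncate zS zSh)
    show "(\<lambda>n. real (n - h) / real n) \<longlonglongrightarrow> 1"
    proof -
      have "(\<lambda>n. real n / real n) \<longlonglongrightarrow> 1" by real_asymp
      then show ?thesis using mean_truncate[of "\<lambda>_. 1" 1 h] by simp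
    qed
  qed
  then have "(\<lambda>n. b n * b n * (real (n - h) / real n)
      - b n * ((\<Sum>i<n - h. z (Suc i + h)) / real n) - b n * ((\<Sum>i<n - h. z (Suc i)) / real n))
      \<longlonglongrightarrow> 0" by simp
  then show ?thesis
    by (rule Lim_transform_eventually)
      (rule eventually_mono[OF eventually_gt_at_top[of 0]], simp only: eq)
qed

text \<open>Since \<open>e i\<close> is \<open>z (Suc i) - a * z i\<close>, innovations that are not
  small force observations that are not small. Squaring costs a factor 4, so the average of the
  truncated squares is at most \<open>4 * A 0 n\<close> up to a null term; \<open>p / 8\<close>
  leaves room below the limiting bound \<open>p / 4\<close>.\<close>

lemma A_lower: "\<forall>\<^sub>F n in sequentially. A 0 n > p / 8"
proof -
  have "(\<lambda>n. ((\<Sum>i<n. min ((e i)\<^sup>2) 1) / real n) / 4 - (z 0)\<^sup>2 / 2 / real n) \<longlonglongrightarrow> p / 4 - 0"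
    by (intro tendsto_intros e_spread lim_const_over_n) auto
  then have "\<forall>\<^sub>F n in sequentially. ((\<Sum>i<n. min ((e i)\<^sup>2) 1) / real n) / 4 - (z 0)\<^sup>2 / 2 / real n > p / 8"
    using e_spread(2) by (intro order_tendstoD(1)) auto
  then show ?thesis
  proof eventually_elim
    case (elim n)
    have "(\<Sum>i<n. min ((e i)\<^sup>2) 1) \<le> (\<Sum>i<n. 2 * (z (Suc i))\<^sup>2 + 2 * (z i)\<^sup>2)"
    proof (rule sum_mono)
      fix i
      have "(e i)\<^sup>2 = (z (Suc i) - a * z i)\<^sup>2" by (simp add: step)
      also have "\<dots> \<le> 2 * (z (Suc i))\<^sup>2 + 2 * (a\<^sup>2 * (z i)\<^sup>2)"
        using zero_le_power2[of "z (Suc i) + a * z i"] by (simp add: power2_eq_square algebra_simps)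
      also have "\<dots> \<le> 2 * (z (Suc i))\<^sup>2 + 2 * (1 * (z i)\<^sup>2)"
        using a by (intro add_left_mono mult_left_mono mult_right_mono) (auto intro: power_le_one)
      finally show "min ((e i)\<^sup>2) 1 \<le> 2 * (z (Suc i))\<^sup>2 + 2 * (z i)\<^sup>2" by simp
    qed
    also have "\<dots> = 2 * (\<Sum>i<n. (z (Suc i))\<^sup>2) + 2 * (\<Sum>i<n. (z i)\<^sup>2)"
      by (simp add: sum.distrib sum_distrib_left)
    also have "(\<Sum>i<n. (z i)\<^sup>2) = (\<Sum>i<n. (z (Suc i))\<^sup>2) + (z 0)\<^sup>2 - (z n)\<^sup>2"
      using sum.lessThan_Suc_shift[of "\<lambda>i. (z i)\<^sup>2" n] by simp
    also have "2 * (\<Sum>i<n. (z (Suc i))\<^sup>2) + 2 * \<dots> \<le> 4 * (\<Sum>i<n. (z (Suc i))\<^sup>2) + 2 * (z 0)\<^sup>2"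
      by simp
    finally have "(\<Sum>i<n. min ((e i)\<^sup>2) 1) \<le> 4 * (\<Sum>i<n. (z (Suc i))\<^sup>2) + 2 * (z 0)\<^sup>2" .
    then have "(\<Sum>i<n. min ((e i)\<^sup>2) 1) / real n \<le> (4 * (\<Sum>i<n. (z (Suc i))\<^sup>2) + 2 * (z 0)\<^sup>2) / real n"
      by (rule divide_right_mono) simp
    also have "\<dots> = 4 * A 0 n + 2 * ((z 0)\<^sup>2 / real n)"
      by (simp add: A_def power2_eq_square add_divide_distrib)
    finally show ?case using elim by simp
  qed
qed

text \<open>The denominator is only known to stay above \<open>p / 16\<close>. This suffices because
  the numerator differs from \<open>a ^ h\<close> times the denominator by a null sequence.\<close>

lemma acorr_tendsto: "(\<lambda>n. emp_acorr n y h) \<longlonglongrightarrow> a ^ h"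
proof -
  let ?c = "\<lambda>n. emp_acov n y 0"
  have low: "\<forall>\<^sub>F n in sequentially. ?c n > p / 16"
  proof -
    have "\<forall>\<^sub>F n in sequentially. ?c n - A 0 n > - (p / 16)"
      using e_spread(2) by (intro order_tendstoD(1)[OF acov_A]) auto
    with A_lower show ?thesis by eventually_elim linarith
  qed
  have "(\<lambda>n. (emp_acov n y h - A h n) + (A h n - a ^ h * A 0 n) - a ^ h * (?c n - A 0 n))
      \<longlonglongrightarrow> 0 + 0 - a ^ h * 0"
    by (intro tendsto_intros acov_A A_power)
  then have num: "(\<lambda>n. emp_acov n y h - a ^ h * ?c n) \<longlonglongrightarrow> 0"
    by (simp add: algebra_simps)
  have "(\<lambda>n. (emp_acov n y h - a ^ h * ?c n) / ?c n) \<longlonglongrightarrow> 0"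
  proof (rule Lim_null_comparison)
    show "(\<lambda>n. norm (emp_acov n y h - a ^ h * ?c n) / (p / 16)) \<longlonglongrightarrow> 0"
      using tendsto_divide[OF tendsto_norm_zero[OF num] tendsto_const[of "p / 16"]] e_spread(2) by simp
    show "\<forall>\<^sub>F n in sequentially. norm ((emp_acov n y h - a ^ h * ?c n) / ?c n)
        \<le> norm (emp_acov n y h - a ^ h * ?c n) / (p / 16)"
      using low
    proof eventually_elim
      case (elim n)
      then have "p / 16 \<le> \<bar>?c n\<bar>" by linarith
      then show ?case using e_spread(2) unfolding real_norm_def abs_divide
        by (intro divide_left_mono mult_pos_pos) auto
    qed
  qed
  then have "(\<lambda>n. (emp_acov n y h - a ^ h * ?c n) / ?c n + a ^ h) \<longlonglongrightarrow> 0 + a ^ h"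
    by (intro tendsto_intros)
  then have "(\<lambda>n. (emp_acov n y h - a ^ h * ?c n) / ?c n + a ^ h) \<longlonglongrightarrow> a ^ h" by simp
  then show ?thesis
  proof (rule Lim_transform_eventually)
    show "\<forall>\<^sub>F n in sequentially. (emp_acov n y h - a ^ h * ?c n) / ?c n + a ^ h = emp_acorr n y h"
      using low
    proof eventually_elim
      case (elim n)
      then have "?c n \<noteq> 0" using e_spread(2) by auto
      then show ?case by (simp add: emp_acorr_def field_simps)
    qed
  qed
qed

end

section \<open>Existence, isolation and convergence of minimisers of the loss\<close>

lemma acf_estimate_exists:
  assumes "compact K" "K \<noteq> {}"
  shows "\<exists>l. is_acf_estimate K d n y l"
proof -
  have "continuous_on K (acf_loss d n y)"
    unfolding acf_loss_def[abs_def] by (intro continuous_intros)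
  with assms obtain l where "l \<in> K" "\<forall>l'\<in>K. acf_loss d n y l \<le> acf_loss d n y l'"
    using continuous_attains_inf by blast
  then show ?thesis
    unfolding is_acf_estimate_def is_arg_min_def by (intro exI[of _ l]) (auto simp: not_less)
qed

text \<open>The loss is a nonconstant polynomial in \<open>exp (- l)\<close>, so each of its level sets is finite.\<close>

lemma acf_estimates_finite:
  assumes d: "d \<ge> 1"
  shows "finite {l. is_acf_estimate K d n y l}"
proof (cases "\<exists>l. is_acf_estimate K d n y l")
  case True
  then obtain l0 where l0: "is_acf_estimate K d n y l0" by blast
  define v where "v = acf_loss d n y l0"
  have v: "v \<ge> 0" unfolding v_def acf_loss_def by (intro sum_nonneg) auto
  define q where "q = (\<Sum>h=1..d. ([:emp_acorr n y h:] - monom 1 h)\<^sup>2) - [:v:]"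
  have q: "poly q x = (\<Sum>h=1..d. (emp_acorr n y h - x ^ h)\<^sup>2) - v" for x
    by (simp add: q_def poly_sum poly_monom)
  have "q \<noteq> 0"
  proof
    assume "q = 0"
    \<comment> \<open>At this point the summand \<open>h = 1\<close> alone equals
      \<open>(v + 1)\<^sup>2\<close>, which exceeds \<open>v\<close>; hence \<open>q\<close> cannot
      vanish identically.\<close>
    define x where "x = emp_acorr n y 1 + (v + 1)"
    have "(v + 1) * (v + 1) = (emp_acorr n y 1 - x ^ 1)\<^sup>2"
      by (simp add: x_def power2_eq_square algebra_simps)
    also have "\<dots> \<le> (\<Sum>h=1..d. (emp_acorr n y h - x ^ h)\<^sup>2)"
      using d by (intro member_le_sum) auto
    also have "\<dots> = v"
      using q[of x] \<open>q = 0\<close> by simp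
    finally have "(v + 1) * (v + 1) \<le> v" .
    moreover have "(v + 1) * 1 \<le> (v + 1) * (v + 1)"
      using v by (intro mult_left_mono) auto
    ultimately have "(v + 1) * 1 \<le> v" by (rule order.trans[rotated])
    then show False by simp
  qed
  then have "finite {x. poly q x = 0}" by (rule poly_roots_finite)
  then have "finite ((\<lambda>l. exp (- l)) -` {x. poly q x = 0})"
    by (rule finite_vimageI) (auto simp: inj_on_def)
  moreover have "{l. is_acf_estimate K d n y l} \<subseteq> (\<lambda>l. exp (- l)) -` {x. poly q x = 0}"
  proof (intro subsetI)
    fix l assume "l \<in> {l. is_acf_estimate K d n y l}"
    then have "\<not> acf_loss d n y l0 < acf_loss d n y l" "\<not> acf_loss d n y l < acf_loss d n y l0"
      using l0 unfolding is_acf_estimate_def is_arg_min_def by blast+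
    then have "acf_loss d n y l = v" unfolding v_def by linarith
    then show "l \<in> (\<lambda>l. exp (- l)) -` {x. poly q x = 0}"
      unfolding vimage_def mem_Collect_eq q acf_loss_def exp_of_nat2_mult by simp
  qed
  ultimately show ?thesis by (rule finite_subset[rotated])
next
  case False
  then have "{l. is_acf_estimate K d n y l} = {}" by blast
  then show ?thesis by (simp only: finite.emptyI)
qed

lemma acf_estimate_tendsto:
  assumes d: "d \<ge> 1" and K: "l0 \<in> K"
    and acorr: "\<And>h. (\<lambda>n. emp_acorr n y h) \<longlonglongrightarrow> exp (- l0) ^ h"
    and l: "\<And>n. n \<ge> 1 \<Longrightarrow> is_acf_estimate K d n y (l n)"
  shows "l \<longlonglongrightarrow> l0"
proof -
  have "(\<lambda>n. acf_loss d n y l0) \<longlonglongrightarrow> (\<Sum>h=1..d. (exp (- l0) ^ h - exp (- l0 * real h))\<^sup>2)"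
    unfolding acf_loss_def by (intro tendsto_intros acorr)
  then have loss: "(\<lambda>n. acf_loss d n y l0) \<longlonglongrightarrow> 0"
    unfolding exp_of_nat2_mult by simp
  have "(\<lambda>n. (emp_acorr n y 1 - exp (- l n))\<^sup>2) \<longlonglongrightarrow> 0"
  proof (rule tendsto_sandwich[where f = "\<lambda>_. 0", OF _ _ tendsto_const loss])
    show "\<forall>\<^sub>F n in sequentially. (emp_acorr n y 1 - exp (- l n))\<^sup>2 \<le> acf_loss d n y l0"
      using eventually_ge_at_top[of 1]
    proof eventually_elim
      case (elim n)
      have "(emp_acorr n y 1 - exp (- l n * real 1))\<^sup>2 \<le> acf_loss d n y (l n)"
        unfolding acf_loss_def using d by (intro member_le_sum) auto
      also have "\<dots> \<le> acf_loss d n y l0"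
        using l[OF elim] K unfolding is_acf_estimate_def is_arg_min_def by (auto simp: not_less)
      finally show ?case by simp
    qed
  qed auto
  from tendsto_real_sqrt[OF this] have "(\<lambda>n. \<bar>emp_acorr n y 1 - exp (- l n)\<bar>) \<longlonglongrightarrow> 0"
    by (simp only: real_sqrt_abs real_sqrt_zero)
  then have "(\<lambda>n. emp_acorr n y 1 - exp (- l n)) \<longlonglongrightarrow> 0"
    by (rule tendsto_rabs_zero_cancel)
  then have "(\<lambda>n. emp_acorr n y 1 - (emp_acorr n y 1 - exp (- l n))) \<longlonglongrightarrow> exp (- l0) ^ 1 - 0"
    by (intro tendsto_diff acorr)
  then have "(\<lambda>n. exp (- l n)) \<longlonglongrightarrow> exp (- l0)" by simp
  then have "(\<lambda>n. ln (exp (- l n))) \<longlonglongrightarrow> ln (exp (- l0))"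
    by (rule tendsto_ln) simp
  then have "(\<lambda>n. - l n) \<longlonglongrightarrow> - l0" by simp
  then show ?thesis by (rule tendsto_minus_cancel)
qed

section \<open>A strong law for orthogonal sequences\<close>

context prob_space
begin

lemma integrable_mult_L2:
  fixes X Y :: "'a \<Rightarrow> real"
  assumes [measurable]: "X \<in> borel_measurable M" "Y \<in> borel_measurable M"
    and sq: "integrable M (\<lambda>\<omega>. (X \<omega>)\<^sup>2)" "integrable M (\<lambda>\<omega>. (Y \<omega>)\<^sup>2)"
  shows "integrable M (\<lambda>\<omega>. X \<omega> * Y \<omega>)"
proof (rule Bochner_Integration.integrable_bound)
  show "integrable M (\<lambda>\<omega>. (X \<omega>)\<^sup>2 + (Y \<omega>)\<^sup>2)" using sq by simp
  have "\<bar>x * y\<bar> \<le> x\<^sup>2 + y\<^sup>2" for x y :: real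
  proof -
    have "2 * (\<bar>x\<bar> * \<bar>y\<bar>) \<le> x\<^sup>2 + y\<^sup>2" "0 \<le> \<bar>x\<bar> * \<bar>y\<bar>"
      using sum_squares_bound[of "\<bar>x\<bar>" "\<bar>y\<bar>"] by simp_all
    then show ?thesis unfolding abs_mult by linarith
  qed
  then show "AE \<omega> in M. norm (X \<omega> * Y \<omega>) \<le> norm ((X \<omega>)\<^sup>2 + (Y \<omega>)\<^sup>2)"
    by simp
qed measurable

text \<open>By monotone convergence the series of the \<open>q n\<close> has finite expectation, so
  it converges almost surely and its terms tend to 0.\<close>

lemma AE_tendsto_zero_if_summable_expectation:
  fixes q :: "nat \<Rightarrow> 'a \<Rightarrow> real"
  assumes int: "\<And>n. integrable M (q n)" and nonneg: "\<And>n \<omega>. 0 \<le> q n \<omega>"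
    and sum: "summable (\<lambda>n. expectation (q n))"
  shows "AE \<omega> in M. (\<lambda>n. q n \<omega>) \<longlonglongrightarrow> 0"
proof -
  have [measurable]: "q n \<in> borel_measurable M" for n using int by auto
  have "(\<integral>\<^sup>+\<omega>. (\<Sum>n. ennreal (q n \<omega>)) \<partial>M) = (\<Sum>n. ennreal (expectation (q n)))"
    by (subst nn_integral_suminf) (auto simp: nn_integral_eq_integral[OF int] nonneg)
  also have "\<dots> = ennreal (\<Sum>n. expectation (q n))"
    using sum by (intro suminf_ennreal2) (auto simp: nonneg)
  finally have "(\<integral>\<^sup>+\<omega>. (\<Sum>n. ennreal (q n \<omega>)) \<partial>M) \<noteq> \<infinity>" by simp
  then have "AE \<omega> in M. (\<Sum>n. ennreal (q n \<omega>)) \<noteq> \<infinity>"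
    by (intro nn_integral_PInf_AE) auto
  then show ?thesis
  proof eventually_elim
    case (elim \<omega>)
    then have "summable (\<lambda>n. q n \<omega>)"
      by (intro summable_suminf_not_top) (auto simp: nonneg)
    then show ?case by (rule summable_LIMSEQ_zero)
  qed
qed

lemma expectation_square_sum_orthogonal:
  fixes D :: "nat \<Rightarrow> 'a \<Rightarrow> real"
  assumes rv: "\<And>i. D i \<in> borel_measurable M"
    and sq: "\<And>i. integrable M (\<lambda>\<omega>. (D i \<omega>)\<^sup>2)"
    and C: "\<And>i. expectation (\<lambda>\<omega>. (D i \<omega>)\<^sup>2) \<le> C"
    and orth: "\<And>i j. i < j \<Longrightarrow> expectation (\<lambda>\<omega>. D i \<omega> * D j \<omega>) = 0"
    and I: "finite I"
  shows "integrable M (\<lambda>\<omega>. (\<Sum>i\<in>I. D i \<omega>)\<^sup>2)"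
    and "expectation (\<lambda>\<omega>. (\<Sum>i\<in>I. D i \<omega>)\<^sup>2) \<le> real (card I) * C"
proof -
  have int: "integrable M (\<lambda>\<omega>. D i \<omega> * D j \<omega>)" for i j
    by (intro integrable_mult_L2 rv sq)
  have off: "expectation (\<lambda>\<omega>. D i \<omega> * D j \<omega>) = (if i = j then expectation (\<lambda>\<omega>. (D i \<omega>)\<^sup>2) else 0)" for i j
    using orth[of i j] orth[of j i] by (cases i j rule: linorder_cases) (auto simp: mult.commute power2_eq_square)
  have eq: "(\<Sum>i\<in>I. D i \<omega>)\<^sup>2 = (\<Sum>i\<in>I. \<Sum>j\<in>I. D i \<omega> * D j \<omega>)" for \<omega>
    by (simp add: power2_eq_square sum_product)
  show "integrable M (\<lambda>\<omega>. (\<Sum>i\<in>I. D i \<omega>)\<^sup>2)"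
    unfolding eq by (intro Bochner_Integration.integrable_sum int)
  have "expectation (\<lambda>\<omega>. (\<Sum>i\<in>I. D i \<omega>)\<^sup>2) = (\<Sum>i\<in>I. \<Sum>j\<in>I. expectation (\<lambda>\<omega>. D i \<omega> * D j \<omega>))"
    unfolding eq by (simp add: int Bochner_Integration.integrable_sum)
  also have "\<dots> = (\<Sum>i\<in>I. expectation (\<lambda>\<omega>. (D i \<omega>)\<^sup>2))"
    unfolding off using I by (simp add: sum.delta)
  also have "\<dots> \<le> real (card I) * C"
    using sum_bounded_above[of I "\<lambda>i. expectation (\<lambda>\<omega>. (D i \<omega>)\<^sup>2)" C] C by simp
  finally show "expectation (\<lambda>\<omega>. (\<Sum>i\<in>I. D i \<omega>)\<^sup>2) \<le> real (card I) * C" .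
qed

text \<open>Convergence along the squares, with the fluctuation between consecutive squares bounded crudely
  by the sum of all squared increments; the expectations are summable after dividing by \<open>n ^ 4\<close>.\<close>

lemma slln_orthogonal:
  fixes D :: "nat \<Rightarrow> 'a \<Rightarrow> real"
  assumes rv: "\<And>i. D i \<in> borel_measurable M"
    and sq: "\<And>i. integrable M (\<lambda>\<omega>. (D i \<omega>)\<^sup>2)"
    and C: "\<And>i. expectation (\<lambda>\<omega>. (D i \<omega>)\<^sup>2) \<le> C"
    and orth: "\<And>i j. i < j \<Longrightarrow> expectation (\<lambda>\<omega>. D i \<omega> * D j \<omega>) = 0"
  shows "AE \<omega> in M. (\<lambda>n. (\<Sum>i<n. D i \<omega>) / real n) \<longlonglongrightarrow> 0"
proof -
  have sq_sum: "integrable M (\<lambda>\<omega>. (\<Sum>i\<in>I. D i \<omega>)\<^sup>2)"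
    "expectation (\<lambda>\<omega>. (\<Sum>i\<in>I. D i \<omega>)\<^sup>2) \<le> real (card I) * C" if "finite I" for I
    using expectation_square_sum_orthogonal[OF rv sq C orth that] by auto
  \<comment> \<open>For every \<open>m\<close> between consecutive squares, the partial sum up to
    \<open>m\<close> is a sum up to \<open>n\<^sup>2\<close> plus a piece of one block, and
    \<open>Q n\<close> dominates the square of each. A block has \<open>2 * n + 1\<close> members,
    so the expectation of \<open>Q n\<close> is of order \<open>n\<^sup>2\<close>.\<close>
  define Q where "Q n \<omega> = (\<Sum>i\<in>{..<n\<^sup>2}. D i \<omega>)\<^sup>2 +
    (\<Sum>m\<in>{n\<^sup>2..<(Suc n)\<^sup>2}. (\<Sum>i\<in>{n\<^sup>2..<m}. D i \<omega>)\<^sup>2)" for n \<omega>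
  have "C \<ge> 0" using order.trans[OF _ C[of 0]] by simp
  have Q_int: "integrable M (Q n)" for n
    unfolding Q_def[abs_def]
    by (intro Bochner_Integration.integrable_add Bochner_Integration.integrable_sum sq_sum) auto
  have Q_nonneg: "0 \<le> Q n \<omega>" for n \<omega>
    unfolding Q_def by (intro add_nonneg_nonneg sum_nonneg) auto
  have diff: "(Suc n)\<^sup>2 - n\<^sup>2 = 2 * n + 1" for n :: nat
    by (simp add: power2_eq_square)
  have Q_le: "expectation (Q n) \<le> (real n)\<^sup>2 * C + (2 * real n + 1)\<^sup>2 * C" for n
  proof -
    have "expectation (Q n) = expectation (\<lambda>\<omega>. (\<Sum>i\<in>{..<n\<^sup>2}. D i \<omega>)\<^sup>2) +
        (\<Sum>m\<in>{n\<^sup>2..<(Suc n)\<^sup>2}. expectation (\<lambda>\<omega>. (\<Sum>i\<in>{n\<^sup>2..<m}. D i \<omega>)\<^sup>2))"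
      unfolding Q_def using sq_sum(1) by (simp add: Bochner_Integration.integrable_sum)
    also have "\<dots> \<le> real (card {..<n\<^sup>2}) * C + (\<Sum>m\<in>{n\<^sup>2..<(Suc n)\<^sup>2}. (2 * real n + 1) * C)"
    proof (intro add_mono sum_mono sq_sum)
      fix m assume m: "m \<in> {n\<^sup>2..<(Suc n)\<^sup>2}"
      have "expectation (\<lambda>\<omega>. (\<Sum>i\<in>{n\<^sup>2..<m}. D i \<omega>)\<^sup>2) \<le> real (card {n\<^sup>2..<m}) * C"
        by (rule sq_sum(2)) simp
      also have "real (card {n\<^sup>2..<m}) \<le> real (2 * n + 1)"
        using m diff[of n] by (intro of_nat_mono) auto
      finally show "expectation (\<lambda>\<omega>. (\<Sum>i\<in>{n\<^sup>2..<m}. D i \<omega>)\<^sup>2) \<le> (2 * real n + 1) * C"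
        using \<open>C \<ge> 0\<close> by (simp add: mult_right_mono add.commute)
    qed auto
    also have "\<dots> = (real n)\<^sup>2 * C + (2 * real n + 1)\<^sup>2 * C"
      unfolding sum_constant card_atLeastLessThan diff by (simp add: power2_eq_square)
    finally show ?thesis .
  qed
  have "AE \<omega> in M. (\<lambda>n. Q n \<omega> / real n ^ 4) \<longlonglongrightarrow> 0"
  proof (rule AE_tendsto_zero_if_summable_expectation)
    show "summable (\<lambda>n. expectation (\<lambda>\<omega>. Q n \<omega> / real n ^ 4))"
    proof (rule summable_comparison_test)
      \<comment> \<open>The 10 is 1 + 9, from \<open>2 * n + 1 \<le> 3 * n\<close> for
        \<open>n \<ge> 1\<close>; at \<open>n = 0\<close> both sides are 0 by the convention for
        division.\<close>
      show "summable (\<lambda>n. 10 * C * (1 / real n ^ 2))"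
        using inverse_power_summable[of 2, where ?'a = real] by (intro summable_mult) (simp add: field_simps)
      have "norm (expectation (\<lambda>\<omega>. Q n \<omega> / real n ^ 4)) \<le> 10 * C * (1 / real n ^ 2)" for n
      proof (cases "n = 0")
        case False
        then have n: "1 \<le> real n" by simp
        have "expectation (Q n) \<le> (real n)\<^sup>2 * C + (2 * real n + 1)\<^sup>2 * C" by (rule Q_le)
        also have "\<dots> \<le> (real n)\<^sup>2 * C + (3 * real n)\<^sup>2 * C"
          using n \<open>C \<ge> 0\<close> by (intro add_left_mono mult_right_mono power_mono) auto
        finally have "expectation (Q n) \<le> 10 * C * (real n)\<^sup>2"
          by (simp add: power2_eq_square algebra_simps)
        then have "expectation (Q n) / real n ^ 4 \<le> 10 * C * (real n)\<^sup>2 / real n ^ 4"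
          by (intro divide_right_mono) auto
        also have "\<dots> = 10 * C * (1 / real n ^ 2)"
          using n by (simp add: field_simps power2_eq_square power4_eq_xxxx)
        finally show ?thesis
          using Q_nonneg by (simp add: abs_of_nonneg integral_nonneg)
      qed simp
      then show "\<exists>N. \<forall>n\<ge>N. norm (expectation (\<lambda>\<omega>. Q n \<omega> / real n ^ 4)) \<le> 10 * C * (1 / real n ^ 2)"
        by blast
    qed
  qed (use Q_int Q_nonneg in auto)
  then show ?thesis
  proof eventually_elim
    case (elim \<omega>)
    define S where "S n = (\<Sum>i<n. D i \<omega>)" for n
    have bound: "\<bar>S m / real m\<bar> \<le> 2 * sqrt (Q (floor_sqrt m) \<omega> / real (floor_sqrt m) ^ 4)"
      if m: "m \<ge> 1" for m
    proof -
      define n where "n = floor_sqrt m"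
      have nm: "n\<^sup>2 \<le> m" "m < (Suc n)\<^sup>2"
        unfolding n_def using Suc_floor_sqrt_power2_gt by auto
      have "n > 0" using m unfolding n_def by simp
      then have rn: "0 < (real n)\<^sup>2" "(real n)\<^sup>2 \<le> real m"
        using nm(1) by (auto simp flip: of_nat_power)
      have split: "S m = S (n\<^sup>2) + (\<Sum>i\<in>{n\<^sup>2..<m}. D i \<omega>)"
        unfolding S_def lessThan_atLeast0 using nm by (simp add: sum.atLeastLessThan_concat)
      have "(S (n\<^sup>2))\<^sup>2 \<le> Q n \<omega>"
        unfolding Q_def S_def by (simp add: sum_nonneg)
      then have 1: "\<bar>S (n\<^sup>2)\<bar> \<le> sqrt (Q n \<omega>)" using real_le_rsqrt by fastforce
      have "(\<Sum>i\<in>{n\<^sup>2..<m}. D i \<omega>)\<^sup>2 \<le> (\<Sum>m\<in>{n\<^sup>2..<(Suc n)\<^sup>2}. (\<Sum>i\<in>{n\<^sup>2..<m}. D i \<omega>)\<^sup>2)"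
        using nm by (intro member_le_sum) auto
      also have "\<dots> \<le> Q n \<omega>" unfolding Q_def by simp
      finally have 2: "\<bar>\<Sum>i\<in>{n\<^sup>2..<m}. D i \<omega>\<bar> \<le> sqrt (Q n \<omega>)" using real_le_rsqrt by fastforce
      have "\<bar>S m\<bar> \<le> 2 * sqrt (Q n \<omega>)" unfolding split using 1 2 by linarith
      then have "\<bar>S m / real m\<bar> \<le> 2 * sqrt (Q n \<omega>) / (real n)\<^sup>2"
        unfolding abs_divide using rn Q_nonneg[of n \<omega>] by (intro frac_le) auto
      also have "(real n)\<^sup>2 = sqrt (real n ^ 4)"
        by (rule real_sqrt_unique[symmetric]) auto
      finally show ?thesis by (simp add: real_sqrt_divide n_def)
    qed
    have lim: "filterlim floor_sqrt sequentially sequentially"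
      unfolding filterlim_at_top eventually_sequentially
    proof
      fix N :: nat
      have "N \<le> floor_sqrt m" if "m \<ge> N\<^sup>2" for m
        using mono_floor_sqrt'[OF that] by simp
      then show "\<exists>k. \<forall>m\<ge>k. N \<le> floor_sqrt m" by blast
    qed
    have "(\<lambda>n. 2 * sqrt (Q n \<omega> / real n ^ 4)) \<longlonglongrightarrow> 2 * sqrt 0"
      by (intro tendsto_intros elim)
    from filterlim_compose[OF this lim]
    have "(\<lambda>m. 2 * sqrt (Q (floor_sqrt m) \<omega> / real (floor_sqrt m) ^ 4)) \<longlonglongrightarrow> 0" by simp
    then have "(\<lambda>m. S m / real m) \<longlonglongrightarrow> 0"
      by (rule Lim_null_comparison[rotated])
        (rule eventually_mono[OF eventually_ge_at_top[of 1]], simp only: real_norm_def bound)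
    then show ?case unfolding S_def .
  qed
qed

lemma indep_var_past:
  fixes X :: "nat \<Rightarrow> 'a \<Rightarrow> real"
  assumes ind: "indep_vars (\<lambda>_. borel) X {..<Suc n}"
    and f: "f \<in> borel_measurable borel" and g: "g \<in> borel_measurable (Pi\<^sub>M {..<n} (\<lambda>_. borel :: real measure))"
  shows "indep_var borel (\<lambda>\<omega>. f (X n \<omega>) :: real) borel (\<lambda>\<omega>. g (\<lambda>k\<in>{..<n}. X k \<omega>) :: real)"
proof -
  have "indep_var (Pi\<^sub>M {n} (\<lambda>_. borel)) (\<lambda>\<omega>. \<lambda>k\<in>{n}. X k \<omega>) (Pi\<^sub>M {..<n} (\<lambda>_. borel)) (\<lambda>\<omega>. \<lambda>k\<in>{..<n}. X k \<omega>)"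
    by (rule indep_var_restrict[OF ind]) auto
  moreover have "(\<lambda>r. f (r n)) \<in> borel_measurable (Pi\<^sub>M {n} (\<lambda>_. borel :: real measure))"
    using f by measurable
  ultimately have "indep_var borel ((\<lambda>r. f (r n)) \<circ> (\<lambda>\<omega>. \<lambda>k\<in>{n}. X k \<omega>)) borel (g \<circ> (\<lambda>\<omega>. \<lambda>k\<in>{..<n}. X k \<omega>))"
    using g by (rule indep_var_compose)
  then show ?thesis by (simp add: comp_def)
qed

text \<open>The weight \<open>W i\<close> depends only on innovations before index
  \<open>i + h\<close>, so the products behave like martingale differences: in a mixed moment the
  latest innovation is independent of everything else and has mean 0. Expressing the past through
  \<open>w i\<close> on a product space covers constant weights, geometric weights and the
  autoregression itself at once.\<close>

lemma slln_innovations: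
  fixes X :: "nat \<Rightarrow> 'a \<Rightarrow> real" and f :: "real \<Rightarrow> real" and w :: "nat \<Rightarrow> (nat \<Rightarrow> real) \<Rightarrow> real"
  assumes ind: "\<And>n. indep_vars (\<lambda>_. borel) X {..<n}"
    and f: "f \<in> borel_measurable borel"
    and f_sq: "\<And>i. integrable M (\<lambda>\<omega>. (f (X i \<omega>))\<^sup>2)" "\<And>i. expectation (\<lambda>\<omega>. (f (X i \<omega>))\<^sup>2) \<le> A"
    and f_mean: "\<And>i. expectation (\<lambda>\<omega>. f (X i \<omega>)) = 0"
    and w: "\<And>i. w i \<in> borel_measurable (Pi\<^sub>M {..<i + h} (\<lambda>_. borel))"
    and W: "\<And>i \<omega>. W i \<omega> = w i (\<lambda>k\<in>{..<i + h}. X k \<omega>)"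
    and W_sq: "\<And>i. integrable M (\<lambda>\<omega>. (W i \<omega>)\<^sup>2)" "\<And>i. expectation (\<lambda>\<omega>. (W i \<omega>)\<^sup>2) \<le> B"
  shows "AE \<omega> in M. (\<lambda>n. (\<Sum>i<n. f (X (i + h) \<omega>) * W i \<omega>) / real n) \<longlonglongrightarrow> 0"
proof (rule slln_orthogonal)
  note f[measurable] w[measurable]
  have X[measurable]: "X i \<in> borel_measurable M" for i
    using ind[of "Suc i"] by (auto simp: indep_vars_def)
  have W_rv[measurable]: "W i \<in> borel_measurable M" for i
    unfolding W[abs_def] by measurable
  have A: "A \<ge> 0" using order.trans[OF _ f_sq(2)[of 0]] by simp
  show "(\<lambda>\<omega>. f (X (i + h) \<omega>) * W i \<omega>) \<in> borel_measurable M" for i by measurable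
  have ind_sq: "indep_var borel (\<lambda>\<omega>. (f (X (i + h) \<omega>))\<^sup>2) borel (\<lambda>\<omega>. (W i \<omega>)\<^sup>2)" for i
    unfolding W using indep_var_past[OF ind, of "\<lambda>x. (f x)\<^sup>2" "\<lambda>r. (w i r)\<^sup>2" "i + h"] by measurable
  show sq: "integrable M (\<lambda>\<omega>. (f (X (i + h) \<omega>) * W i \<omega>)\<^sup>2)" for i
    unfolding power_mult_distrib by (rule indep_var_integrable[OF ind_sq f_sq(1) W_sq(1)])
  show "expectation (\<lambda>\<omega>. (f (X (i + h) \<omega>) * W i \<omega>)\<^sup>2) \<le> A * B" for i
    unfolding power_mult_distrib indep_var_lebesgue_integral[OF ind_sq f_sq(1) W_sq(1)]
    using A by (intro mult_mono f_sq W_sq integral_nonneg) auto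
  show "expectation (\<lambda>\<omega>. f (X (i + h) \<omega>) * W i \<omega> * (f (X (j + h) \<omega>) * W j \<omega>)) = 0"
    if ij: "i < j" for i j
  proof -
    define G where "G \<omega> = f (X (i + h) \<omega>) * W i \<omega> * W j \<omega>" for \<omega>
    \<comment> \<open>The three earlier factors as one function of the coordinates below
      \<open>j + h\<close>; \<open>w i\<close> must be fed the restriction, since it lives on a
      smaller product space.\<close>
    define \<gamma> where "\<gamma> r = f (r (i + h)) * w i (restrict r {..<i + h}) * w j r" for r
    have G: "G \<omega> = \<gamma> (\<lambda>k\<in>{..<j + h}. X k \<omega>)" for \<omega>
    proof -
      have "{..<j + h} \<inter> {..<i + h} = {..<i + h}" using ij by auto
      then show ?thesis using ij unfolding G_def \<gamma>_def W by (simp add: restrict_restrict)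
    qed
    have [measurable]: "\<gamma> \<in> borel_measurable (Pi\<^sub>M {..<j + h} (\<lambda>_. borel))"
    proof -
      have [measurable]: "(\<lambda>r. restrict r {..<i + h}) \<in> Pi\<^sub>M {..<j + h} (\<lambda>_. borel :: real measure) \<rightarrow>\<^sub>M Pi\<^sub>M {..<i + h} (\<lambda>_. borel)"
        using ij by (intro measurable_restrict_subset) auto
      have [measurable]: "(\<lambda>r. r (i + h)) \<in> borel_measurable (Pi\<^sub>M {..<j + h} (\<lambda>_. borel :: real measure))"
        using ij by (intro measurable_component_singleton) auto
      show ?thesis unfolding \<gamma>_def by measurable
    qed
    have ind_G: "indep_var borel (\<lambda>\<omega>. f (X (j + h) \<omega>)) borel G"
      unfolding G[abs_def] by (rule indep_var_past[OF ind]) measurable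
    have "integrable M (\<lambda>\<omega>. (f (X (i + h) \<omega>) * W i \<omega>) * W j \<omega>)"
      by (intro integrable_mult_L2 sq W_sq) measurable
    then have G_int: "integrable M G" by (simp add: G_def[abs_def])
    have f_int: "integrable M (\<lambda>\<omega>. f (X (j + h) \<omega>))"
      using integrable_mult_L2[of "\<lambda>\<omega>. f (X (j + h) \<omega>)" "\<lambda>_. 1"] f_sq(1) by simp
    have "expectation (\<lambda>\<omega>. f (X (i + h) \<omega>) * W i \<omega> * (f (X (j + h) \<omega>) * W j \<omega>)) =
        expectation (\<lambda>\<omega>. f (X (j + h) \<omega>) * G \<omega>)"
      by (simp add: G_def mult_ac)
    also have "\<dots> = expectation (\<lambda>\<omega>. f (X (j + h) \<omega>)) * expectation G"
      by (rule indep_var_lebesgue_integral[OF ind_G f_int G_int])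
    finally show ?thesis by (simp add: f_mean)
  qed
qed

end

section \<open>Limits of random variables and characteristic functions\<close>

text \<open>Serves to approximate indicators of closed sets by continuous functions. The empty set
  is separated because \<open>infdist\<close> to it is 0 by convention.\<close>

lemma closed_zero_set:
  fixes S :: "real set"
  assumes "closed S"
  shows "\<exists>g :: real \<Rightarrow> real. continuous_on UNIV g \<and> (\<forall>x. 0 \<le> g x) \<and> (\<forall>x. g x = 0 \<longleftrightarrow> x \<in> S)"
proof (cases "S = {}")
  case True
  show ?thesis by (rule exI[of _ "\<lambda>_. 1"]) (simp add: True)
next
  case False
  show ?thesis
    by (rule exI[of _ "\<lambda>x. infdist x S"])
      (simp add: infdist_nonneg in_closed_iff_infdist_zero[OF assms False] continuous_on_infdist)
qed

context prob_space
begin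

text \<open>Factorisation of expectations passes to the limit for bounded continuous functions by
  dominated convergence, then to indicators of closed sets, and these form an intersection-stable
  generator of the Borel sets.\<close>

lemma indep_vars_AE_limit:
  fixes X :: "nat \<Rightarrow> 'i \<Rightarrow> 'a \<Rightarrow> real"
  assumes I: "finite I" and ind: "\<And>N. indep_vars (\<lambda>_. borel) (X N) I"
    and Y: "\<And>i. i \<in> I \<Longrightarrow> Y i \<in> borel_measurable M"
    and lim: "\<And>i. i \<in> I \<Longrightarrow> AE \<omega> in M. (\<lambda>N. X N i \<omega>) \<longlonglongrightarrow> Y i \<omega>"
  shows "indep_vars (\<lambda>_. borel) Y I"
proof (cases "I = {}")
  case True
  then show ?thesis by (simp add: indep_vars_def indep_sets_def)
next
  case False
  have X: "X N i \<in> borel_measurable M" if "i \<in> I" for N i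
    using ind[of N] that by (auto simp: indep_vars_def)
  have prod_expectation: "expectation (\<lambda>\<omega>. \<Prod>i\<in>I. f i (Y i \<omega>)) = (\<Prod>i\<in>I. expectation (\<lambda>\<omega>. f i (Y i \<omega>)))"
    if f: "\<And>i. continuous_on UNIV (f i)" "\<And>i x. \<bar>f i x\<bar> \<le> 1" for f :: "'i \<Rightarrow> real \<Rightarrow> real"
  proof (rule LIMSEQ_unique)
    have [measurable]: "f i \<in> borel_measurable borel" for i
      by (intro borel_measurable_continuous_onI f)
    note X[measurable] Y[measurable]
    have f_lim: "AE \<omega> in M. (\<lambda>N. f i (X N i \<omega>)) \<longlonglongrightarrow> f i (Y i \<omega>)" if "i \<in> I" for i
      using lim[OF that]
    proof eventually_elim
      case (elim \<omega>)
      show ?case by (rule continuous_on_tendsto_compose[OF f(1) elim]) auto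
    qed
    have f_lim_all: "AE \<omega> in M. \<forall>i\<in>I. (\<lambda>N. f i (X N i \<omega>)) \<longlonglongrightarrow> f i (Y i \<omega>)"
      using f_lim I by (intro AE_finite_allI) auto
    show "(\<lambda>N. expectation (\<lambda>\<omega>. \<Prod>i\<in>I. f i (X N i \<omega>))) \<longlonglongrightarrow> expectation (\<lambda>\<omega>. \<Prod>i\<in>I. f i (Y i \<omega>))"
    proof (rule integral_dominated_convergence[where w = "\<lambda>_. 1"])
      show "AE \<omega> in M. (\<lambda>N. \<Prod>i\<in>I. f i (X N i \<omega>)) \<longlonglongrightarrow> (\<Prod>i\<in>I. f i (Y i \<omega>))"
        using f_lim_all by eventually_elim (intro tendsto_prod, auto)
      show "AE \<omega> in M. norm (\<Prod>i\<in>I. f i (X N i \<omega>)) \<le> 1" for N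
        using f(2) by (auto simp: abs_prod intro!: prod_le_1)
    qed (auto intro!: borel_measurable_prod)
    have "expectation (\<lambda>\<omega>. \<Prod>i\<in>I. f i (X N i \<omega>)) = (\<Prod>i\<in>I. expectation (\<lambda>\<omega>. f i (X N i \<omega>)))" for N
    proof (rule indep_vars_lebesgue_integral[OF I])
      show "indep_vars (\<lambda>_. borel) (\<lambda>i \<omega>. f i (X N i \<omega>)) I"
        by (rule indep_vars_compose2[OF ind]) measurable
      show "integrable M (\<lambda>\<omega>. f i (X N i \<omega>))" if "i \<in> I" for i
        using that f(2) by (intro integrable_const_bound[where B = 1]) auto
    qed
    moreover have "(\<lambda>N. \<Prod>i\<in>I. expectation (\<lambda>\<omega>. f i (X N i \<omega>))) \<longlonglongrightarrow> (\<Prod>i\<in>I. expectation (\<lambda>\<omega>. f i (Y i \<omega>)))"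
    proof (rule tendsto_prod)
      fix i assume i: "i \<in> I"
      show "(\<lambda>N. expectation (\<lambda>\<omega>. f i (X N i \<omega>))) \<longlonglongrightarrow> expectation (\<lambda>\<omega>. f i (Y i \<omega>))"
      proof (rule integral_dominated_convergence[where w = "\<lambda>_. 1"])
        show "AE \<omega> in M. (\<lambda>N. f i (X N i \<omega>)) \<longlonglongrightarrow> f i (Y i \<omega>)" by (rule f_lim[OF i])
        show "AE \<omega> in M. norm (f i (X N i \<omega>)) \<le> 1" for N by (simp add: f)
      qed (use i in simp_all)
    qed
    ultimately show "(\<lambda>N. expectation (\<lambda>\<omega>. \<Prod>i\<in>I. f i (X N i \<omega>))) \<longlonglongrightarrow> (\<Prod>i\<in>I. expectation (\<lambda>\<omega>. f i (Y i \<omega>)))"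
      by (simp only:)
  qed
  have "prob (\<Inter>j\<in>I. Y j -` S j \<inter> space M) = (\<Prod>j\<in>I. prob (Y j -` S j \<inter> space M))"
    if S: "\<And>j. j \<in> I \<Longrightarrow> closed (S j)" for S
  proof -
    note Y[measurable]
    have S_sets[measurable]: "S j \<in> sets borel" if "j \<in> I" for j by (rule borel_closed[OF S[OF that]])
    have "\<forall>j\<in>I. \<exists>g :: real \<Rightarrow> real. continuous_on UNIV g \<and> (\<forall>x. 0 \<le> g x) \<and> (\<forall>x. g x = 0 \<longleftrightarrow> x \<in> S j)"
    proof
      fix j assume "j \<in> I"
      then show "\<exists>g :: real \<Rightarrow> real. continuous_on UNIV g \<and> (\<forall>x. 0 \<le> g x) \<and> (\<forall>x. g x = 0 \<longleftrightarrow> x \<in> S j)"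
        by (rule closed_zero_set[OF S])
    qed
    from bchoice[OF this] obtain g :: "'i \<Rightarrow> real \<Rightarrow> real" where g: "\<And>j. j \<in> I \<Longrightarrow> continuous_on UNIV (g j)"
      "\<And>j x. j \<in> I \<Longrightarrow> 0 \<le> g j x" "\<And>j x. j \<in> I \<Longrightarrow> g j x = 0 \<longleftrightarrow> x \<in> S j"
      by auto
    \<comment> \<open>Continuous functions that are 1 on \<open>S j\<close> and vanish from some
      \<open>k\<close> on at each point outside. The value 0 for indices outside \<open>I\<close>
      makes continuity and the bound hold without side condition.\<close>
    define f where "f k j x = (if j \<in> I then max 0 (1 - real k * g j x) else 0)" for k :: nat and j x
    have f_cont: "continuous_on UNIV (f k j)" for k j
      unfolding f_def by (cases "j \<in> I") (auto intro!: continuous_intros g)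
    have f_bound: "\<bar>f k j x\<bar> \<le> 1" for k j x
      unfolding f_def using g(2) by (auto simp: max_def)
    have [measurable]: "f k j \<in> borel_measurable borel" for k j
      by (intro borel_measurable_continuous_onI f_cont)
    have f_lim: "(\<lambda>k. f k j x) \<longlonglongrightarrow> indicator (S j) x" if j: "j \<in> I" for j x
    proof (cases "x \<in> S j")
      case True
      then have "g j x = 0" using g(3)[OF j] by blast
      then have "f k j x = 1" for k by (simp add: f_def j)
      with True show ?thesis by simp
    next
      case False
      with g(2,3)[OF j, of x] have pos: "g j x > 0" by (simp add: less_le)
      obtain K :: nat where K: "1 / g j x < real K" using reals_Archimedean2 by blast
      have "f k j x = 0" if "k \<ge> K" for k
      proof -
        have "1 / g j x < real k" using K that by simp
        then have "1 < real k * g j x" using pos by (simp add: field_simps)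
        then show ?thesis by (simp add: f_def)
      qed
      then have "\<forall>\<^sub>F k in sequentially. f k j x = 0" unfolding eventually_sequentially by blast
      with False show ?thesis by (simp add: tendsto_eventually)
    qed
    have "expectation (\<lambda>\<omega>. \<Prod>j\<in>I. indicat_real (S j) (Y j \<omega>)) = (\<Prod>j\<in>I. expectation (\<lambda>\<omega>. indicat_real (S j) (Y j \<omega>)))"
    proof (rule LIMSEQ_unique)
      show "(\<lambda>k. expectation (\<lambda>\<omega>. \<Prod>j\<in>I. f k j (Y j \<omega>))) \<longlonglongrightarrow> expectation (\<lambda>\<omega>. \<Prod>j\<in>I. indicat_real (S j) (Y j \<omega>))"
      proof (rule integral_dominated_convergence[where w = "\<lambda>_. 1"])
        show "AE \<omega> in M. (\<lambda>k. \<Prod>j\<in>I. f k j (Y j \<omega>)) \<longlonglongrightarrow> (\<Prod>j\<in>I. indicat_real (S j) (Y j \<omega>))"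
          by (intro AE_I2 tendsto_prod f_lim)
        show "AE \<omega> in M. norm (\<Prod>j\<in>I. f k j (Y j \<omega>)) \<le> 1" for k
          using f_bound by (auto simp: abs_prod intro!: prod_le_1)
      qed (auto intro!: borel_measurable_prod)
      have "(\<lambda>k. \<Prod>j\<in>I. expectation (\<lambda>\<omega>. f k j (Y j \<omega>))) \<longlonglongrightarrow> (\<Prod>j\<in>I. expectation (\<lambda>\<omega>. indicat_real (S j) (Y j \<omega>)))"
      proof (rule tendsto_prod)
        fix j assume j: "j \<in> I"
        show "(\<lambda>k. expectation (\<lambda>\<omega>. f k j (Y j \<omega>))) \<longlonglongrightarrow> expectation (\<lambda>\<omega>. indicat_real (S j) (Y j \<omega>))"
        proof (rule integral_dominated_convergence[where w = "\<lambda>_. 1"])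
          show "AE \<omega> in M. (\<lambda>k. f k j (Y j \<omega>)) \<longlonglongrightarrow> indicat_real (S j) (Y j \<omega>)"
            by (intro AE_I2 f_lim j)
          show "AE \<omega> in M. norm (f k j (Y j \<omega>)) \<le> 1" for k by (simp add: f_bound)
        qed (use j in simp_all)
      qed
      then show "(\<lambda>k. expectation (\<lambda>\<omega>. \<Prod>j\<in>I. f k j (Y j \<omega>))) \<longlonglongrightarrow> (\<Prod>j\<in>I. expectation (\<lambda>\<omega>. indicat_real (S j) (Y j \<omega>)))"
        unfolding prod_expectation[OF f_cont f_bound] .
    qed
    moreover have "expectation (\<lambda>\<omega>. indicat_real (S j) (Y j \<omega>)) = prob (Y j -` S j \<inter> space M)" if j: "j \<in> I" for j
    proof -
      have "expectation (\<lambda>\<omega>. indicat_real (S j) (Y j \<omega>)) = expectation (indicat_real (Y j -` S j \<inter> space M))"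
        by (intro Bochner_Integration.integral_cong) (auto simp: indicator_def)
      also have "\<dots> = prob (Y j -` S j \<inter> space M)"
        by simp
      finally show ?thesis .
    qed
    moreover have "expectation (\<lambda>\<omega>. \<Prod>j\<in>I. indicat_real (S j) (Y j \<omega>)) = prob (\<Inter>j\<in>I. Y j -` S j \<inter> space M)"
    proof -
      have meas: "(\<Inter>j\<in>I. Y j -` S j \<inter> space M) \<in> sets M"
        using I False by (intro sets.finite_INT) auto
      have "expectation (\<lambda>\<omega>. \<Prod>j\<in>I. indicat_real (S j) (Y j \<omega>)) = expectation (indicat_real (\<Inter>j\<in>I. Y j -` S j \<inter> space M))"
      proof (rule Bochner_Integration.integral_cong[OF refl])
        fix \<omega> assume "\<omega> \<in> space M"
        then show "(\<Prod>j\<in>I. indicat_real (S j) (Y j \<omega>)) = (indicat_real (\<Inter>j\<in>I. Y j -` S j \<inter> space M) \<omega> :: real)"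
          using I by (auto simp: indicator_def prod_zero_iff)
      qed
      also have "\<dots> = prob (\<Inter>j\<in>I. Y j -` S j \<inter> space M)"
        using sets.sets_into_space[OF meas] by (simp add: Int_absorb2)
      finally show ?thesis .
    qed
    ultimately show ?thesis by simp
  qed
  note closed_prob = this
  show ?thesis
  proof (subst indep_vars_finite[where E = "\<lambda>_. Collect closed", OF False I])
    show "sets borel = sigma_sets (space (borel :: real measure)) (Collect closed)" 
      by (subst borel_eq_closed) simp
    show "\<forall>S\<in>I \<rightarrow> Collect closed. prob (\<Inter>j\<in>I. Y j -` S j \<inter> space M) = (\<Prod>j\<in>I. prob (Y j -` S j \<inter> space M))"
      using closed_prob by (auto simp: Pi_iff)
  qed (auto simp: Y Int_stable_def)
qed

text \<open>Borel-Cantelli: the probabilities that \<open>Suc k\<close> times the square exceeds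
  \<open>Suc n\<close> are summable over \<open>n\<close>, because their sum is at most
  \<open>Suc k\<close> times the second moment. Intersecting over all \<open>k\<close> gives the
  limit 0.\<close>

lemma identically_distributed_growth:
  fixes X :: "nat \<Rightarrow> 'a \<Rightarrow> real"
  assumes X: "\<And>n. X n \<in> borel_measurable M"
    and eq: "\<And>n. distr M borel (X n) = distr M borel (X 0)"
    and sq: "integrable M (\<lambda>\<omega>. (X 0 \<omega>)\<^sup>2)"
  shows "AE \<omega> in M. (\<lambda>n. X n \<omega> / sqrt (real (Suc n))) \<longlonglongrightarrow> 0"
proof -
  note X[measurable]
  have ev: "AE \<omega> in M. \<forall>\<^sub>F n in sequentially. real (Suc k) * (X n \<omega>)\<^sup>2 \<le> real (Suc n)" for k
  proof -
    define A where "A n = {\<omega> \<in> space M. real (Suc n) < real (Suc k) * (X n \<omega>)\<^sup>2}" for n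
    have [measurable]: "A n \<in> sets M" for n unfolding A_def by measurable
    define B where "B n = {\<omega> \<in> space M. real (Suc n) < real (Suc k) * (X 0 \<omega>)\<^sup>2}" for n
    have [measurable]: "B n \<in> sets M" for n unfolding B_def by measurable
    have AB: "prob (A n) = prob (B n)" for n
    proof -
      have S: "{x. real (Suc n) < real (Suc k) * x\<^sup>2} \<in> sets borel" by measurable
      have *: "prob {\<omega> \<in> space M. real (Suc n) < real (Suc k) * (X m \<omega>)\<^sup>2} =
          measure (distr M borel (X m)) {x. real (Suc n) < real (Suc k) * x\<^sup>2}" for m
        unfolding measure_distr[OF X S] by (simp only: vimage_def mem_Collect_eq Int_def conj_commute)
      show ?thesis unfolding A_def B_def * eq[of n] ..
    qed
    \<comment> \<open>A discrete layer-cake bound: at most \<open>x\<close> positive integers lie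
      below \<open>x\<close>. The minimum with \<open>N\<close> makes the induction go
      through.\<close>
    have count: "(\<Sum>n<N. if real (Suc n) < x then 1 else 0) \<le> min (real N) x" if "0 \<le> x" for x N
    proof (induction N)
      case (Suc N)
      then show ?case by (cases "real (Suc N) < x") simp_all
    qed (use that in simp)
    have "summable (\<lambda>n. prob (B n))"
    proof (rule summableI_nonneg_bounded)
      fix N
      have "(\<Sum>n<N. prob (B n)) = expectation (\<lambda>\<omega>. \<Sum>n<N. indicator (B n) \<omega>)"
        by (subst Bochner_Integration.integral_sum) (auto simp: emeasure_eq_measure)
      also have "\<dots> \<le> expectation (\<lambda>\<omega>. real (Suc k) * (X 0 \<omega>)\<^sup>2)"
      proof (rule integral_mono)
        fix \<omega> assume "\<omega> \<in> space M"
        then have "(\<Sum>n<N. indicator (B n) \<omega>) = (\<Sum>n<N. if real (Suc n) < real (Suc k) * (X 0 \<omega>)\<^sup>2 then 1 else (0::real))"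
          by (intro sum.cong) (auto simp: B_def)
        also have "\<dots> \<le> real (Suc k) * (X 0 \<omega>)\<^sup>2"
          using count[of "real (Suc k) * (X 0 \<omega>)\<^sup>2" N] by simp
        finally show "(\<Sum>n<N. indicator (B n) \<omega>) \<le> real (Suc k) * (X 0 \<omega>)\<^sup>2" .
      qed (use sq in \<open>auto intro!: Bochner_Integration.integrable_sum simp: emeasure_eq_measure\<close>)
      finally show "(\<Sum>n<N. prob (B n)) \<le> expectation (\<lambda>\<omega>. real (Suc k) * (X 0 \<omega>)\<^sup>2)" .
    qed simp
    then have "AE \<omega> in M. \<forall>\<^sub>F n in sequentially. \<omega> \<in> space M - A n"
      by (intro borel_cantelli_AE1) (auto simp: AB emeasure_eq_measure)
    then show ?thesis
    proof eventually_elim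
      case (elim \<omega>)
      then show ?case
        by (rule eventually_mono) (simp add: A_def not_less del: of_nat_Suc)
    qed
  qed
  have "AE \<omega> in M. \<forall>k. \<forall>\<^sub>F n in sequentially. real (Suc k) * (X n \<omega>)\<^sup>2 \<le> real (Suc n)"
    using ev by (simp add: AE_all_countable)
  then show ?thesis
  proof eventually_elim
    case (elim \<omega>)
    have "(\<lambda>n. (X n \<omega>)\<^sup>2 / real (Suc n)) \<longlonglongrightarrow> 0"
    proof (rule tendstoI)
      fix e :: real assume "e > 0"
      then obtain k where k: "inverse (real (Suc k)) < e" using reals_Archimedean by blast
      show "\<forall>\<^sub>F n in sequentially. dist ((X n \<omega>)\<^sup>2 / real (Suc n)) 0 < e"
        using elim[rule_format, of k]
      proof eventually_elim
        case (elim n)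
        then have "(X n \<omega>)\<^sup>2 / real (Suc n) \<le> inverse (real (Suc k))"
          by (simp add: divide_simps mult.commute del: of_nat_Suc)
        with k show ?case by (simp add: dist_real_def del: of_nat_Suc)
      qed
    qed
    from tendsto_real_sqrt[OF this]
    have "(\<lambda>n. \<bar>X n \<omega>\<bar> / sqrt (real (Suc n))) \<longlonglongrightarrow> 0"
      by (simp only: real_sqrt_divide real_sqrt_abs real_sqrt_zero)
    then have "(\<lambda>n. \<bar>X n \<omega> / sqrt (real (Suc n))\<bar>) \<longlonglongrightarrow> 0"
      by (simp add: abs_divide)
    then show ?case by (rule tendsto_rabs_zero_cancel)
  qed
qed

end

section \<open>Second moments and degeneracy read off a characteristic function\<close>

context real_distribution
begin

lemma prob_UNIV: "prob UNIV = 1"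
  using prob_space by simp

lemma Re_char: "Re (char M u) = expectation (\<lambda>x. cos (u * x))"
proof -
  have "integrable M (\<lambda>x. iexp (u * x))" by (intro integrable_iexp) auto
  then have "Re (char M u) = expectation (\<lambda>x. Re (iexp (u * x)))"
    unfolding char_def by (rule integral_Re[symmetric])
  then show ?thesis by (simp add: Re_exp)
qed

text \<open>Fatou's lemma for \<open>n\<^sup>2 * (1 - cos (x / n))\<close>, which tends to
  \<open>x\<^sup>2 / 2\<close> and whose expectations are bounded by \<open>D\<close> through the
  real part of the characteristic function at \<open>1 / n\<close>.\<close>

lemma integrable_square_if_char:
  assumes D: "\<And>u. \<bar>u\<bar> \<le> 1 \<Longrightarrow> 1 - Re (char M u) \<le> D * u\<^sup>2"
  shows "integrable M (\<lambda>x. x\<^sup>2)"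
proof -
  define g where "g n x = (real (Suc n))\<^sup>2 * (1 - cos (x / real (Suc n)))" for n and x :: real
  have g_nonneg: "0 \<le> g n x" for n x by (simp add: g_def)
  have [measurable]: "g n \<in> borel_measurable M" for n unfolding g_def by measurable
  have g_int: "integrable M (g n)" for n
    unfolding g_def
    by (intro integrable_mult_right Bochner_Integration.integrable_diff integrable_const
      integrable_const_bound[where B = 1]) (auto simp: abs_cos_le_one)
  have g_le: "(\<integral>\<^sup>+x. ennreal (g n x) \<partial>M) \<le> ennreal D" for n
  proof -
    have "expectation (g n) = (real (Suc n))\<^sup>2 * (1 - Re (char M (1 / real (Suc n))))"
      unfolding Re_char g_def
      by (subst integral_mult_right_zero, subst Bochner_Integration.integral_diff)
        (auto intro!: integrable_const_bound[where B = 1] simp: abs_cos_le_one prob_UNIV)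
    also have "\<dots> \<le> (real (Suc n))\<^sup>2 * (D * (1 / real (Suc n))\<^sup>2)"
      by (intro mult_left_mono D) auto
    also have "\<dots> = D" by (simp add: power_divide del: of_nat_Suc)
    finally show ?thesis
      by (subst nn_integral_eq_integral[OF g_int]) (auto simp: g_nonneg intro: ennreal_leI)
  qed
  have g_lim: "(\<lambda>n. g n x) \<longlonglongrightarrow> x\<^sup>2 / 2" for x
    unfolding g_def by (real_asymp simp: power2_eq_square)
  have "(\<integral>\<^sup>+x. ennreal (x\<^sup>2 / 2) \<partial>M) = (\<integral>\<^sup>+x. liminf (\<lambda>n. ennreal (g n x)) \<partial>M)"
  proof (rule nn_integral_cong)
    fix x
    have "(\<lambda>n. ennreal (g n x)) \<longlonglongrightarrow> ennreal (x\<^sup>2 / 2)"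
      by (intro tendsto_ennrealI g_lim)
    then show "ennreal (x\<^sup>2 / 2) = liminf (\<lambda>n. ennreal (g n x))"
      using lim_imp_Liminf[OF sequentially_bot] by metis
  qed
  also have "\<dots> \<le> liminf (\<lambda>n. \<integral>\<^sup>+x. ennreal (g n x) \<partial>M)"
    by (rule nn_integral_liminf) simp
  also have "\<dots> \<le> liminf (\<lambda>n. ennreal D)"
    by (intro Liminf_mono always_eventually allI g_le)
  also have "\<dots> < \<infinity>" by (simp add: Liminf_const)
  finally have "integrable M (\<lambda>x. x\<^sup>2 / 2)"
    by (intro integrableI_nonneg) auto
  from integrable_mult_right[OF this, of 2] show ?thesis by simp
qed

text \<open>If \<open>x / n\<close> is constant modulo \<open>2 * pi\<close> for every \<open>n\<close>, then so is \<open>x\<close>.\<close>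

lemma AE_const_if_norm_char_eq_1:
  assumes "\<And>n. norm (char M (1 / real (Suc n))) = 1"
  shows "\<exists>c. AE x in M. x = c"
proof -
  define c where "c n = char M (1 / real (Suc n))" for n
  have c: "norm (c n) = 1" "cnj (c n) * c n = 1" for n
  proof -
    show "norm (c n) = 1" using assms by (simp add: c_def)
    then show "cnj (c n) * c n = 1" using complex_norm_square[of "c n"] by (simp add: mult.commute)
  qed
  have "AE x in M. iexp (1 / real (Suc n) * x) = c n" for n
  proof -
    \<comment> \<open>Rotating by the conjugate of \<open>c n\<close> turns the mean into 1, while
      the real part never exceeds 1; the deficit is nonnegative with integral 0.\<close>
    let ?h = "\<lambda>x. 1 - Re (cnj (c n) * iexp (1 / real (Suc n) * x))"
    have int: "integrable M (\<lambda>x. cnj (c n) * iexp (1 / real (Suc n) * x))"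
      by (intro integrable_mult_right integrable_iexp) auto
    have "Re (cnj (c n) * iexp (1 / real (Suc n) * x)) \<le> 1" for x
      using complex_Re_le_cmod[of "cnj (c n) * iexp (1 / real (Suc n) * x)"] c(1)[of n]
      by (simp add: norm_mult)
    then have nonneg: "AE x in M. 0 \<le> ?h x" by simp
    have "(LINT x|M. cnj (c n) * iexp (1 / real (Suc n) * x)) = cnj (c n) * c n"
      unfolding c_def char_def by (rule integral_mult_right_zero)
    then have "(LINT x|M. ?h x) = 0"
      using integral_Re[OF int] integrable_Re[OF int] c(2)[of n] by (simp add: prob_UNIV)
    then have "AE x in M. ?h x = 0"
      using integral_nonneg_eq_0_iff_AE[OF _ nonneg] integrable_Re[OF int] by simp
    then show ?thesis
    proof eventually_elim
      case (elim x)
      define w where "w = cnj (c n) * iexp (1 / real (Suc n) * x)"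
      have w: "Re w = 1" "norm w = 1"
        using elim c(1)[of n] by (auto simp: w_def norm_mult)
      then have "Im w = 0" using cmod_power2[of w] by simp
      with w have "w = 1" by (simp add: complex_eq_iff)
      then have "c n * w = c n" by simp
      then show ?case using c(2)[of n] unfolding w_def
        by (metis mult.assoc mult.commute mult_1)
    qed
  qed
  then have AE: "AE x in M. \<forall>n. iexp (1 / real (Suc n) * x) = c n"
    by (simp add: AE_all_countable)
  \<comment> \<open>A property that holds almost surely under a probability measure has a witness,
    which becomes the constant.\<close>
  have "\<exists>x0. \<forall>n. iexp (1 / real (Suc n) * x0) = c n"
  proof (rule ccontr)
    assume "\<nexists>x0. \<forall>n. iexp (1 / real (Suc n) * x0) = c n"
    then have no: "\<not> (\<forall>n. iexp (1 / real (Suc n) * x) = c n)" for x by blast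
    from AE have "AE x in M. False" by (rule eventually_mono) (use no in blast)
    then show False by simp
  qed
  then obtain x0 where x0: "\<forall>n. iexp (1 / real (Suc n) * x0) = c n" by blast
  from AE have "AE x in M. x = x0"
  proof eventually_elim
    case (elim x)
    obtain n :: nat where n: "\<bar>x - x0\<bar> < real n" using reals_Archimedean2 by blast
    \<comment> \<open>With \<open>n\<close> above the distance of \<open>x\<close> and
      \<open>x0\<close>, \<open>t\<close> is less than one period, so the only multiple of
      \<open>2 * pi\<close> it can be is 0.\<close>
    define t where "t = (x - x0) / real (Suc n)"
    have "\<bar>x - x0\<bar> < 2 * pi * real (Suc n)"
    proof -
      have "real n < real (Suc n) * 1" by simp
      also have "\<dots> \<le> real (Suc n) * (2 * pi)" using pi_gt3 by (intro mult_left_mono) auto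
      finally show ?thesis using n by (simp add: mult.commute)
    qed
    then have t: "\<bar>t\<bar> < 2 * pi" by (simp add: t_def abs_divide field_simps)
    have "iexp (1 / real (Suc n) * x) = iexp (1 / real (Suc n) * x0)" using elim x0 by metis
    then have "iexp t = 1"
      unfolding t_def by (simp add: right_diff_distrib diff_divide_distrib exp_diff)
    then obtain k :: int where k: "t = real_of_int (2 * k) * pi"
      by (auto simp: exp_eq_1)
    with t have "\<bar>real_of_int k\<bar> < 1" by (simp add: abs_mult)
    then have "k = 0" by linarith
    with k have "t = 0" by simp
    then show ?case by (simp add: t_def)
  qed
  then show ?thesis by blast
qed

end

section \<open>The Levy exponent\<close>

text \<open>Small jumps are covered by \<open>min 1 (x\<^sup>2)\<close>. For large ones the
  quadratic Taylor term of the exponential gives the factor \<open>2 / v\<^sup>2\<close>, and both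
  signs of \<open>v\<close> handle both tails.\<close>

lemma integrable_square_if_exp_moment:
  fixes F :: "real measure"
  assumes F: "sets F = sets borel" and small: "integrable F (\<lambda>x. min 1 (x\<^sup>2))" and v: "v > 0"
    and pos: "(\<integral>\<^sup>+x\<in>{x. 1 < \<bar>x\<bar>}. ennreal (exp (v * x)) \<partial>F) < \<infinity>"
    and neg: "(\<integral>\<^sup>+x\<in>{x. 1 < \<bar>x\<bar>}. ennreal (exp (- v * x)) \<partial>F) < \<infinity>"
  shows "integrable F (\<lambda>x. x\<^sup>2)"
proof (rule integrableI_nonneg)
  have meas: "f \<in> borel_measurable F" if "f \<in> borel_measurable borel" for f :: "real \<Rightarrow> 'c :: topological_space"
    using that F by (simp cong: measurable_cong_sets)
  show "(\<lambda>x. x\<^sup>2) \<in> borel_measurable F" by (intro meas) measurable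
  have tail: "x\<^sup>2 \<le> 2 / v\<^sup>2 * (exp (v * x) + exp (- v * x))" for x
  proof -
    have *: "y\<^sup>2 \<le> 2 / v\<^sup>2 * exp (v * y)" if "0 \<le> y" for y
    proof -
      have "(v * y)\<^sup>2 / 2 \<le> exp (v * y)"
        using exp_lower_Taylor_quadratic[of "v * y"] v that by (smt (verit) mult_nonneg_nonneg)
      then show ?thesis using v by (simp add: field_simps power_mult_distrib)
    qed
    have e: "0 \<le> 2 / v\<^sup>2 * exp (v * x)" "0 \<le> 2 / v\<^sup>2 * exp (- v * x)" by simp_all
    show ?thesis
    proof (cases "0 \<le> x")
      case True
      from *[OF this] e show ?thesis unfolding distrib_left by linarith
    next
      case False
      then have "(- x)\<^sup>2 \<le> 2 / v\<^sup>2 * exp (v * - x)" by (intro *) simp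
      then have "x\<^sup>2 \<le> 2 / v\<^sup>2 * exp (- v * x)" by simp
      with e show ?thesis unfolding distrib_left by linarith
    qed
  qed
  have bound: "ennreal (x\<^sup>2) \<le> ennreal (min 1 (x\<^sup>2)) + ennreal (2 / v\<^sup>2) *
      (ennreal (exp (v * x)) * indicator {x. 1 < \<bar>x\<bar>} x + ennreal (exp (- v * x)) * indicator {x. 1 < \<bar>x\<bar>} x)" for x
  proof (cases "1 < \<bar>x\<bar>")
    case True
    have "ennreal (x\<^sup>2) \<le> ennreal (2 / v\<^sup>2 * (exp (v * x) + exp (- v * x)))"
      by (intro ennreal_leI tail)
    also have "\<dots> = ennreal (2 / v\<^sup>2) * (ennreal (exp (v * x)) + ennreal (exp (- v * x)))"
      by (subst ennreal_mult) (auto simp: ennreal_plus)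
    finally show ?thesis using True by (simp add: add_increasing)
  next
    case False
    then have "x\<^sup>2 \<le> 1" by (simp add: abs_square_le_1)
    then have "min 1 (x\<^sup>2) = x\<^sup>2" by simp
    then show ?thesis by simp
  qed
  have fin: "(\<integral>\<^sup>+x. ennreal (min 1 (x\<^sup>2)) \<partial>F) < \<infinity>"
    using small by (subst nn_integral_eq_integral) auto
  have "(\<integral>\<^sup>+x. ennreal (x\<^sup>2) \<partial>F) \<le> (\<integral>\<^sup>+x. (ennreal (min 1 (x\<^sup>2)) + ennreal (2 / v\<^sup>2) *
      (ennreal (exp (v * x)) * indicator {x. 1 < \<bar>x\<bar>} x + ennreal (exp (- v * x)) * indicator {x. 1 < \<bar>x\<bar>} x)) \<partial>F)"
    by (intro nn_integral_mono bound)
  also have "\<dots> = (\<integral>\<^sup>+x. ennreal (min 1 (x\<^sup>2)) \<partial>F) + ennreal (2 / v\<^sup>2) *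
     ((\<integral>\<^sup>+x\<in>{x. 1 < \<bar>x\<bar>}. ennreal (exp (v * x)) \<partial>F) + (\<integral>\<^sup>+x\<in>{x. 1 < \<bar>x\<bar>}. ennreal (exp (- v * x)) \<partial>F))"
    by (subst nn_integral_add nn_integral_cmult; (intro meas)?; measurable?)+
  also have "\<dots> < \<infinity>"
    using fin pos neg by (simp add: ennreal_mult_less_top less_top)
  finally show "(\<integral>\<^sup>+x. ennreal (x\<^sup>2) \<partial>F) < \<infinity>" .
qed simp

lemma one_minus_cos_le: "1 - cos x \<le> x\<^sup>2" for x :: real
proof -
  have "1 - cos x = 2 * (sin (x / 2))\<^sup>2" using cos_double_sin[of "x / 2"] by simp
  also have "(sin (x / 2))\<^sup>2 \<le> (x / 2)\<^sup>2"
    using abs_sin_x_le_abs_x[of "x / 2"] unfolding abs_le_square_iff .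
  finally have "1 - cos x \<le> x\<^sup>2 / 2" by (simp add: power_divide)
  then show ?thesis using zero_le_power2[of x] by linarith
qed

text \<open>The drift and the compensator are purely imaginary, so the real part is quadratic near 0
  although the exponent itself is only linear. The integrand is estimated by second-order Taylor on
  \<open>{-1..1}\<close>, and by first order outside, where
  \<open>\<bar>x\<bar> \<le> x\<^sup>2\<close>.\<close>

lemma levy_exponent_bounds:
  fixes F :: "real measure"
  assumes F: "sets F = sets borel" and sq: "integrable F (\<lambda>x. x\<^sup>2)" and c: "0 \<le> c"
  obtains C where "0 \<le> C" "\<And>u. \<bar>u\<bar> \<le> 1 \<Longrightarrow> norm (levy_exponent b c F u) \<le> C * \<bar>u\<bar>"
    "\<And>u. \<bar>u\<bar> \<le> 1 \<Longrightarrow> \<bar>Re (levy_exponent b c F u)\<bar> \<le> C * u\<^sup>2"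
proof -
  define V where "V = (LINT x|F. x\<^sup>2)"
  define h where "h u x = iexp (u * x) - 1 - \<i> * of_real (u * x * indicator {-1..1} x)" for u x :: real
  have V: "V \<ge> 0" unfolding V_def by simp
  have h_meas: "h u \<in> borel_measurable F" for u
  proof -
    have "h u \<in> borel_measurable borel" unfolding h_def by measurable
    then show ?thesis using F by (simp cong: measurable_cong_sets)
  qed
  have h_norm: "norm (h u x) \<le> \<bar>u\<bar> * x\<^sup>2" if u: "\<bar>u\<bar> \<le> 1" for u x
  proof (cases "x \<in> {-1..1}")
    case True
    have "norm (h u x) \<le> \<bar>u * x\<bar>\<^sup>2 / 2"
      using iexp_approx1[of "u * x" 1] True by (simp add: h_def power2_eq_square algebra_simps)
    also have "\<dots> = \<bar>u\<bar>\<^sup>2 / 2 * x\<^sup>2" by (simp add: power_mult_distrib)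
    also have "\<dots> = \<bar>u\<bar> * (\<bar>u\<bar> / 2) * x\<^sup>2"
      by (simp only: power2_eq_square[of "\<bar>u\<bar>"] times_divide_eq_right)
    also have "\<dots> \<le> \<bar>u\<bar> * 1 * x\<^sup>2" using u by (intro mult_right_mono mult_left_mono) auto
    finally show ?thesis by simp
  next
    case False
    then have x: "1 \<le> \<bar>x\<bar>" by auto
    have "norm (h u x) \<le> \<bar>u\<bar> * \<bar>x\<bar>"
      using iexp_approx1[of "u * x" 0] False by (simp add: h_def abs_mult)
    also have "\<bar>u\<bar> * \<bar>x\<bar> \<le> \<bar>u\<bar> * x\<^sup>2"
      using mult_left_mono[OF x abs_ge_zero[of x]] by (intro mult_left_mono) (simp_all add: power2_eq_square)
    finally show ?thesis .
  qed
  have h_int: "integrable F (h u)" if u: "\<bar>u\<bar> \<le> 1" for u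
  proof (rule Bochner_Integration.integrable_bound[of _ "\<lambda>x. \<bar>u\<bar> * x\<^sup>2"])
    show "AE x in F. norm (h u x) \<le> norm (\<bar>u\<bar> * x\<^sup>2)" using h_norm[OF u] by simp
  qed (use sq h_meas in auto)
  have psi: "levy_exponent b c F u = \<i> * of_real (b * u) - of_real (c * u\<^sup>2 / 2) + (CLINT x|F. h u x)" for u
    by (simp add: levy_exponent_def h_def)
  define C where "C = \<bar>b\<bar> + c / 2 + V"
  show thesis
  proof (rule that[of C])
    show "0 \<le> C" using c V by (simp add: C_def)
  next
    fix u :: real assume u: "\<bar>u\<bar> \<le> 1"
    have u2: "u\<^sup>2 \<le> \<bar>u\<bar>"
      using mult_left_mono[OF u abs_ge_zero[of u]] by (simp add: power2_eq_square)
    have "norm (CLINT x|F. h u x) \<le> (LINT x|F. norm (h u x))" by (rule integral_norm_bound)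
    also have "\<dots> \<le> (LINT x|F. \<bar>u\<bar> * x\<^sup>2)"
      using h_int[OF u] h_norm[OF u] sq by (intro integral_mono) auto
    finally have hV: "norm (CLINT x|F. h u x) \<le> \<bar>u\<bar> * V" by (simp add: V_def)
    have "norm (levy_exponent b c F u) \<le> norm (\<i> * of_real (b * u) :: complex) + norm (of_real (c * u\<^sup>2 / 2) :: complex) + norm (CLINT x|F. h u x)"
      unfolding psi by (intro order.trans[OF norm_triangle_ineq] add_right_mono norm_triangle_ineq4)
    also have "\<dots> \<le> \<bar>b\<bar> * \<bar>u\<bar> + c / 2 * \<bar>u\<bar> + \<bar>u\<bar> * V"
    proof (intro add_mono hV)
      show "norm (\<i> * of_real (b * u) :: complex) \<le> \<bar>b\<bar> * \<bar>u\<bar>" by (simp add: norm_mult abs_mult)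
      have "norm (of_real (c * u\<^sup>2 / 2) :: complex) = c / 2 * u\<^sup>2"
        using c unfolding norm_of_real by simp
      then show "norm (of_real (c * u\<^sup>2 / 2) :: complex) \<le> c / 2 * \<bar>u\<bar>"
        using c u2 by (simp add: mult_left_mono)
    qed
    finally show "norm (levy_exponent b c F u) \<le> C * \<bar>u\<bar>" by (simp add: C_def algebra_simps)
    have cos_le: "\<bar>Re (h u x)\<bar> \<le> u\<^sup>2 * x\<^sup>2" for x
    proof -
      have "Re (h u x) = cos (u * x) - 1" by (simp add: h_def Re_exp)
      then have "\<bar>Re (h u x)\<bar> = 1 - cos (u * x)" by simp
      also have "\<dots> \<le> (u * x)\<^sup>2" by (rule one_minus_cos_le)
      finally show ?thesis by (simp add: power_mult_distrib)
    qed
    have "\<bar>Re (CLINT x|F. h u x)\<bar> = \<bar>LINT x|F. Re (h u x)\<bar>"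
      using integral_Re[OF h_int[OF u]] by simp
    also have "\<dots> \<le> (LINT x|F. \<bar>Re (h u x)\<bar>)"
      using integral_norm_bound[of F "\<lambda>x. Re (h u x)"] by simp
    also have "\<dots> \<le> (LINT x|F. u\<^sup>2 * x\<^sup>2)"
      using integrable_Re[OF h_int[OF u]] cos_le sq by (intro integral_mono) auto
    finally have "\<bar>Re (CLINT x|F. h u x)\<bar> \<le> u\<^sup>2 * V" by (simp add: V_def)
    then have "\<bar>Re (levy_exponent b c F u)\<bar> \<le> c * u\<^sup>2 / 2 + u\<^sup>2 * V"
    proof -
      have "Re (levy_exponent b c F u) = Re (CLINT x|F. h u x) - c * u\<^sup>2 / 2" by (simp add: psi)
      moreover have "0 \<le> c * u\<^sup>2 / 2" using c by simp
      ultimately show ?thesis using \<open>\<bar>Re (CLINT x|F. h u x)\<bar> \<le> u\<^sup>2 * V\<close> by linarith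
    qed
    also have "\<dots> \<le> C * u\<^sup>2" using zero_le_mult_iff[of "\<bar>b\<bar>" "u\<^sup>2"] by (simp add: C_def algebra_simps)
    finally show "\<bar>Re (levy_exponent b c F u)\<bar> \<le> C * u\<^sup>2" .
  qed
qed

text \<open>Converts a quadratic bound on the real part of a logarithm and a linear one on its
  imaginary part into the hypothesis of \<open>integrable_square_if_char\<close>.\<close>

lemma Re_exp_lower:
  assumes "Re w \<le> 0"
  shows "1 - Re (exp w) \<le> \<bar>Re w\<bar> + (Im w)\<^sup>2"
proof -
  have e: "1 + Re w \<le> exp (Re w)" "exp (Re w) \<le> 1" using assms by auto
  then have e': "1 - exp (Re w) \<le> \<bar>Re w\<bar>" by linarith
  note c = one_minus_cos_le[of "Im w"]
  have "1 - Re (exp w) = (1 - exp (Re w)) + exp (Re w) * (1 - cos (Im w))"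
    by (simp add: Re_exp algebra_simps)
  also have "\<dots> \<le> \<bar>Re w\<bar> + 1 * (1 - cos (Im w))"
    using e by (intro add_mono mult_right_mono e') auto
  finally show ?thesis using c by simp
qed

lemma (in prob_space) char_AE_limit:
  fixes X :: "nat \<Rightarrow> 'a \<Rightarrow> real"
  assumes X[measurable]: "\<And>N. X N \<in> borel_measurable M" "Y \<in> borel_measurable M"
    and lim: "AE \<omega> in M. (\<lambda>N. X N \<omega>) \<longlonglongrightarrow> Y \<omega>"
  shows "(\<lambda>N. char (distr M borel (X N)) u) \<longlonglongrightarrow> char (distr M borel Y) u"
proof -
  have *: "char (distr M borel Z) u = (CLINT \<omega>|M. iexp (u * Z \<omega>))" if "Z \<in> borel_measurable M" for Z
    using that by (simp add: char_def integral_distr)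
  have "(\<lambda>N. CLINT \<omega>|M. iexp (u * X N \<omega>)) \<longlonglongrightarrow> (CLINT \<omega>|M. iexp (u * Y \<omega>))"
  proof (rule integral_dominated_convergence[where w = "\<lambda>_. 1"])
    show "AE \<omega> in M. (\<lambda>N. iexp (u * X N \<omega>)) \<longlonglongrightarrow> iexp (u * Y \<omega>)"
      using lim by eventually_elim (intro tendsto_intros)
  qed simp_all
  then show ?thesis by (simp add: * X)
qed

lemma (in prob_space) char_distr_cmult:
  fixes X :: "'a \<Rightarrow> real"
  assumes "X \<in> borel_measurable M"
  shows "char (distr M borel (\<lambda>\<omega>. c * X \<omega>)) u = char (distr M borel X) (c * u)"
  using assms by (simp add: char_def integral_distr mult_ac)

section \<open>Innovations as limits of Riemann--Stieltjes sums\<close>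

lemma levy_processD:
  assumes "levy_process P L"
  shows "prob_space P" and "\<And>t. 0 \<le> t \<Longrightarrow> L t \<in> borel_measurable P"
    and "\<And>(t :: nat \<Rightarrow> real) n. 0 \<le> t 0 \<Longrightarrow> mono t \<Longrightarrow>
        prob_space.indep_vars P (\<lambda>_. borel) (\<lambda>i \<omega>. L (t (Suc i)) \<omega> - L (t i) \<omega>) {..<n}"
    and "\<And>s t. 0 \<le> s \<Longrightarrow> 0 \<le> t \<Longrightarrow> distr P borel (\<lambda>\<omega>. L (s + t) \<omega> - L s \<omega>) = distr P borel (L t)"
    and "AE \<omega> in P. cadlag (\<lambda>t. L t \<omega>)"
  using assms unfolding levy_process_def by blast+

text \<open>\<open>innov_sum n i\<close> is the Riemann--Stieltjes sum with mesh \<open>lam / n\<close> of the innovation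
  \<open>exp (- lam * (i + 1)) * integral of exp dL over [lam * i, lam * (i + 1)]\<close>.\<close>

locale levy_grid = prob_space P for P :: "'a measure" +
  fixes L :: "real \<Rightarrow> 'a \<Rightarrow> real" and \<psi> :: "real \<Rightarrow> complex" and lam :: real
  assumes levy: "levy_process P L"
    and char_L: "\<And>t u. 0 \<le> t \<Longrightarrow> char (distr P borel (L t)) u = exp (of_real t * \<psi> u)"
    and lam: "0 < lam"
begin

definition step :: "nat \<Rightarrow> real" where "step n = lam / real n"

definition incr :: "nat \<Rightarrow> nat \<Rightarrow> 'a \<Rightarrow> real" where
  "incr n j \<omega> = L (step n * real (Suc j)) \<omega> - L (step n * real j) \<omega>"

definition innov_sum :: "nat \<Rightarrow> nat \<Rightarrow> 'a \<Rightarrow> real" where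
  "innov_sum n i \<omega> = (\<Sum>j\<in>{i * n..<Suc i * n}. exp (step n * real j - lam * real (Suc i)) * incr n j \<omega>)"

lemma step_nonneg: "0 \<le> step n"
  using lam by (simp add: step_def)

lemma L_rv: "0 \<le> t \<Longrightarrow> L t \<in> borel_measurable P"
  using levy_processD(2)[OF levy] .

lemma incr_rv[measurable]: "incr n j \<in> borel_measurable P"
  unfolding incr_def[abs_def] using step_nonneg[of n] by (intro borel_measurable_diff L_rv) auto

lemma innov_sum_rv[measurable]: "innov_sum n i \<in> borel_measurable P"
  unfolding innov_sum_def[abs_def] by measurable

lemma indep_incr: "indep_vars (\<lambda>_. borel) (incr n) {..<m}"
proof -
  have "mono (\<lambda>j. step n * real j)"
    using step_nonneg[of n] by (intro monoI mult_left_mono) auto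
  then show ?thesis
    using levy_processD(3)[OF levy, of "\<lambda>j. step n * real j" m] by (simp add: incr_def[abs_def])
qed

lemma char_incr: "char (distr P borel (incr n j)) u = exp (of_real (step n) * \<psi> u)"
proof -
  have "incr n j = (\<lambda>\<omega>. L (step n * real j + step n) \<omega> - L (step n * real j) \<omega>)"
    by (simp add: incr_def[abs_def] algebra_simps)
  then have "distr P borel (incr n j) = distr P borel (L (step n))"
    using levy_processD(4)[OF levy, of "step n * real j" "step n"] step_nonneg[of n] by simp
  then show ?thesis by (simp add: char_L step_nonneg)
qed

lemma indep_innov_sum: "indep_vars (\<lambda>_. borel) (innov_sum n) {..<m}"
proof -
  let ?K = "\<lambda>i. {i * n..<Suc i * n}"
  let ?g = "\<lambda>i r. \<Sum>j\<in>?K i. exp (step n * real j - lam * real (Suc i)) * r j"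
  have disj: "?K i \<inter> ?K j = {}" if "i < j" for i j
  proof -
    have "Suc i * n \<le> j * n" using that by (intro mult_le_mono1) auto
    then show ?thesis by auto
  qed
  have "indep_vars (\<lambda>i. Pi\<^sub>M (?K i) (\<lambda>_. borel)) (\<lambda>i \<omega>. \<lambda>j\<in>?K i. incr n j \<omega>) {..<m}"
  proof (rule indep_vars_restrict[OF indep_incr[of n "m * n"]])
    show "?K i \<subseteq> {..<m * n}" if "i \<in> {..<m}" for i
    proof -
      have "Suc i * n \<le> m * n" using that by (intro mult_le_mono1) auto
      then show ?thesis by auto
    qed
    show "disjoint_family_on ?K {..<m}"
      unfolding disjoint_family_on_def
    proof (intro ballI impI)
      fix i j :: nat assume "i \<noteq> j"
      then show "?K i \<inter> ?K j = {}"
        using disj[of i j] disj[of j i] by (cases i j rule: linorder_cases) (simp_all add: Int_commute)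
    qed
  qed
  then have "indep_vars (\<lambda>_. borel) (\<lambda>i \<omega>. ?g i (\<lambda>j\<in>?K i. incr n j \<omega>)) {..<m}"
    by (rule indep_vars_compose2) measurable
  then show ?thesis by (simp add: innov_sum_def[abs_def])
qed

text \<open>A Riemann sum for the integral of \<open>\<psi> (exp (s - lam) * u)\<close> over
  \<open>s\<close> in \<open>[0, lam]\<close>. It does not involve the block index, whence the
  innovations are identically distributed.\<close>

definition log_char :: "nat \<Rightarrow> real \<Rightarrow> complex" where
  "log_char n u = of_real (step n) * (\<Sum>k<n. \<psi> (exp (step n * real k - lam) * u))"

lemma char_innov_sum:
  assumes n: "0 < n"
  shows "char (distr P borel (innov_sum n i)) u = exp (log_char n u)"
proof -
  define v where "v j = exp (step n * real j - lam * real (Suc i))" for j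
  let ?K = "{i * n..<Suc i * n}"
  have "indep_vars (\<lambda>_. borel) (incr n) ?K"
    by (rule indep_vars_subset[OF indep_incr[of n "Suc i * n"]]) auto
  then have "indep_vars (\<lambda>_. borel) (\<lambda>j \<omega>. v j * incr n j \<omega>) ?K"
    by (rule indep_vars_compose2) measurable
  then have "char (distr P borel (innov_sum n i)) u = (\<Prod>j\<in>?K. char (distr P borel (\<lambda>\<omega>. v j * incr n j \<omega>)) u)"
    unfolding innov_sum_def[abs_def] v_def by (rule char_distr_sum)
  also have "\<dots> = (\<Prod>j\<in>?K. exp (of_real (step n) * \<psi> (v j * u)))"
    by (simp only: char_distr_cmult[OF incr_rv] char_incr)
  also have "\<dots> = exp (of_real (step n) * (\<Sum>j\<in>?K. \<psi> (v j * u)))"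
    by (simp add: exp_sum sum_distrib_left)
  also have "(\<Sum>j\<in>?K. \<psi> (v j * u)) = (\<Sum>k<n. \<psi> (v (k + i * n) * u))"
    using sum.shift_bounds_nat_ivl[of "\<lambda>j. \<psi> (v j * u)" 0 "i * n" n] by (simp add: lessThan_atLeast0)
  also have "\<dots> = (\<Sum>k<n. \<psi> (exp (step n * real k - lam) * u))"
  \<comment> \<open>The offset \<open>i * n\<close> contributes
    \<open>step n * (i * n) = lam * i\<close>, which cancels the dependence on
    \<open>i\<close>.\<close>
  proof (rule sum.cong[OF refl])
    fix k
    have "step n * real (k + i * n) - lam * real (Suc i) = step n * real k - lam"
      using n by (simp add: step_def field_simps)
    then show "\<psi> (v (k + i * n) * u) = \<psi> (exp (step n * real k - lam) * u)" by (simp only: v_def)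
  qed
  finally show ?thesis by (simp add: log_char_def)
qed

text \<open>Grids with \<open>i * m * Suc N\<close> cells on \<open>[0, lam * i]\<close> have the
  mesh of \<open>innov_sum (m * Suc N)\<close> for every \<open>i\<close>. The sums for
  \<open>Suc i\<close> and \<open>i\<close> therefore differ by exactly one block.\<close>

lemma innov_sum_tendsto:
  assumes m: "0 < m" and I: "\<And>i. AE \<omega> in P. Y (Suc i) \<omega> - exp (- lam) * Y i \<omega> =
      exp (- lam * real (Suc i)) *
        (RS_integral exp (\<lambda>s. L s \<omega>) 0 (lam * real (Suc i)) -
          (if i = 0 then 0 else RS_integral exp (\<lambda>s. L s \<omega>) 0 (lam * real i)))"
  shows "AE \<omega> in P. (\<lambda>N. innov_sum (m * Suc N) i \<omega>) \<longlonglongrightarrow> Y (Suc i) \<omega> - exp (- lam) * Y i \<omega>"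
  using levy_processD(5)[OF levy] I[of i]
proof eventually_elim
  case (elim \<omega>)
  let ?g = "\<lambda>s. L s \<omega>"
  \<comment> \<open>The case \<open>i = 0\<close> is set to 0 by hand, as
    \<open>cadlag_has_RS_integral\<close> treats intervals of positive length.\<close>
  define R where "R i = (if i = 0 then 0 else RS_integral exp ?g 0 (lam * real i))" for i :: nat
  define S where "S n i = (\<Sum>j<i * n. exp (step n * real j) * incr n j \<omega>)" for n i
  have lim: "(\<lambda>N. S (m * Suc N) i) \<longlonglongrightarrow> R i" for i
  proof (cases "i = 0")
    case False
    have "has_RS_integral exp ?g 0 (lam * real i) (R i)"
      using False lam unfolding R_def
      by (auto intro!: cadlag_has_RS_integral[OF elim(1)] continuous_intros mono_onI)
    then have "(\<lambda>N. rs_sum exp ?g (rs_grid (lam * real i / real (i * m * Suc N)) (i * m * Suc N))) \<longlonglongrightarrow> R i"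
      using False lam m by (intro rs_grid_tendsto) auto
    moreover have "rs_sum exp ?g (rs_grid (lam * real i / real (i * m * Suc N)) (i * m * Suc N)) = S (m * Suc N) i" for N
    proof -
      have "lam * real i / real (i * m * Suc N) = step (m * Suc N)"
        using False unfolding step_def mult.assoc of_nat_mult[of i]
        by (simp del: mult_Suc_right of_nat_Suc of_nat_mult)
      moreover have "0 < m * Suc N" using m by simp
      then have "0 < step (m * Suc N)"
        unfolding step_def by (intro divide_pos_pos lam) (simp only: of_nat_0_less_iff)
      ultimately show ?thesis
        using False m by (simp only: rs_grid_sum S_def incr_def mult.assoc) (simp add: rs_grid_sum)
    qed
    ultimately show ?thesis by (simp only:)
  qed (simp add: S_def R_def)
  have "innov_sum n i \<omega> = exp (- lam * real (Suc i)) * (S n (Suc i) - S n i)" for n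
  proof -
    have "S n (Suc i) = S n i + (\<Sum>j\<in>{i * n..<Suc i * n}. exp (step n * real j) * incr n j \<omega>)"
      unfolding S_def lessThan_atLeast0 by (rule sum.atLeastLessThan_concat[symmetric]) auto
    then have "exp (- lam * real (Suc i)) * (S n (Suc i) - S n i) =
        exp (- lam * real (Suc i)) * (\<Sum>j\<in>{i * n..<Suc i * n}. exp (step n * real j) * incr n j \<omega>)" by simp
    also have "\<dots> = innov_sum n i \<omega>"
      unfolding innov_sum_def sum_distrib_left
    proof (rule sum.cong[OF refl])
      fix j
      have "exp (step n * real j - lam * real (Suc i)) = exp (- lam * real (Suc i)) * exp (step n * real j)"
        unfolding exp_add[symmetric] by (simp add: algebra_simps)
      then show "exp (- lam * real (Suc i)) * (exp (step n * real j) * incr n j \<omega>) =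
          exp (step n * real j - lam * real (Suc i)) * incr n j \<omega>" by simp
    qed
    finally show ?thesis by simp
  qed
  moreover have "(\<lambda>N. exp (- lam * real (Suc i)) * (S (m * Suc N) (Suc i) - S (m * Suc N) i)) \<longlonglongrightarrow>
      exp (- lam * real (Suc i)) * (R (Suc i) - R i)"
    by (intro tendsto_intros lim)
  moreover have "Y (Suc i) \<omega> - exp (- lam) * Y i \<omega> = exp (- lam * real (Suc i)) * (R (Suc i) - R i)"
    unfolding elim(2) R_def by simp
  ultimately show ?case by (simp only:)
qed

section \<open>Bounds on the characteristic functions of the innovation sums, uniform in the
  mesh\<close>

lemma Re_psi_nonpos: "Re (\<psi> u) \<le> 0"
proof -
  interpret D: real_distribution "distr P borel (L 1)"
    using L_rv[of 1] by (intro real_distribution_distr) simp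
  have "norm (exp (\<psi> u)) \<le> 1"
    using D.cmod_char_le_1[of u] char_L[of 1 u] by simp
  then show ?thesis by simp
qed

lemma exponent_weight_le: 
  assumes k: "k < n"
  shows "exp (step n * real k - lam) \<le> 1"
proof -
  have "step n * real k \<le> lam" using k lam by (simp add: step_def field_simps)
  then show ?thesis by simp
qed

text \<open>All weights are at most 1, so each summand obeys the bound at \<open>u\<close> itself,
  and \<open>n\<close> summands times the mesh give \<open>lam\<close> whatever \<open>n\<close>
  is.\<close>

lemma innov_char_Re:
  assumes n: "0 < n" and C: "0 \<le> C" "\<And>u. \<bar>u\<bar> \<le> 1 \<Longrightarrow> norm (\<psi> u) \<le> C * \<bar>u\<bar>"
    "\<And>u. \<bar>u\<bar> \<le> 1 \<Longrightarrow> \<bar>Re (\<psi> u)\<bar> \<le> C * u\<^sup>2" and u: "\<bar>u\<bar> \<le> 1"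
  shows "1 - Re (exp (log_char n u)) \<le> (lam * C + (lam * C)\<^sup>2) * u\<^sup>2"
proof -
  define w where "w k = exp (step n * real k - lam)" for k
  have w: "0 \<le> w k" "w k \<le> 1" if "k < n" for k using exponent_weight_le[OF that] by (auto simp: w_def)
  have wu: "\<bar>w k * u\<bar> \<le> \<bar>u\<bar>" if "k < n" for k
    using w[OF that] by (simp add: abs_mult mult_left_le_one_le)
  have step: "step n * real n = lam" using n by (simp add: step_def)
  have Re: "Re (log_char n u) = step n * (\<Sum>k<n. Re (\<psi> (w k * u)))"
    by (simp add: log_char_def w_def)
  have Re_neg: "Re (log_char n u) \<le> 0"
    unfolding Re using Re_psi_nonpos step_nonneg by (intro mult_nonneg_nonpos sum_nonpos) auto
  have "\<bar>Re (log_char n u)\<bar> \<le> step n * (\<Sum>k<n. C * u\<^sup>2)"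
    unfolding Re abs_mult abs_of_nonneg[OF step_nonneg]
  proof (intro mult_left_mono step_nonneg order.trans[OF sum_abs] sum_mono)
    fix k assume "k \<in> {..<n}"
    then have wk: "\<bar>w k * u\<bar> \<le> \<bar>u\<bar>" by (intro wu) simp
    have "\<bar>Re (\<psi> (w k * u))\<bar> \<le> C * (w k * u)\<^sup>2" using wk u by (intro C(3)) simp
    also have "\<dots> \<le> C * u\<^sup>2" using wk C(1) by (intro mult_left_mono) (simp_all only: abs_le_square_iff)
    finally show "\<bar>Re (\<psi> (w k * u))\<bar> \<le> C * u\<^sup>2" .
  qed
  also have "\<dots> = lam * C * u\<^sup>2" using step by (simp add: mult_ac)
  finally have 1: "\<bar>Re (log_char n u)\<bar> \<le> lam * C * u\<^sup>2" .
  have "\<bar>Im (log_char n u)\<bar> \<le> norm (log_char n u)" by (rule abs_Im_le_cmod)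
  also have "\<dots> \<le> step n * (\<Sum>k<n. C * \<bar>u\<bar>)"
    unfolding log_char_def norm_mult norm_of_real abs_of_nonneg[OF step_nonneg]
  proof (intro mult_left_mono step_nonneg order.trans[OF norm_sum] sum_mono)
    fix k assume "k \<in> {..<n}"
    then have wk: "\<bar>w k * u\<bar> \<le> \<bar>u\<bar>" by (intro wu) simp
    have "norm (\<psi> (w k * u)) \<le> C * \<bar>w k * u\<bar>" using wk u by (intro C(2)) simp
    also have "\<dots> \<le> C * \<bar>u\<bar>" using wk C(1) by (intro mult_left_mono)
    finally show "norm (\<psi> (exp (step n * real k - lam) * u)) \<le> C * \<bar>u\<bar>" by (simp add: w_def)
  qed
  also have "\<dots> = lam * C * \<bar>u\<bar>" using step by (simp add: mult_ac)
  finally have "\<bar>Im (log_char n u)\<bar> \<le> \<bar>lam * C * u\<bar>"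
    using lam C(1) by (simp add: abs_mult)
  then have 2: "(Im (log_char n u))\<^sup>2 \<le> (lam * C)\<^sup>2 * u\<^sup>2"
    unfolding abs_le_square_iff by (simp add: power_mult_distrib)
  have "1 - Re (exp (log_char n u)) \<le> \<bar>Re (log_char n u)\<bar> + (Im (log_char n u))\<^sup>2"
    by (rule Re_exp_lower[OF Re_neg])
  also have "\<dots> \<le> (lam * C + (lam * C)\<^sup>2) * u\<^sup>2"
    using 1 2 unfolding distrib_right by (rule add_mono)
  finally show ?thesis .
qed

text \<open>Near the right end of the block the weights are close to \<open>1\<close>, so a fixed fraction of the
  increments contributes a factor bounded away from \<open>1\<close>.\<close>

lemma innov_char_bound:
  assumes nondeg: "\<not> (\<exists>c. AE \<omega> in P. L 1 \<omega> = c)"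
  obtains q :: nat and u r where "0 < q" "r < 1" "\<And>N. norm (exp (log_char (q * Suc N) u)) \<le> r"
proof -
  interpret D: real_distribution "distr P borel (L 1)"
    using L_rv[of 1] by (intro real_distribution_distr) simp
  have norm_char: "norm (char (distr P borel (L 1)) u) = exp (Re (\<psi> u))" for u
    using char_L[of 1 u] by simp
  obtain n0 where n0: "norm (char (distr P borel (L 1)) (1 / real (Suc n0))) \<noteq> 1"
  proof (rule ccontr)
    assume "\<not> thesis"
    then have "\<And>n. norm (char (distr P borel (L 1)) (1 / real (Suc n))) = 1" using that by blast
    from D.AE_const_if_norm_char_eq_1[OF this] obtain c where "AE x in distr P borel (L 1). x = c" by blast
    then have "AE \<omega> in P. L 1 \<omega> = c" using L_rv[of 1] by (subst (asm) AE_distr_iff) auto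
    with nondeg show False by blast
  qed
  define u where "u = 1 / real (Suc n0)"
  have u: "0 < u" by (simp add: u_def)
  \<comment> \<open>Half of the gap at \<open>u\<close>, so that the inequality stays strict there
    and extends to a neighbourhood.\<close>
  define \<eta> where "\<eta> = - Re (\<psi> u) / 2"
  have "Re (\<psi> u) \<noteq> 0" using n0 unfolding u_def[symmetric] norm_char by auto
  with Re_psi_nonpos[of u] have eta: "0 < \<eta>" "Re (\<psi> u) < - \<eta>" by (auto simp: \<eta>_def)
  \<comment> \<open>Continuity comes from the characteristic function of \<open>L 1\<close>, whose
    modulus is \<open>exp (Re (\<psi> u))\<close>; no continuity of \<open>\<psi>\<close> has been
    established.\<close>
  have "isCont (\<lambda>u. norm (char (distr P borel (L 1)) u)) u"
    by (intro continuous_intros D.isCont_char)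
  then have "((\<lambda>u. norm (char (distr P borel (L 1)) u)) \<longlongrightarrow> exp (Re (\<psi> u))) (at u)"
    unfolding isCont_def norm_char .
  then have "\<forall>\<^sub>F v in at u. norm (char (distr P borel (L 1)) v) < exp (- \<eta>)"
    using eta by (intro order_tendstoD(2)) auto
  then obtain \<rho> where rho: "0 < \<rho>" "\<And>v. v \<noteq> u \<Longrightarrow> \<bar>v - u\<bar> < \<rho> \<Longrightarrow> Re (\<psi> v) < - \<eta>"
    unfolding eventually_at norm_char dist_real_def by auto
  have near: "Re (\<psi> v) \<le> - \<eta>" if "\<bar>v - u\<bar> < \<rho>" for v
    using rho(2)[of v] that eta(2) by (cases "v = u") auto
  \<comment> \<open>The last \<open>1 / q\<close> of the cells have weights within
    \<open>lam / q\<close> of 1, by \<open>1 - exp (- t) \<le> t\<close>; this \<open>q\<close>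
    brings the rescaled arguments within \<open>\<rho>\<close> of \<open>u\<close>.\<close>
  obtain q :: nat where q: "lam * u / \<rho> < real q" using reals_Archimedean2 by blast
  have q0: "0 < real q"
    using q lam u rho(1) by (meson divide_pos_pos less_trans mult_pos_pos)
  have qr: "lam * u / real q < \<rho>" using q q0 rho(1) by (simp add: field_simps)
  show thesis
  proof (rule that[of q "exp (- (lam / real q * \<eta>))" u])
    show "0 < q" using q0 by simp
    show "exp (- (lam / real q * \<eta>)) < 1" using lam q0 eta by simp
    fix N
    define m where "m = Suc N"
    define n where "n = q * m"
    have m: "0 < real m" by (simp add: m_def)
    have mn: "m \<le> n" using q0 by (simp add: n_def)
    have w: "Re (\<psi> (exp (step n * real k - lam) * u)) \<le> - \<eta>" if k: "n - m \<le> k" "k < n" for k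
    proof (rule near)
      have "lam - step n * real k = step n * (real n - real k)"
        using q0 m by (simp add: step_def n_def field_simps)
      also have "\<dots> \<le> step n * real m"
        using k mn by (intro mult_left_mono step_nonneg) linarith
      also have "\<dots> = lam / real q" using q0 m by (simp add: step_def n_def)
      finally have d: "lam - step n * real k \<le> lam / real q" .
      have "1 - exp (step n * real k - lam) \<le> lam - step n * real k"
        using exp_ge_add_one_self[of "step n * real k - lam"] by linarith
      then have "u * (1 - exp (step n * real k - lam)) \<le> u * (lam / real q)"
        using d u by (intro mult_left_mono) auto
      moreover have "0 \<le> u * (1 - exp (step n * real k - lam))"
        using u exponent_weight_le[OF k(2)] by simp
      moreover have "\<bar>exp (step n * real k - lam) * u - u\<bar> = \<bar>u * (1 - exp (step n * real k - lam))\<bar>"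
        by (simp add: algebra_simps abs_minus_commute)
      ultimately show "\<bar>exp (step n * real k - lam) * u - u\<bar> < \<rho>"
        using qr by (simp add: mult.commute)
    qed
    \<comment> \<open>The discarded terms are nonpositive. The \<open>m\<close> retained ones
      contribute \<open>step n * m * \<eta> = lam / q * \<eta>\<close>, independent of
      \<open>N\<close>.\<close>
    have "(\<Sum>k<n. Re (\<psi> (exp (step n * real k - lam) * u))) \<le>
        (\<Sum>k\<in>{n - m..<n}. Re (\<psi> (exp (step n * real k - lam) * u)))"
    proof -
      have "(\<Sum>k\<in>{n - m..<n}. - Re (\<psi> (exp (step n * real k - lam) * u))) \<le>
          (\<Sum>k<n. - Re (\<psi> (exp (step n * real k - lam) * u)))"
        using Re_psi_nonpos by (intro sum_mono2) auto
      then show ?thesis by (simp add: sum_negf)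
    qed
    also have "\<dots> \<le> (\<Sum>k\<in>{n - m..<n}. - \<eta>)"
      by (intro sum_mono w) auto
    also have "\<dots> = - (real m * \<eta>)" using mn by simp
    finally have "step n * (\<Sum>k<n. Re (\<psi> (exp (step n * real k - lam) * u))) \<le> step n * (- (real m * \<eta>))"
      by (rule mult_left_mono[OF _ step_nonneg])
    then have "Re (log_char n u) \<le> step n * (- (real m * \<eta>))"
      by (simp add: log_char_def)
    also have "\<dots> = - (lam / real q * \<eta>)" using q0 m by (simp add: step_def n_def)
    finally show "norm (exp (log_char (q * Suc N) u)) \<le> exp (- (lam / real q * \<eta>))"
      by (simp add: n_def m_def)
  qed
qed

end

section \<open>The AR(1) process driven by independent innovations\<close>

text \<open>Started at 0, so that the value at \<open>i\<close> is a function of the innovations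
  before \<open>i\<close> alone; \<open>ar1_seq_expand\<close> restores the initial value as a
  separate term \<open>a ^ i * z 0\<close>.\<close>

primrec ar1_seq :: "real \<Rightarrow> (nat \<Rightarrow> real) \<Rightarrow> nat \<Rightarrow> real" where
  "ar1_seq a e 0 = 0"
| "ar1_seq a e (Suc i) = a * ar1_seq a e i + e i"

lemma ar1_seq_cong: "(\<And>k. k < i \<Longrightarrow> e k = e' k) \<Longrightarrow> ar1_seq a e i = ar1_seq a e' i"
  by (induction i) auto

lemma ar1_seq_measurable:
  "i \<le> n \<Longrightarrow> (\<lambda>r. ar1_seq a (\<lambda>k. r k - m) i) \<in> borel_measurable (Pi\<^sub>M {..<n} (\<lambda>_. borel :: real measure))"
proof (induction i)
  case (Suc i)
  have "(\<lambda>r. r i) \<in> borel_measurable (Pi\<^sub>M {..<n} (\<lambda>_. borel :: real measure))"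
    using Suc.prems by (intro measurable_component_singleton) auto
  with Suc show ?case by simp
qed simp

lemma ar1_seq_expand:
  assumes step: "\<And>i. z (Suc i) = a * z i + e i"
  shows "z i = ar1_seq a e i + a ^ i * z 0"
  by (induction i) (auto simp: step algebra_simps)

context prob_space
begin

text \<open>Convexity of the square, applied to the average of \<open>x\<close> and
  \<open>y / (1 - a)\<close> with weights \<open>a\<close> and \<open>1 - a\<close>. The bound
  \<open>V / (1 - a)\<^sup>2\<close> is the fixed point of
  \<open>s \<mapsto> a * s + V / (1 - a)\<close>.\<close>

lemma ar1_seq_square_bound:
  fixes e :: "nat \<Rightarrow> 'a \<Rightarrow> real"
  assumes a: "0 < a" "a < 1" and rv[measurable]: "\<And>i. e i \<in> borel_measurable M"
    and sq: "\<And>i. integrable M (\<lambda>\<omega>. (e i \<omega>)\<^sup>2)" "\<And>i. expectation (\<lambda>\<omega>. (e i \<omega>)\<^sup>2) \<le> V"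
  shows "integrable M (\<lambda>\<omega>. (ar1_seq a (\<lambda>k. e k \<omega>) i)\<^sup>2) \<and>
    expectation (\<lambda>\<omega>. (ar1_seq a (\<lambda>k. e k \<omega>) i)\<^sup>2) \<le> V / (1 - a)\<^sup>2"
proof (induction i)
  case 0
  have "0 \<le> V" using order.trans[OF _ sq(2)[of 0]] by simp
  then show ?case by simp
next
  case (Suc i)
  have [measurable]: "(\<lambda>\<omega>. ar1_seq a (\<lambda>k. e k \<omega>) j) \<in> borel_measurable M" for j
    by (induction j) auto
  have convex: "(a * x + y)\<^sup>2 \<le> a * x\<^sup>2 + 1 / (1 - a) * y\<^sup>2" for x y
  proof -
    have "a * x\<^sup>2 + 1 / (1 - a) * y\<^sup>2 - (a * x + y)\<^sup>2 = a / (1 - a) * ((1 - a) * x - y)\<^sup>2"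
      using a by (simp add: field_simps power2_eq_square)
    also have "\<dots> \<ge> 0" using a by simp
    finally show ?thesis by simp
  qed
  let ?t = "\<lambda>\<omega>. ar1_seq a (\<lambda>k. e k \<omega>) i"
  have int: "integrable M (\<lambda>\<omega>. a * (?t \<omega>)\<^sup>2 + 1 / (1 - a) * (e i \<omega>)\<^sup>2)"
    using Suc sq(1) by simp
  have int': "integrable M (\<lambda>\<omega>. (a * ?t \<omega> + e i \<omega>)\<^sup>2)"
  proof (rule Bochner_Integration.integrable_bound[OF int])
    show "AE \<omega> in M. norm ((a * ?t \<omega> + e i \<omega>)\<^sup>2) \<le> norm (a * (?t \<omega>)\<^sup>2 + 1 / (1 - a) * (e i \<omega>)\<^sup>2)"
      using convex by (intro AE_I2) (auto intro: order.trans[OF _ abs_ge_self])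
  qed measurable
  have "expectation (\<lambda>\<omega>. (a * ?t \<omega> + e i \<omega>)\<^sup>2) \<le> expectation (\<lambda>\<omega>. a * (?t \<omega>)\<^sup>2 + 1 / (1 - a) * (e i \<omega>)\<^sup>2)"
    by (intro integral_mono int int' convex)
  also have "\<dots> = a * expectation (\<lambda>\<omega>. (?t \<omega>)\<^sup>2) + 1 / (1 - a) * expectation (\<lambda>\<omega>. (e i \<omega>)\<^sup>2)"
    using Suc sq(1) by simp
  also have "\<dots> \<le> a * (V / (1 - a)\<^sup>2) + 1 / (1 - a) * V"
    using Suc a sq(2) by (intro add_mono mult_left_mono) auto
  also have "1 / (1 - a) * V = (1 - a) * (V / (1 - a)\<^sup>2)"
    using a by (simp add: power2_eq_square)
  also have "a * (V / (1 - a)\<^sup>2) + (1 - a) * (V / (1 - a)\<^sup>2) = V / (1 - a)\<^sup>2"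
    unfolding distrib_right[symmetric] by simp
  finally show ?case using int' by simp
qed

lemma iid_stable_ar1:
  fixes X :: "nat \<Rightarrow> 'a \<Rightarrow> real" and y :: "nat \<Rightarrow> 'a \<Rightarrow> real"
  assumes ind: "\<And>n. indep_vars (\<lambda>_. borel) X {..<n}"
    and eq: "\<And>n. distr M borel (X n) = distr M borel (X 0)"
    and sq: "integrable M (\<lambda>\<omega>. (X 0 \<omega>)\<^sup>2)"
    and nondeg: "\<not> (\<exists>c. AE \<omega> in M. X 0 \<omega> = c)"
    and a: "0 < a" "a < 1"
    and X: "\<And>i \<omega>. X i \<omega> = y (Suc i) \<omega> - a * y i \<omega>"
  shows "AE \<omega> in M. \<forall>h. (\<lambda>n. emp_acorr n (\<lambda>i. y i \<omega>) h) \<longlonglongrightarrow> a ^ h"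
proof -
  have rv[measurable]: "X i \<in> borel_measurable M" for i
    using ind[of "Suc i"] by (auto simp: indep_vars_def)
  have transfer: "integrable M (\<lambda>\<omega>. g (X i \<omega>)) \<longleftrightarrow> integrable M (\<lambda>\<omega>. g (X 0 \<omega>))"
    "expectation (\<lambda>\<omega>. g (X i \<omega>)) = expectation (\<lambda>\<omega>. g (X 0 \<omega>))"
    if g: "g \<in> borel_measurable borel" for g :: "real \<Rightarrow> real" and i
    using integrable_distr_eq[OF rv[of i] g] integrable_distr_eq[OF rv[of 0] g]
      integral_distr[OF rv[of i] g] integral_distr[OF rv[of 0] g] by (simp_all only: eq[of i])
  define m where "m = expectation (X 0)"
  define V where "V = expectation (\<lambda>\<omega>. (X 0 \<omega> - m)\<^sup>2)"
  define p where "p = expectation (\<lambda>\<omega>. min ((X 0 \<omega> - m)\<^sup>2) 1)"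
  have X0_int: "integrable M (X 0)"
    using integrable_mult_L2[of "X 0" "\<lambda>_. 1"] sq by simp
  have sq_m: "integrable M (\<lambda>\<omega>. (X i \<omega> - m)\<^sup>2)" "expectation (\<lambda>\<omega>. (X i \<omega> - m)\<^sup>2) \<le> V" for i
  proof -
    have "integrable M (\<lambda>\<omega>. (X 0 \<omega> - m)\<^sup>2)"
      unfolding power2_diff using sq X0_int by simp
    then show "integrable M (\<lambda>\<omega>. (X i \<omega> - m)\<^sup>2)"
      by (subst transfer(1)[of "\<lambda>x. (x - m)\<^sup>2"]) auto
    show "expectation (\<lambda>\<omega>. (X i \<omega> - m)\<^sup>2) \<le> V"
      unfolding V_def by (subst transfer(2)[of "\<lambda>x. (x - m)\<^sup>2"]) auto
  qed
  have mean: "expectation (\<lambda>\<omega>. X i \<omega> - m) = 0" for i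
    by (subst transfer(2)[of "\<lambda>x. x - m"]) (use X0_int in \<open>auto simp: m_def prob_space\<close>)
  have min_le: "\<bar>min ((X i \<omega> - m)\<^sup>2) 1\<bar> \<le> 1" for i \<omega> by (simp add: min_def)
  have min_int: "integrable M (\<lambda>\<omega>. min ((X i \<omega> - m)\<^sup>2) 1)" for i
    by (rule integrable_const_bound[where B = 1]) (use min_le in auto)
  have p_pos: "p > 0"
  proof (rule ccontr)
    assume "\<not> p > 0"
    moreover have "0 \<le> p" unfolding p_def by (intro Bochner_Integration.integral_nonneg) auto
    ultimately have "p = 0" by simp
    then have "AE \<omega> in M. min ((X 0 \<omega> - m)\<^sup>2) 1 = 0"
      unfolding p_def by (subst (asm) integral_nonneg_eq_0_iff_AE) (use min_int in auto)
    then have "AE \<omega> in M. X 0 \<omega> = m" by eventually_elim (auto simp: min_def split: if_splits)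
    with nondeg show False by blast
  qed
  \<comment> \<open>\<open>i + 0\<close> and the factor 1 bring the sum into the form of
    \<open>slln_innovations\<close> with lag 0 and constant weight.\<close>
  have e_mean: "AE \<omega> in M. (\<lambda>n. (\<Sum>i<n. (X (i + 0) \<omega> - m) * 1) / real n) \<longlonglongrightarrow> 0"
    by (rule slln_innovations[OF ind _ sq_m mean, where w = "\<lambda>_ _. 1" and B = 1]) (simp_all add: prob_space)
  \<comment> \<open>Truncation makes the centred summands bounded by 1, so their second moments need
    no further moment of \<open>X\<close>.\<close>
  have e_spread: "AE \<omega> in M. (\<lambda>n. (\<Sum>i<n. (min ((X (i + 0) \<omega> - m)\<^sup>2) 1 - p) * 1) / real n) \<longlonglongrightarrow> 0"
  proof (rule slln_innovations[OF ind, where w = "\<lambda>_ _. 1" and B = 1])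
    show "(\<lambda>x. min ((x - m)\<^sup>2) 1 - p) \<in> borel_measurable borel" by measurable
    have p1: "p \<le> 1"
    proof -
      have "p \<le> expectation (\<lambda>_. 1)" unfolding p_def by (intro integral_mono min_int) auto
      then show ?thesis by (simp add: prob_space)
    qed
    have le: "(min ((X i \<omega> - m)\<^sup>2) 1 - p)\<^sup>2 \<le> 1" for i \<omega>
    proof -
      have "0 \<le> min ((X i \<omega> - m)\<^sup>2) 1" "min ((X i \<omega> - m)\<^sup>2) 1 \<le> 1" by auto
      then have "\<bar>min ((X i \<omega> - m)\<^sup>2) 1 - p\<bar> \<le> 1" using p1 p_pos by linarith
      then show ?thesis by (simp only: abs_square_le_1)
    qed
    show int: "integrable M (\<lambda>\<omega>. (min ((X i \<omega> - m)\<^sup>2) 1 - p)\<^sup>2)" for i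
      by (rule integrable_const_bound[where B = 1]) (use le in auto)
    show "expectation (\<lambda>\<omega>. (min ((X i \<omega> - m)\<^sup>2) 1 - p)\<^sup>2) \<le> 1" for i
    proof -
      have "expectation (\<lambda>\<omega>. (min ((X i \<omega> - m)\<^sup>2) 1 - p)\<^sup>2) \<le> expectation (\<lambda>_. 1)"
        by (intro integral_mono int le) auto
      then show ?thesis by (simp add: prob_space)
    qed
    show "expectation (\<lambda>\<omega>. min ((X i \<omega> - m)\<^sup>2) 1 - p) = 0" for i
    proof -
      have "expectation (\<lambda>\<omega>. min ((X i \<omega> - m)\<^sup>2) 1) = p"
        unfolding p_def by (rule transfer(2)) measurable
      then show ?thesis using min_int by (simp add: prob_space)
    qed
  qed (simp_all add: prob_space)
  have cross1: "AE \<omega> in M. (\<lambda>n. (\<Sum>i<n. (X (i + h) \<omega> - m) * ar1_seq a (\<lambda>k. X k \<omega> - m) i) / real n) \<longlonglongrightarrow> 0" for h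
  proof (rule slln_innovations[OF ind _ sq_m mean, where w = "\<lambda>i r. ar1_seq a (\<lambda>k. r k - m) i" and B = "V / (1 - a)\<^sup>2"])
    show "ar1_seq a (\<lambda>k. X k \<omega> - m) i = ar1_seq a (\<lambda>k. (\<lambda>k\<in>{..<i + h}. X k \<omega>) k - m) i" for i \<omega>
      by (rule ar1_seq_cong) simp
    show "integrable M (\<lambda>\<omega>. (ar1_seq a (\<lambda>k. X k \<omega> - m) i)\<^sup>2)"
      "expectation (\<lambda>\<omega>. (ar1_seq a (\<lambda>k. X k \<omega> - m) i)\<^sup>2) \<le> V / (1 - a)\<^sup>2" for i
      using ar1_seq_square_bound[of a "\<lambda>k \<omega>. X k \<omega> - m" V i] a sq_m by auto
  qed (auto intro: ar1_seq_measurable)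
  \<comment> \<open>These are the deterministic weights left after the random factor
    \<open>z 0\<close> has been pulled out of the sum pathwise.\<close>
  have cross2: "AE \<omega> in M. (\<lambda>n. (\<Sum>i<n. (X (i + h) \<omega> - m) * a ^ i) / real n) \<longlonglongrightarrow> 0" for h
    by (rule slln_innovations[OF ind _ sq_m mean, where w = "\<lambda>i _. a ^ i" and B = 1])
      (use a in \<open>auto simp: prob_space power_le_one power_mult[symmetric]\<close>)
  have growth: "AE \<omega> in M. (\<lambda>n. X n \<omega> / sqrt (real (Suc n))) \<longlonglongrightarrow> 0"
    by (rule identically_distributed_growth[where X = X, OF rv eq sq])
  have "AE \<omega> in M. \<forall>h. (\<lambda>n. (\<Sum>i<n. (X (i + h) \<omega> - m) * ar1_seq a (\<lambda>k. X k \<omega> - m) i) / real n) \<longlonglongrightarrow> 0"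
    "AE \<omega> in M. \<forall>h. (\<lambda>n. (\<Sum>i<n. (X (i + h) \<omega> - m) * a ^ i) / real n) \<longlonglongrightarrow> 0"
    using cross1 cross2 by (simp_all add: AE_all_countable)
  with e_mean e_spread growth show ?thesis
  proof eventually_elim
    case (elim \<omega>)
    \<comment> \<open>The fixed point of \<open>x \<mapsto> a * x + m\<close>, the only centre for
      which the recursion of \<open>z\<close> has centred innovations.\<close>
    define \<mu> where "\<mu> = m / (1 - a)"
    define z where "z i = y i \<omega> - \<mu>" for i
    define e where "e i = X i \<omega> - m" for i
    have z_step: "z (Suc i) = a * z i + e i" for i
      using a unfolding z_def e_def X \<mu>_def by (simp add: field_simps)
    interpret stable_ar1 a \<mu> p "\<lambda>i. y i \<omega>" z e
    proof
      show "(\<lambda>n. (\<Sum>i<n. e i) / real n) \<longlonglongrightarrow> 0" using elim(1) by (simp add: e_def)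
      show "(\<lambda>n. e n / sqrt (real (Suc n))) \<longlonglongrightarrow> 0"
      proof -
        have "(\<lambda>n. m / sqrt (real (Suc n))) \<longlonglongrightarrow> 0" by real_asymp
        from tendsto_diff[OF elim(3) this] show ?thesis
          by (simp add: e_def diff_divide_distrib)
      qed
      show "(\<lambda>n. (\<Sum>i<n. e (i + h) * z i) / real n) \<longlonglongrightarrow> 0" for h
      proof -
        have "(\<lambda>n. (\<Sum>i<n. e (i + h) * ar1_seq a e i) / real n + z 0 * ((\<Sum>i<n. e (i + h) * a ^ i) / real n)) \<longlonglongrightarrow> 0 + z 0 * 0"
          unfolding e_def using elim(4,5) by (intro tendsto_intros) blast+
        moreover have "(\<Sum>i<n. e (i + h) * ar1_seq a e i) / real n + z 0 * ((\<Sum>i<n. e (i + h) * a ^ i) / real n) =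
            (\<Sum>i<n. e (i + h) * z i) / real n" for n
        proof -
          have "(\<Sum>i<n. e (i + h) * z i) = (\<Sum>i<n. e (i + h) * ar1_seq a e i) + z 0 * (\<Sum>i<n. e (i + h) * a ^ i)"
            unfolding sum_distrib_left sum.distrib[symmetric]
            by (intro sum.cong refl, subst ar1_seq_expand[where z = z, OF z_step]) (simp add: algebra_simps)
          then show ?thesis by (simp add: add_divide_distrib)
        qed
        ultimately show ?thesis by (simp only: mult_zero_right add_0_right)
      qed
      show "(\<lambda>n. (\<Sum>i<n. min ((e i)\<^sup>2) 1) / real n) \<longlonglongrightarrow> p"
      proof (rule Lim_transform_eventually)
        show "(\<lambda>n. (\<Sum>i<n. (min ((X (i + 0) \<omega> - m)\<^sup>2) 1 - p) * 1) / real n + p) \<longlonglongrightarrow> p"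
          using tendsto_add[OF elim(2) tendsto_const[of p]] by simp
        \<comment> \<open>At \<open>n = 0\<close> the left side is \<open>p\<close> and the right
          side 0, hence only eventual equality.\<close>
        show "\<forall>\<^sub>F n in sequentially. (\<Sum>i<n. (min ((X (i + 0) \<omega> - m)\<^sup>2) 1 - p) * 1) / real n + p =
            (\<Sum>i<n. min ((e i)\<^sup>2) 1) / real n"
          using eventually_gt_at_top[of 0]
        proof eventually_elim
          case (elim n)
          then show ?case by (simp add: e_def sum_subtractf diff_divide_distrib)
        qed
      qed
    qed (use a z_step p_pos in \<open>auto simp: z_def\<close>)
    show ?case using acorr_tendsto by blast
  qed
qed

end


section \<open>From the Ornstein-Uhlenbeck process to consistency of the estimator\<close>

theorem lemma3p4:
  fixes P :: "'a measure" and L Y :: "real \<Rightarrow> 'a \<Rightarrow> real" and F\<^sub>L :: "real measure"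
    and Z :: "'a \<Rightarrow> real" and M lambda\<^sub>o :: real and K :: "real set" and d :: nat
  assumes levy: "levy_process P L"
    and levy_measure: "is_levy_measure P L F\<^sub>L"
    and nondegenerate: "\<not> (\<exists>c. AE \<omega> in P. L 1 \<omega> = c)"
    and M_pos: "M > 0"
    and exp_moments: "\<And>v. \<bar>v\<bar> \<le> M \<Longrightarrow> (\<integral>\<^sup>+x\<in>{x. 1 < \<bar>x\<bar>}. ennreal (exp (v * x)) \<partial>F\<^sub>L) < \<infinity>"
    and lambda_pos: "lambda\<^sub>o > 0"
    and Y_rv: "\<And>t. t \<ge> 0 \<Longrightarrow> Y t \<in> borel_measurable P"
    and Y_eq: "\<And>t. t \<ge> 0 \<Longrightarrow> AE \<omega> in P.
       Y t \<omega> = exp (- lambda\<^sub>o * t) * Y 0 \<omega>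
             + exp (- lambda\<^sub>o * t) * RS_integral exp (\<lambda>s. L s \<omega>) 0 (lambda\<^sub>o * t)"
    and Y0_indep: "prob_space.indep_set P
       (sets (vimage_algebra (space P) (Y 0) borel))
       (sets (vimage_algebra (space P) (\<lambda>\<omega>. \<lambda>t\<in>{0..}. L t \<omega>) (Pi\<^sub>M {0..} (\<lambda>_. borel))))"
    and Z_rv: "Z \<in> borel_measurable P"
    and Z_eq: "AE \<omega> in P.
       ((\<lambda>T. RS_integral (\<lambda>s. exp (- s)) (\<lambda>s. L s \<omega>) 0 T) \<longlongrightarrow> Z \<omega>) at_top"
    and Y0_distr: "distr P borel (Y 0) = distr P borel Z"
    and K: "compact K" "K \<subseteq> {0..}" "lambda\<^sub>o \<in> K"
  shows "(\<forall>n\<ge>1. \<forall>\<omega>\<in>space P. \<exists>l. is_acf_estimate K d n (\<lambda>i. Y (real i) \<omega>) l) \<and>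
    (d \<ge> 1 \<longrightarrow>
      (\<forall>n\<ge>1. \<forall>\<omega>\<in>space P. \<forall>l. is_acf_estimate K d n (\<lambda>i. Y (real i) \<omega>) l \<longrightarrow>
         (\<exists>\<epsilon>>0. \<forall>l'. is_acf_estimate K d n (\<lambda>i. Y (real i) \<omega>) l' \<and> \<bar>l' - l\<bar> < \<epsilon> \<longrightarrow> l' = l)) \<and>
      (AE \<omega> in P. \<forall>l :: nat \<Rightarrow> real.
         (\<forall>n\<ge>1. is_acf_estimate K d n (\<lambda>i. Y (real i) \<omega>) (l n)) \<longrightarrow> l \<longlonglongrightarrow> lambda\<^sub>o))"
proof -
  have est_exists: "\<exists>l. is_acf_estimate K d n y l" for n y
    using K by (intro acf_estimate_exists) auto
  have isolated: "\<exists>\<epsilon>>0. \<forall>l'. is_acf_estimate K d n y l' \<and> \<bar>l' - l\<bar> < \<epsilon> \<longrightarrow> l' = l"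
    if d: "d \<ge> 1" for n y l
  proof -
    obtain \<epsilon> where e: "\<epsilon> > 0" "\<forall>l'\<in>{l. is_acf_estimate K d n y l}. l' \<noteq> l \<longrightarrow> \<epsilon> \<le> dist l l'"
      using finite_set_avoid[OF acf_estimates_finite[OF d]] by blast
    show ?thesis
      using e by (intro exI[of _ \<epsilon>]) (auto simp: dist_real_def abs_minus_commute not_le[symmetric])
  qed
  have prob: "prob_space P" using levy by (rule levy_processD)
  interpret prob_space P by (rule prob)
  have F: "sets F\<^sub>L = sets borel" "integrable F\<^sub>L (\<lambda>x. min 1 (x\<^sup>2))"
    using levy_measure by (auto simp: is_levy_measure_def)
  obtain b c where bc: "0 \<le> c"
    "\<And>t u. 0 \<le> t \<Longrightarrow> char (distr P borel (L t)) u = exp (of_real t * levy_exponent b c F\<^sub>L u)"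
    using levy_measure unfolding is_levy_measure_def by blast
  define \<psi> where "\<psi> = levy_exponent b c F\<^sub>L"
  have F_sq: "integrable F\<^sub>L (\<lambda>x. x\<^sup>2)"
    using exp_moments[of M] exp_moments[of "- M"] M_pos
    by (intro integrable_square_if_exp_moment[OF F M_pos]) simp_all
  obtain C where C: "0 \<le> C" "\<And>u. \<bar>u\<bar> \<le> 1 \<Longrightarrow> norm (\<psi> u) \<le> C * \<bar>u\<bar>"
    "\<And>u. \<bar>u\<bar> \<le> 1 \<Longrightarrow> \<bar>Re (\<psi> u)\<bar> \<le> C * u\<^sup>2"
    using levy_exponent_bounds[OF F(1) F_sq bc(1), of b] unfolding \<psi>_def by blast
  interpret levy_grid P L \<psi> lambda\<^sub>o
    by unfold_locales (use levy bc lambda_pos in \<open>auto simp: \<psi>_def\<close>)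
  define a where "a = exp (- lambda\<^sub>o)"
  have a: "0 < a" "a < 1" using lambda_pos by (auto simp: a_def)
  define y where "y i = Y (real i)" for i :: nat
  define X where "X i \<omega> = y (Suc i) \<omega> - a * y i \<omega>" for i \<omega>
  have y_rv[measurable]: "y i \<in> borel_measurable P" for i
    unfolding y_def by (rule Y_rv) simp
  have X_rv[measurable]: "X i \<in> borel_measurable P" for i
    unfolding X_def[abs_def] by measurable
  have pow: "exp (- lambda\<^sub>o * real i) = a ^ i" for i
    unfolding a_def by (rule exp_of_nat2_mult)
  \<comment> \<open>Subtracting \<open>a\<close> times the equation at time \<open>i\<close> from
    the one at time \<open>i + 1\<close> cancels \<open>Y 0\<close>. For \<open>i = 0\<close> the
    initial value is itself the observation, and there is no integral to subtract.\<close>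
  have innovation: "AE \<omega> in P. y (Suc i) \<omega> - exp (- lambda\<^sub>o) * y i \<omega> =
      exp (- lambda\<^sub>o * real (Suc i)) *
        (RS_integral exp (\<lambda>s. L s \<omega>) 0 (lambda\<^sub>o * real (Suc i)) -
          (if i = 0 then 0 else RS_integral exp (\<lambda>s. L s \<omega>) 0 (lambda\<^sub>o * real i)))" for i
  proof (cases "i = 0")
    case True
    from Y_eq[of "real (Suc i)"] show ?thesis
      by (rule AE_mp) (use True in \<open>auto simp: y_def\<close>)
  next
    case False
    from Y_eq[of "real (Suc i)", OF of_nat_0_le_iff] Y_eq[of "real i", OF of_nat_0_le_iff] show ?thesis
    proof eventually_elim
      case (elim \<omega>)
      then show ?case
        using False unfolding pow a_def[symmetric] y_def by (simp add: algebra_simps)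
    qed
  qed
  have lim: "AE \<omega> in P. (\<lambda>N. innov_sum (m * Suc N) i \<omega>) \<longlonglongrightarrow> X i \<omega>" if "0 < m" for m i
    unfolding X_def a_def by (rule innov_sum_tendsto[OF that innovation])
  have lim1: "AE \<omega> in P. (\<lambda>N. innov_sum (Suc N) i \<omega>) \<longlonglongrightarrow> X i \<omega>" for i
    using lim[of 1 i] by simp
  \<comment> \<open>\<open>m = 1\<close> serves for the common law and the second moment;
    \<open>m = q\<close> is needed for nondegeneracy, where the modulus is controlled only on
    multiples of \<open>q\<close>.\<close>
  have char_lim: "(\<lambda>N. exp (log_char (m * Suc N) u)) \<longlonglongrightarrow> char (distr P borel (X i)) u" if "0 < m" for m i u
    using char_AE_limit[OF innov_sum_rv X_rv lim[OF that], of i u] that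
    by (simp add: char_innov_sum del: mult_Suc_right)
  interpret X0: real_distribution "distr P borel (X 0)"
    by (intro real_distribution_distr X_rv)
  have "indep_vars (\<lambda>_. borel) X {..<n}" for n
    by (rule indep_vars_AE_limit[where X = "\<lambda>N. innov_sum (Suc N)"]) (simp_all add: indep_innov_sum lim1)
  moreover have "distr P borel (X n) = distr P borel (X 0)" for n
  proof (rule Levy_uniqueness)
    show "char (distr P borel (X n)) = char (distr P borel (X 0))"
      by (intro ext LIMSEQ_unique[OF char_lim[of 1] char_lim[of 1]]) simp_all
  qed (intro real_distribution_distr X_rv)+
  moreover have "integrable P (\<lambda>\<omega>. (X 0 \<omega>)\<^sup>2)"
  proof -
    have char_bound: "1 - Re (char (distr P borel (X 0)) u) \<le> (lambda\<^sub>o * C + (lambda\<^sub>o * C)\<^sup>2) * u\<^sup>2" if "\<bar>u\<bar> \<le> 1" for u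
    proof (rule LIMSEQ_le_const2)
      show "(\<lambda>N. 1 - Re (exp (log_char (1 * Suc N) u))) \<longlonglongrightarrow> 1 - Re (char (distr P borel (X 0)) u)"
        by (intro tendsto_intros char_lim) simp
      show "\<exists>N0. \<forall>N\<ge>N0. 1 - Re (exp (log_char (1 * Suc N) u)) \<le> (lambda\<^sub>o * C + (lambda\<^sub>o * C)\<^sup>2) * u\<^sup>2"
        using innov_char_Re[OF _ C that] by simp
    qed
    have "integrable (distr P borel (X 0)) (\<lambda>x. x\<^sup>2)"
      by (rule X0.integrable_square_if_char) (rule char_bound)
    then show ?thesis
      by (simp add: integrable_distr_eq)
  qed
  moreover have "\<not> (\<exists>c. AE \<omega> in P. X 0 \<omega> = c)"
  proof
    assume "\<exists>c. AE \<omega> in P. X 0 \<omega> = c"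
    then obtain c where c: "AE \<omega> in P. X 0 \<omega> = c" by blast
    obtain q :: nat and u r where q: "0 < q" "r < 1" "\<And>N. norm (exp (log_char (q * Suc N) u)) \<le> r"
      by (rule innov_char_bound[OF nondegenerate]) (rule that)
    have "norm (char (distr P borel (X 0)) u) \<le> r"
    proof (rule LIMSEQ_le_const2)
      show "(\<lambda>N. norm (exp (log_char (q * Suc N) u))) \<longlonglongrightarrow> norm (char (distr P borel (X 0)) u)"
        by (intro tendsto_intros char_lim q)
      show "\<exists>N0. \<forall>N\<ge>N0. norm (exp (log_char (q * Suc N) u)) \<le> r" using q(3) by blast
    qed
    \<comment> \<open>A constant variable has a characteristic function of modulus 1 everywhere,
      against the bound \<open>r < 1\<close>.\<close>
    moreover have "char (distr P borel (X 0)) u = iexp (u * c)"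
    proof -
      have "char (distr P borel (X 0)) u = (CLINT \<omega>|P. iexp (u * X 0 \<omega>))"
        by (simp add: char_def integral_distr)
      also have "\<dots> = (CLINT \<omega>|P. iexp (u * c))"
        using c by (intro integral_cong_AE) auto
      finally show ?thesis by (simp add: prob_space)
    qed
    ultimately show False using q(2) by simp
  qed
  ultimately have acorr: "AE \<omega> in P. \<forall>h. (\<lambda>n. emp_acorr n (\<lambda>i. y i \<omega>) h) \<longlonglongrightarrow> a ^ h"
    using a by (intro iid_stable_ar1[where X = X]) (auto simp: X_def)
  have "AE \<omega> in P. \<forall>l :: nat \<Rightarrow> real.
      (\<forall>n\<ge>1. is_acf_estimate K d n (\<lambda>i. Y (real i) \<omega>) (l n)) \<longrightarrow> l \<longlonglongrightarrow> lambda\<^sub>o" if "d \<ge> 1"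
    using acorr
  proof eventually_elim
    case (elim \<omega>)
    then show ?case
      using acf_estimate_tendsto[OF that K(3), of "\<lambda>i. Y (real i) \<omega>"] unfolding y_def a_def by blast
  qed
  with est_exists isolated show ?thesis by blast
qed

end
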